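(* Let $N\ge 1$, let $\Omega\subset\mathbb{R}^N$ be a bounded domain, and let $1<p<\infty$. Let $\ell\in\{0,\infty\}$ and let $f\colon\mathbb{R}\to\mathbb{R}$ be a continuous function; put $F(s)=\int_0^s f(t)\,\mathrm{d}t$ for $s\ge 0$. Suppose that there exists a sequence $\{\alpha_n\}\subset(0,\infty)$ such that $\alpha_n\to\ell$ and $f(\alpha_n)=0$ for every $n\in\mathbb{N}$, and that $$-\infty<L^-=\liminf_{s\to\ell}\frac{F(s)}{s^p}\le\limsup_{s\to\ell}\frac{F(s)}{s^p}=L^+<\infty.$$ Then there exists $\underline{\lambda}\in(0,\infty]$ such that no $\lambda\in[0,\underline{\lambda})$ is a bifurcation point from $\ell$ for the problem $$-\Delta_p u=\lambda f(u)\ \text{ in }\Omega,\qquad u=0\ \text{ on }\partial\Omega.$$ Furthermore, if $L^+<0$ or $L^-=L^+=0$, then this holds with $\underline{\lambda}=\infty$.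
   Context: $\Delta_p u=\operatorname{div}(|\nabla u|^{p-2}\nabla u)$ is the $p$-Laplacian. The limits as $s\to\ell$ are taken as $s\to 0^+$ if $\ell=0$ and as $s\to\infty$ if $\ell=\infty$. Bounded solutions are understood in the weak sense: $u\in W^{1,p}_0(\Omega)\cap L^\infty(\Omega)$ with $\int_\Omega|\nabla u|^{p-2}\nabla u\cdot\nabla\varphi=\lambda\int_\Omega f(u)\varphi$ for all $\varphi\in W^{1,p}_0(\Omega)\cap L^\infty(\Omega)$. A value $\tilde\lambda\ge 0$ is a bifurcation point from $\ell\in\{0,\infty\}$ for the problem if there exists a sequence of pairs $\{(\lambda_n,u_n)\}\subset(0,\infty)\times L^\infty(\Omega)$, with $u_n\ge 0$, $u_n\not\equiv 0$, and $u_n$ a solution of the problem with $\lambda=\lambda_n$, such that $\lambda_n\to\tilde\lambda$ and $\|u_n\|_{L^\infty(\Omega)}\to\ell$. *)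

theory Defs
  imports "HOL-Analysis.Analysis" "HOL-Probability.Essential_Supremum"
begin

text \<open>
  Functions on \<open>\<Omega>\<close> are represented by total functions whose values outside \<open>\<Omega>\<close> are
  irrelevant; Lebesgue and Sobolev functions are representatives of their a.e.-classes.
\<close>

text \<open>Coordinates of the gradient are the partial derivatives.\<close>

definition grad :: "('a::euclidean_space \<Rightarrow> real) \<Rightarrow> 'a \<Rightarrow> 'a" where
  "grad \<phi> x = (\<Sum>b\<in>Basis. frechet_derivative \<phi> (at x) b *\<^sub>R b)"

primrec C_k :: "nat \<Rightarrow> ('a::euclidean_space \<Rightarrow> real) \<Rightarrow> bool" where
  "C_k 0 \<phi> \<longleftrightarrow> continuous_on UNIV \<phi>"
| "C_k (Suc k) \<phi> \<longleftrightarrow>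
     (\<forall>x. \<phi> differentiable at x) \<and> (\<forall>v. C_k k (\<lambda>x. frechet_derivative \<phi> (at x) v))"

definition Cc_infinity :: "'a::euclidean_space set \<Rightarrow> ('a \<Rightarrow> real) set" where
  "Cc_infinity \<Omega> =
     {\<phi>. (\<forall>k. C_k k \<phi>) \<and> compact (closure {x. \<phi> x \<noteq> 0}) \<and> closure {x. \<phi> x \<noteq> 0} \<subseteq> \<Omega>}"

definition Lp :: "'a::euclidean_space set \<Rightarrow> real \<Rightarrow> ('a \<Rightarrow> 'b::euclidean_space) set" where
  "Lp \<Omega> p = {u. u \<in> borel_measurable (lebesgue_on \<Omega>) \<and>
                 integrable (lebesgue_on \<Omega>) (\<lambda>x. norm (u x) powr p)}"

definition Linf_norm :: "'a::euclidean_space set \<Rightarrow> ('a \<Rightarrow> real) \<Rightarrow> ereal" where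
  "Linf_norm \<Omega> u = esssup (lebesgue_on \<Omega>) (\<lambda>x. ereal \<bar>u x\<bar>)"

definition Linf :: "'a::euclidean_space set \<Rightarrow> ('a \<Rightarrow> real) set" where
  "Linf \<Omega> = {u. u \<in> borel_measurable (lebesgue_on \<Omega>) \<and> Linf_norm \<Omega> u < \<infinity>}"

text \<open>
  \<open>W1p \<Omega> p u Du\<close>: \<open>u\<close> belongs to $W^{1,p}(\Omega)$ and \<open>Du\<close> is (a representative of) its weak
  gradient, which is unique a.e. in \<open>\<Omega>\<close>. The integration by parts formula is vector-valued,
  i.e. it holds for each partial derivative.
\<close>

definition W1p ::
  "'a::euclidean_space set \<Rightarrow> real \<Rightarrow> ('a \<Rightarrow> real) \<Rightarrow> ('a \<Rightarrow> 'a) \<Rightarrow> bool" where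
  "W1p \<Omega> p u Du \<longleftrightarrow> u \<in> Lp \<Omega> p \<and> Du \<in> Lp \<Omega> p \<and>
     (\<forall>\<phi>\<in>Cc_infinity \<Omega>. (LINT x|lebesgue_on \<Omega>. u x *\<^sub>R grad \<phi> x)
                         = - (LINT x|lebesgue_on \<Omega>. \<phi> x *\<^sub>R Du x))"

text \<open>
  $W^{1,p}_0(\Omega)$, the closure of $C_c^\infty(\Omega)$ in $W^{1,p}(\Omega)$; again \<open>Du\<close> is the weak
  gradient of \<open>u\<close>. The weak gradient of a test function is its classical gradient.
\<close>

definition W01p ::
  "'a::euclidean_space set \<Rightarrow> real \<Rightarrow> ('a \<Rightarrow> real) \<Rightarrow> ('a \<Rightarrow> 'a) \<Rightarrow> bool" where
  "W01p \<Omega> p u Du \<longleftrightarrow> W1p \<Omega> p u Du \<and>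
     (\<exists>\<phi>. (\<forall>n::nat. \<phi> n \<in> Cc_infinity \<Omega>) \<and>
        (\<lambda>n. ((LINT x|lebesgue_on \<Omega>. \<bar>\<phi> n x - u x\<bar> powr p) +
              (LINT x|lebesgue_on \<Omega>. norm (grad (\<phi> n) x - Du x) powr p)) powr (1 / p))
          \<longlonglongrightarrow> 0)"

text \<open>
  For \<open>1 < p < 2\<close> the field $|\nabla u|^{p-2}\nabla u$ is read as \<open>0\<close> where the gradient vanishes,
  which is what \<open>0 powr (p - 2) = 0\<close> yields.
\<close>

definition bounded_solution ::
  "'a::euclidean_space set \<Rightarrow> real \<Rightarrow> (real \<Rightarrow> real) \<Rightarrow> real \<Rightarrow> ('a \<Rightarrow> real) \<Rightarrow> bool" where
  "bounded_solution \<Omega> p f lam u \<longleftrightarrow> u \<in> Linf \<Omega> \<and>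
     (\<exists>Du. W01p \<Omega> p u Du \<and>
        (\<forall>\<phi> D\<phi>. W01p \<Omega> p \<phi> D\<phi> \<and> \<phi> \<in> Linf \<Omega> \<longrightarrow>
           (LINT x|lebesgue_on \<Omega>. (norm (Du x) powr (p - 2) *\<^sub>R Du x) \<bullet> D\<phi> x)
             = lam * (LINT x|lebesgue_on \<Omega>. f (u x) * \<phi> x)))"

definition bifurcation_point ::
  "'a::euclidean_space set \<Rightarrow> real \<Rightarrow> (real \<Rightarrow> real) \<Rightarrow> ereal \<Rightarrow> real \<Rightarrow> bool" where
  "bifurcation_point \<Omega> p f l \<mu> \<longleftrightarrow> 0 \<le> \<mu> \<and>
     (\<exists>(lams :: nat \<Rightarrow> real) (us :: nat \<Rightarrow> 'a \<Rightarrow> real).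
        (\<forall>n. 0 < lams n \<and>
             bounded_solution \<Omega> p f (lams n) (us n) \<and>
             (AE x in lebesgue_on \<Omega>. 0 \<le> us n x) \<and>
             \<not> (AE x in lebesgue_on \<Omega>. us n x = 0)) \<and>
        lams \<longlonglongrightarrow> \<mu> \<and>
        (\<lambda>n. Linf_norm \<Omega> (us n)) \<longlonglongrightarrow> l)"

text \<open>The filter for \<open>s \<rightarrow> l\<close>; only meant for \<open>l = 0\<close> and \<open>l = \<infinity>\<close>.\<close>

definition tends_to_end :: "ereal \<Rightarrow> real filter" where
  "tends_to_end l = (if l = 0 then at_right 0 else at_top)"

end

theory Submission
  imports Defs "HOL-Real_Asymp.Real_Asymp"
begin

text \<open>
  A nonnegative solution \<open>u\<close> whose supremum is \<open>M\<close> is compared with one-dimensional barriers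
  \<open>x \<mapsto> w (x \<bullet> e + k)\<close>, where \<open>e\<close> is a fixed direction and \<open>w\<close> increases from \<open>w 0 = 0\<close>. Let \<open>w\<close>
  solve the energy equation \<open>w' = g w\<close> with \<open>g s powr p = p / (p - 1) * H s\<close> and
  \<open>H s = E - lam * F s - \<eta> * s\<close>. Then \<open>- (w' powr (p - 1))' = - H' w = lam * f w + \<eta>\<close>, so that
  \<open>w\<close> is a strict supersolution where its values lie in \<open>{0..M}\<close>. All that is needed is \<open>H > 0\<close> on
  \<open>{0..M}\<close>, and this holds as soon as \<open>E\<close> exceeds \<open>lam\<close> times the maximum of \<open>F\<close> and \<open>\<eta> > 0\<close> is
  small (lemma \<open>barrier_profile\<close>).

  For large \<open>k\<close> the barrier lies above \<open>M\<close>, hence above \<open>u\<close>. As long as \<open>x \<bullet> e + k \<ge> 0\<close> on \<open>\<Omega>\<close>, it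
  can be slid down without falling below \<open>u\<close> (lemma \<open>sliding_comparison\<close>): at the boundary \<open>u\<close> vanishes
  and the barrier is nonnegative, and an interior contact is excluded because \<open>w\<close> is a strict
  supersolution. The contact argument works for a \<open>u\<close> that is only measurable. If
  \<open>u \<le> w (x \<bullet> e + k + h)\<close> with a small \<open>h\<close>, then \<open>u\<close> is close to \<open>w (x \<bullet> e + k)\<close> wherever it is
  larger, so that \<open>lam * f u\<close> is still smaller there than the right-hand side of the barrier; testing with
  the positive part of \<open>u - w\<close> and the monotonicity of the \<open>p\<close>-Laplacian show that this set is
  null (lemma \<open>weak_comparison\<close>).

  If \<open>x \<bullet> e + k\<close> ranges in \<open>{0..D}\<close> for the last \<open>k\<close>, sliding gives \<open>u \<le> w D\<close>. There is thus no
  solution with supremum \<open>M\<close> when \<open>w D < M\<close>, that is, when the time which \<open>w\<close> needs to reach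
  \<open>M\<close>, the integral of \<open>1 / g\<close> over \<open>{0..M}\<close>, exceeds \<open>D\<close>. If \<open>- C * s powr p \<le> F s \<le> A * s powr p\<close>, then
  \<open>g s \<le> \<kappa> * (s + B)\<close> with \<open>\<kappa> powr p\<close> proportional to \<open>lam * C\<close> and \<open>B powr p\<close> roughly
  \<open>A / C * M powr p\<close>, so this time is at least \<open>ln (1 + M / B) / \<kappa>\<close>, and the condition becomes, up
  to an arbitrarily small error, \<open>exp (\<kappa> * D) - 1 < (C / A) powr (1 / p)\<close> (lemma \<open>no_bounded_solution\<close>). With
  \<open>A = C\<close> it holds for small \<open>lam\<close>. If \<open>L\<^sup>+ \<le> 0\<close>, then \<open>A\<close> may be taken arbitrarily small while
  \<open>C\<close> stays fixed, and it holds for every \<open>lam\<close>.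

  Test functions in the closure of the smooth ones are obtained from \<open>u\<close> by smooth compositions:
  the barrier is replaced by a nearby polynomial (lemma \<open>polynomial_barrier\<close>) and the positive part by
  a smooth function (lemma \<open>Cc_approx_softplus\<close>).
\<close>

section \<open>Smooth functions\<close>

abbreviation smooth :: "('a::euclidean_space \<Rightarrow> real) \<Rightarrow> bool" where
  "smooth \<phi> \<equiv> \<forall>k. C_k k \<phi>"

lemma C_k_SucI:
  assumes "\<And>x. (\<phi> has_derivative \<phi>' x) (at x)" "\<And>v. C_k k (\<lambda>x. \<phi>' x v)"
  shows "C_k (Suc k) \<phi>"
proof -
  have "frechet_derivative \<phi> (at x) = \<phi>' x" for x
    using frechet_derivative_at[OF assms(1)] by simp
  then show ?thesis
    using assms by (auto simp: differentiable_def)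
qed

lemma C_k_has_derivative:
  assumes "C_k (Suc k) \<phi>"
  shows "(\<phi> has_derivative frechet_derivative \<phi> (at x)) (at x)"
  using assms by (simp add: frechet_derivative_works[symmetric])

lemma C_k_SucD: "C_k (Suc k) \<phi> \<Longrightarrow> C_k k \<phi>"
proof (induction k arbitrary: \<phi>)
  case 0
  then show ?case
    by (auto intro!: continuous_at_imp_continuous_on differentiable_imp_continuous_within)
next
  case (Suc k)
  then show ?case
    by (metis C_k.simps(2))
qed

lemma C_k_const: "C_k k (\<lambda>x. c)"
proof (induction k arbitrary: c)
  case (Suc k)
  show ?case
    by (rule C_k_SucI[OF has_derivative_const]) (rule Suc)
qed auto

lemma C_k_inner: "C_k k (\<lambda>x. x \<bullet> e)"
proof (cases k)
  case (Suc k')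
  show ?thesis unfolding Suc
    by (rule C_k_SucI[where \<phi>'="\<lambda>x v. v \<bullet> e"])
      (auto intro!: derivative_eq_intros C_k_const)
qed (auto intro!: continuous_intros)

lemma C_k_add: "C_k k \<phi> \<Longrightarrow> C_k k \<psi> \<Longrightarrow> C_k k (\<lambda>x. \<phi> x + \<psi> x)"
proof (induction k arbitrary: \<phi> \<psi>)
  case (Suc k)
  show ?case
    by (rule C_k_SucI[OF has_derivative_add[OF C_k_has_derivative[OF Suc.prems(1)]
            C_k_has_derivative[OF Suc.prems(2)]]])
      (use Suc in auto)
qed (auto intro!: continuous_intros)

lemma C_k_mult: "C_k k \<phi> \<Longrightarrow> C_k k \<psi> \<Longrightarrow> C_k k (\<lambda>x. \<phi> x * \<psi> x)"
proof (induction k arbitrary: \<phi> \<psi>)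
  case (Suc k)
  show ?case
    by (rule C_k_SucI[OF has_derivative_mult[OF C_k_has_derivative[OF Suc.prems(1)]
            C_k_has_derivative[OF Suc.prems(2)]]])
      (use Suc C_k_SucD in \<open>auto intro!: C_k_add Suc.IH\<close>)
qed (auto intro!: continuous_intros)

lemma C_k_diff: "C_k k \<phi> \<Longrightarrow> C_k k \<psi> \<Longrightarrow> C_k k (\<lambda>x. \<phi> x - \<psi> x)"
  using C_k_add[OF _ C_k_mult[OF C_k_const[of k "-1"]], of \<phi> \<psi>] by simp

lemma C_k_polynomial:
  fixes q :: "real \<Rightarrow> real"
  assumes "real_polynomial_function q" "C_k k \<phi>"
  shows "C_k k (\<lambda>x. q (\<phi> x))"
  using assms(1)
proof induction
  case (linear h)
  then obtain c where "h = (\<lambda>t. t * c)"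
    by (auto simp: real_bounded_linear)
  then show ?case using C_k_mult[OF assms(2) C_k_const] by simp
qed (auto intro: C_k_const C_k_add C_k_mult)

text \<open>A smooth approximation of the positive part and its derivative. The logistic function is
  convenient because its derivative is a polynomial in itself, so that smoothness is an induction
  with products only. The shift by \<open>sqrt \<epsilon>\<close>, which tends to zero more slowly than the width \<open>\<epsilon>\<close> of
  the transition, makes \<open>logistic \<epsilon>\<close> converge to the indicator function of the \<^emph>\<open>open\<close> half line,
  so that the gradients of the test functions converge also on the set where \<open>u = w\<close>.\<close>

definition logistic :: "real \<Rightarrow> real \<Rightarrow> real" where
  "logistic \<epsilon> t = 1 / (1 + exp (- ((t - sqrt \<epsilon>) / \<epsilon>)))"

definition softplus :: "real \<Rightarrow> real \<Rightarrow> real" where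
  "softplus \<epsilon> t = \<epsilon> * ln (1 + exp ((t - sqrt \<epsilon>) / \<epsilon>))"

lemma logistic_bounds: "0 < logistic \<epsilon> t" "logistic \<epsilon> t < 1" "0 \<le> logistic \<epsilon> t" "logistic \<epsilon> t \<le> 1"
proof -
  show "0 < logistic \<epsilon> t"
    unfolding logistic_def by (smt (verit) exp_gt_zero zero_less_divide_1_iff)
  show "logistic \<epsilon> t < 1"
    unfolding logistic_def by (simp add: add_pos_pos)
  then show "0 \<le> logistic \<epsilon> t" "logistic \<epsilon> t \<le> 1" using \<open>0 < logistic \<epsilon> t\<close> by auto
qed

lemma DERIV_softplus:
  assumes "\<epsilon> > 0" shows "(softplus \<epsilon> has_real_derivative logistic \<epsilon> t) (at t)"
proof -
  define y where "y = exp ((t - sqrt \<epsilon>) / \<epsilon>)"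
  have "y > 0" by (simp add: y_def)
  then have "0 < 1 + y" by linarith
  then have "(softplus \<epsilon> has_real_derivative \<epsilon> * (y * (1 / \<epsilon>) / (1 + y))) (at t)"
    unfolding softplus_def y_def using assms by (auto intro!: derivative_eq_intros)
  moreover have "\<epsilon> * (y * (1 / \<epsilon>) / (1 + y)) = logistic \<epsilon> t"
    using assms \<open>y > 0\<close> unfolding logistic_def exp_minus y_def[symmetric]
    by (simp add: divide_simps)
  ultimately show ?thesis by simp
qed

lemma DERIV_logistic:
  assumes "\<epsilon> > 0"
  shows "(logistic \<epsilon> has_real_derivative (1 / \<epsilon>) * (logistic \<epsilon> t * (1 - logistic \<epsilon> t))) (at t)"
proof -
  have "0 < exp (- ((t - sqrt \<epsilon>) / \<epsilon>))" by simp
  then have "1 + exp (- ((t - sqrt \<epsilon>) / \<epsilon>)) \<noteq> 0" by linarith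
  then show ?thesis
    unfolding logistic_def using assms
    by (auto intro!: derivative_eq_intros simp: field_simps power2_eq_square)
qed

lemma continuous_on_logistic: "\<epsilon> > 0 \<Longrightarrow> continuous_on S (logistic \<epsilon>)"
  using DERIV_logistic by (meson DERIV_isCont continuous_at_imp_continuous_on)

lemma continuous_on_softplus: "\<epsilon> > 0 \<Longrightarrow> continuous_on S (softplus \<epsilon>)"
  using DERIV_softplus by (meson DERIV_isCont continuous_at_imp_continuous_on)

text \<open>By induction on \<open>k\<close>: the derivative of \<open>logistic \<epsilon> \<circ> \<phi>\<close> is
  \<open>logistic \<epsilon> \<circ> \<phi>\<close> times factors that are known to be of class \<open>C_k k\<close>.\<close>

lemma C_k_logistic:
  assumes "\<epsilon> > 0" shows "C_k k \<phi> \<Longrightarrow> C_k k (\<lambda>x. logistic \<epsilon> (\<phi> x))"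
proof (induction k)
  case 0
  then show ?case
    using continuous_on_compose2[OF continuous_on_logistic[OF assms, of UNIV]] by auto
next
  case (Suc k)
  have "((\<lambda>x. logistic \<epsilon> (\<phi> x)) has_derivative (\<lambda>v. ((1 / \<epsilon>) * (logistic \<epsilon> (\<phi> x) *
      (1 - logistic \<epsilon> (\<phi> x)))) * frechet_derivative \<phi> (at x) v)) (at x)" for x
    using has_derivative_compose[OF C_k_has_derivative[OF Suc.prems],
        OF DERIV_logistic[OF assms, THEN has_field_derivative_imp_has_derivative]] by simp
  then show ?case
    by (rule C_k_SucI)
      (use Suc C_k_SucD[OF Suc.prems] in
        \<open>auto simp del: times_divide_eq_left intro!: C_k_mult C_k_diff C_k_const\<close>)
qed

lemma C_k_softplus:
  assumes "\<epsilon> > 0" "C_k k \<phi>" shows "C_k k (\<lambda>x. softplus \<epsilon> (\<phi> x))"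
proof (cases k)
  case 0
  then show ?thesis
    using assms continuous_on_compose2[OF continuous_on_softplus[OF assms(1), of UNIV]] by auto
next
  case (Suc k')
  have "((\<lambda>x. softplus \<epsilon> (\<phi> x)) has_derivative
      (\<lambda>v. logistic \<epsilon> (\<phi> x) * frechet_derivative \<phi> (at x) v)) (at x)" for x
    using has_derivative_compose[OF C_k_has_derivative[OF assms(2)[unfolded Suc]],
        OF DERIV_softplus[OF assms(1), THEN has_field_derivative_imp_has_derivative]] by simp
  then show ?thesis unfolding Suc
    by (rule C_k_SucI)
      (use assms Suc C_k_SucD in \<open>auto intro!: C_k_mult C_k_logistic\<close>)
qed

lemma softplus_lipschitz:
  assumes "\<epsilon> > 0" shows "\<bar>softplus \<epsilon> s - softplus \<epsilon> t\<bar> \<le> \<bar>s - t\<bar>"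
proof -
  have "norm (softplus \<epsilon> s - softplus \<epsilon> t) \<le> 1 * norm (s - t)"
    by (rule field_differentiable_bound[of UNIV _ "logistic \<epsilon>"])
      (use DERIV_softplus[OF assms] logistic_bounds[of \<epsilon>] in \<open>auto simp: abs_of_pos intro: less_imp_le\<close>)
  then show ?thesis by simp
qed

lemma softplus_bounds:
  assumes "\<epsilon> > 0" shows "max 0 (t - sqrt \<epsilon>) \<le> softplus \<epsilon> t" "softplus \<epsilon> t \<le> max 0 t + \<epsilon>"
proof -
  have "softplus \<epsilon> t \<ge> 0" using assms by (simp add: softplus_def)
  moreover have "ln (exp ((t - sqrt \<epsilon>) / \<epsilon>)) \<le> ln (1 + exp ((t - sqrt \<epsilon>) / \<epsilon>))"
    by (subst ln_le_cancel_iff) (auto simp: add_pos_pos)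
  then have "\<epsilon> * ((t - sqrt \<epsilon>) / \<epsilon>) \<le> softplus \<epsilon> t"
    unfolding softplus_def using assms by (intro mult_left_mono) auto
  ultimately show "max 0 (t - sqrt \<epsilon>) \<le> softplus \<epsilon> t" using assms by simp
  define m where "m = max 0 t / \<epsilon>"
  have "(t - sqrt \<epsilon>) / \<epsilon> \<le> m" "0 \<le> m"
    using assms by (auto simp: m_def divide_right_mono real_sqrt_ge_zero le_max_iff_disj)
  then have "1 + exp ((t - sqrt \<epsilon>) / \<epsilon>) \<le> exp m + exp m" by (intro add_mono) auto
  also have "\<dots> = 2 * exp m" by simp
  also have "\<dots> \<le> exp 1 * exp m"
    using exp_ge_add_one_self[of 1] by (intro mult_right_mono) auto
  also have "\<dots> = exp (m + 1)" by (simp add: exp_add)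
  finally have "ln (1 + exp ((t - sqrt \<epsilon>) / \<epsilon>)) \<le> ln (exp (m + 1))"
    by (subst ln_le_cancel_iff) (auto simp: add_pos_pos)
  then have "softplus \<epsilon> t \<le> \<epsilon> * (m + 1)"
    unfolding softplus_def using assms by (intro mult_left_mono) auto
  also have "\<epsilon> * (m + 1) = max 0 t + \<epsilon>" using assms by (simp add: m_def distrib_left)
  finally show "softplus \<epsilon> t \<le> max 0 t + \<epsilon>" .
qed

lemma softplus_tendsto: "(\<lambda>n. softplus (1 / Suc n) t) \<longlonglongrightarrow> max 0 t"
proof (rule tendsto_sandwich)
  have e: "(\<lambda>n. 1 / real (Suc n)) \<longlonglongrightarrow> 0"
    using LIMSEQ_inverse_real_of_nat by (simp add: divide_inverse)
  have "(\<lambda>n. max 0 (t - sqrt (1 / Suc n))) \<longlonglongrightarrow> max 0 (t - sqrt 0)"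
    by (intro tendsto_intros e)
  then show "(\<lambda>n. max 0 (t - sqrt (1 / Suc n))) \<longlonglongrightarrow> max 0 t" by simp
  have "(\<lambda>n. max 0 t + 1 / Suc n) \<longlonglongrightarrow> max 0 t + 0"
    by (intro tendsto_intros e)
  then show "(\<lambda>n. max 0 t + 1 / Suc n) \<longlonglongrightarrow> max 0 t" by simp
qed (use softplus_bounds in auto)

lemma logistic_tendsto: "(\<lambda>n. logistic (1 / Suc n) t) \<longlonglongrightarrow> (if 0 < t then 1 else 0)"
proof -
  have *: "(\<lambda>n::nat. (t - sqrt (1 / real n)) / (1 / real n)) = (\<lambda>n. t * real n - sqrt (1 / real n) * real n)"
    by (auto simp: field_simps)
  have "(\<lambda>n. logistic (1 / real n) t) \<longlonglongrightarrow> (if 0 < t then 1 else 0)"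
  proof (cases "0 < t")
    case True
    have "filterlim (\<lambda>n::nat. (t - sqrt (1 / real n)) / (1 / real n)) at_top at_top"
      using True unfolding * by real_asymp
    then have "(\<lambda>n::nat. exp (- ((t - sqrt (1 / real n)) / (1 / real n)))) \<longlonglongrightarrow> 0"
      by (intro filterlim_compose[OF exp_at_bot]) (simp only: filterlim_uminus_at_bot minus_minus)
    then have "(\<lambda>n. logistic (1 / real n) t) \<longlonglongrightarrow> 1 / (1 + 0)"
      unfolding logistic_def by (intro tendsto_intros) auto
    then show ?thesis using True by simp
  next
    case False
    have "filterlim (\<lambda>n::nat. - ((t - sqrt (1 / real n)) / (1 / real n))) at_top at_top"
    proof (rule filterlim_at_top_mono)
      show "filterlim (\<lambda>n::nat. sqrt (1 / real n) * real n) at_top at_top" by real_asymp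
      have "t * real n \<le> 0" for n :: nat using False by (simp add: mult_nonpos_nonneg)
      then show "\<forall>\<^sub>F n in sequentially. sqrt (1 / real n) * real n \<le> - ((t - sqrt (1 / real n)) / (1 / real n))"
        by (auto simp: field_simps)
    qed
    then have "filterlim (\<lambda>n::nat. exp (- ((t - sqrt (1 / real n)) / (1 / real n)))) at_top at_top"
      by (rule filterlim_compose[OF exp_at_top])
    then have "filterlim (\<lambda>n::nat. 1 + exp (- ((t - sqrt (1 / real n)) / (1 / real n)))) at_top at_top"
      by (rule filterlim_tendsto_add_at_top[OF tendsto_const])
    then have "(\<lambda>n. inverse (1 + exp (- ((t - sqrt (1 / real n)) / (1 / real n))))) \<longlonglongrightarrow> 0"
      using filterlim_compose[OF tendsto_inverse_0] filterlim_at_top_imp_at_infinity by blast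
    then show ?thesis using False by (simp add: logistic_def divide_inverse)
  qed
  then show ?thesis
    by (rule LIMSEQ_Suc)
qed

section \<open>Test functions\<close>

lemma grad_eqI:
  assumes "(\<phi> has_derivative (\<lambda>v. G \<bullet> v)) (at x)" shows "grad \<phi> x = G"
proof -
  have "frechet_derivative \<phi> (at x) = (\<lambda>v. G \<bullet> v)"
    using frechet_derivative_at[OF assms] by simp
  then show ?thesis by (simp add: grad_def euclidean_representation)
qed

lemma has_derivative_grad:
  assumes "\<phi> differentiable at x" shows "(\<phi> has_derivative (\<lambda>v. grad \<phi> x \<bullet> v)) (at x)"
proof -
  have d: "(\<phi> has_derivative frechet_derivative \<phi> (at x)) (at x)"
    using assms frechet_derivative_works by blast
  then have "linear (frechet_derivative \<phi> (at x))" by (rule has_derivative_linear)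
  then have "frechet_derivative \<phi> (at x) v = grad \<phi> x \<bullet> v" for v
    using Linear_Algebra.linear_componentwise[of "frechet_derivative \<phi> (at x)" v 1]
    by (simp add: grad_def inner_sum_right inner_commute[of _ v] mult.commute)
  then show ?thesis using d by presburger
qed

lemma Cc_infinity_compact_support:
  assumes "\<phi> \<in> Cc_infinity \<Omega>"
  obtains K where "compact K" "K \<subseteq> \<Omega>" "\<And>x. x \<notin> K \<Longrightarrow> \<phi> x = 0"
proof (rule that[of "closure {x. \<phi> x \<noteq> 0}"])
  show "\<phi> x = 0" if "x \<notin> closure {x. \<phi> x \<noteq> 0}" for x
    using that closure_subset[of "{x. \<phi> x \<noteq> 0}"] by auto
qed (use assms in \<open>auto simp: Cc_infinity_def\<close>)

lemma Cc_infinity_differentiable: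
  assumes "\<phi> \<in> Cc_infinity \<Omega>" shows "\<phi> differentiable at x"
  using assms unfolding Cc_infinity_def by (metis (mono_tags, lifting) C_k.simps(2) mem_Collect_eq)

lemma Cc_infinity_continuous:
  assumes "\<phi> \<in> Cc_infinity \<Omega>" shows "continuous_on UNIV \<phi>"
  using assms unfolding Cc_infinity_def by (metis (mono_tags, lifting) C_k.simps(1) mem_Collect_eq)

lemma Cc_infinity_continuous_grad:
  assumes "\<phi> \<in> Cc_infinity \<Omega>" shows "continuous_on UNIV (grad \<phi>)"
proof -
  have "C_k (Suc 0) \<phi>" using assms unfolding Cc_infinity_def by blast
  then show ?thesis unfolding grad_def by (auto intro!: continuous_intros)
qed

lemma derivative_eq_0_off_closed:
  fixes h :: "'a::euclidean_space \<Rightarrow> real"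
  assumes "closed K" "x \<notin> K" "\<And>x. x \<notin> K \<Longrightarrow> h x = 0" "(h has_derivative h') (at x)"
  shows "h' = (\<lambda>v. 0)"
proof (rule has_derivative_unique[OF assms(4)])
  show "(h has_derivative (\<lambda>v. 0)) (at x)"
    by (rule has_derivative_transform_within_open[where f="\<lambda>_. 0" and s="- K"])
      (use assms in \<open>auto simp: open_Compl\<close>)
qed

lemma grad_eq_0_off_support:
  assumes "\<phi> \<in> Cc_infinity \<Omega>" "compact K" "\<And>x. x \<notin> K \<Longrightarrow> \<phi> x = 0" "x \<notin> K"
  shows "grad \<phi> x = 0"
proof -
  have "(\<lambda>v. grad \<phi> x \<bullet> v) = (\<lambda>v. 0)"
    by (rule derivative_eq_0_off_closed[of K x \<phi>])
      (use assms has_derivative_grad[OF Cc_infinity_differentiable[OF assms(1)]]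
        in \<open>auto simp: compact_imp_closed\<close>)
  then show ?thesis by (metis inner_eq_zero_iff)
qed

lemma Cc_infinity_intro:
  assumes "smooth \<psi>" "\<phi> \<in> Cc_infinity \<Omega>" "\<And>x. \<phi> x = 0 \<Longrightarrow> \<psi> x = 0"
  shows "\<psi> \<in> Cc_infinity \<Omega>"
proof -
  have "closure {x. \<psi> x \<noteq> 0} \<subseteq> closure {x. \<phi> x \<noteq> 0}"
    using assms(3) by (intro closure_mono) auto
  moreover from this assms(2) have "compact (closure {x. \<psi> x \<noteq> 0})"
    unfolding Cc_infinity_def
    by (metis (mono_tags, lifting) closed_closure compact_Int_closed inf.absorb2 mem_Collect_eq)
  ultimately show ?thesis
    using assms unfolding Cc_infinity_def by blast
qed

lemma compactly_supported_bound:
  fixes h :: "'a::euclidean_space \<Rightarrow> 'b::euclidean_space"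
  assumes "compact K" "continuous_on K h" "\<And>x. x \<notin> K \<Longrightarrow> h x = 0"
  obtains B where "B > 0" "\<And>x. norm (h x) \<le> B"
proof -
  obtain B where B: "\<And>x. x \<in> K \<Longrightarrow> norm (h x) \<le> B"
    using compact_imp_bounded[OF compact_continuous_image[OF assms(2,1)]]
    by (auto simp: bounded_iff)
  have "norm (h x) \<le> max B 1" for x
    by (cases "x \<in> K") (use B[of x] assms(3)[of x] in auto)
  then show ?thesis using that[of "max B 1"] by auto
qed


section \<open>Integration by parts\<close>

text \<open>The difference quotients of \<open>h\<close> in the direction \<open>e\<close> have integral zero by translation
  invariance of the Lebesgue measure, and they converge boundedly on a fixed compact set.\<close>

lemma integral_directional_derivative_eq_0:
  fixes h :: "'a::euclidean_space \<Rightarrow> real"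
  assumes K: "compact K" "\<And>x. x \<notin> K \<Longrightarrow> h x = 0"
    and h': "\<And>x. (h has_derivative h' x) (at x)"
    and cont: "continuous_on UNIV (\<lambda>x. h' x e)"
  shows "(LINT x|lborel. h' x e) = 0"
proof -
  have "h' x = (\<lambda>v. 0)" if "x \<notin> K" for x
    using derivative_eq_0_off_closed[OF compact_imp_closed[OF K(1)] that K(2) h'] .
  then obtain B where B: "B > 0" "\<And>x. norm (h' x e) \<le> B"
    using compactly_supported_bound[of K "\<lambda>x. h' x e"] K(1) continuous_on_subset[OF cont]
    by (metis UNIV_I subsetI)
  \<comment> \<open>a compact set outside which all difference quotients with steps at most 1 vanish\<close>
  define K' where "K' = (\<lambda>(x, t). x - t *\<^sub>R e) ` (K \<times> {0..1})"
  have K': "compact K'"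
    unfolding K'_def
    by (intro compact_continuous_image compact_Times K compact_Icc)
      (auto simp: case_prod_unfold intro!: continuous_intros)
  define D where "D = (\<lambda>(n::nat) x. (h (x + (1 / Suc n) *\<^sub>R e) - h x) * Suc n)"
  have hcont: "continuous_on UNIV h"
    using h' by (meson continuous_at_imp_continuous_on has_derivative_continuous)
  have hint: "integrable lborel h"
  proof -
    have "(\<lambda>x. indicator K x *\<^sub>R h x) = h" using K(2) by (auto simp: indicator_def fun_eq_iff)
    then show ?thesis
      using borel_integrable_compact[OF K(1) continuous_on_subset[OF hcont]] by simp
  qed
  have der: "((\<lambda>t. h (x + t *\<^sub>R e)) has_real_derivative h' (x + t *\<^sub>R e) e) (at t)" for x t
  proof -
    have "((\<lambda>t. h (x + t *\<^sub>R e)) has_derivative (\<lambda>s. h' (x + t *\<^sub>R e) (s *\<^sub>R e))) (at t)"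
      by (rule has_derivative_compose[of "\<lambda>t. x + t *\<^sub>R e" _ t UNIV h, OF _ h'])
        (auto intro!: derivative_eq_intros)
    moreover have "(\<lambda>s. h' (x + t *\<^sub>R e) (s *\<^sub>R e)) = (\<lambda>s. h' (x + t *\<^sub>R e) e * s)"
      using has_derivative_linear[OF h'] by (auto simp: linear_cmul)
    ultimately show ?thesis by (simp add: has_field_derivative_def)
  qed
  have shift: "integrable lborel (\<lambda>x. h (x + c))" "(LINT x|lborel. h (x + c)) = (LINT x|lborel. h x)" for c
  proof -
    have [measurable]: "h \<in> borel_measurable borel" using hcont by (rule borel_measurable_continuous_onI)
    have "integrable (distr lborel borel ((+) c)) h" using hint by (simp add: lborel_distr_plus)
    then show "integrable lborel (\<lambda>x. h (x + c))"
      by (subst (asm) integrable_distr_eq) (auto simp: add.commute)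
    have "(LINT x|distr lborel borel ((+) c). h x) = (LINT x|lborel. h (c + x))"
      by (subst integral_distr) auto
    then show "(LINT x|lborel. h (x + c)) = (LINT x|lborel. h x)"
      by (simp add: lborel_distr_plus add.commute)
  qed
  have "(LINT x|lborel. D n x) = 0" for n
    unfolding D_def using shift hint by simp
  moreover have "(\<lambda>n. LINT x|lborel. D n x) \<longlonglongrightarrow> (LINT x|lborel. h' x e)"
  proof (rule integral_dominated_convergence[where w="\<lambda>x. indicator K' x *\<^sub>R B"])
    show "(\<lambda>x. h' x e) \<in> borel_measurable lborel"
      using cont by (simp add: borel_measurable_continuous_onI)
    show "D n \<in> borel_measurable lborel" for n
      unfolding D_def using shift hint by (auto intro!: borel_measurable_integrable)
    show "integrable lborel (\<lambda>x. indicator K' x *\<^sub>R B)"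
      by (rule borel_integrable_compact[OF K']) auto
    show "AE x in lborel. (\<lambda>n. D n x) \<longlonglongrightarrow> h' x e"
    proof (rule AE_I2)
      fix x
      have "((\<lambda>s. (h (x + s *\<^sub>R e) - h x) / s) \<longlongrightarrow> h' x e) (at 0)"
        using der[of x 0] unfolding DERIV_def by simp
      moreover have "filterlim (\<lambda>n. 1 / real (Suc n)) (at 0) sequentially"
        using LIMSEQ_inverse_real_of_nat
        by (auto simp: filterlim_at divide_inverse eventually_sequentially)
      ultimately have "(\<lambda>n. (h (x + (1 / real (Suc n)) *\<^sub>R e) - h x) / (1 / real (Suc n))) \<longlonglongrightarrow> h' x e"
        by (rule filterlim_compose)
      then show "(\<lambda>n. D n x) \<longlonglongrightarrow> h' x e" by (simp add: D_def)
    qed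
    show "AE x in lborel. norm (D n x) \<le> indicator K' x *\<^sub>R B" for n
    proof (rule AE_I2)
      fix x
      show "norm (D n x) \<le> indicator K' x *\<^sub>R B"
      proof (cases "x \<in> K'")
        case True
        have "norm (h (x + (1 / Suc n) *\<^sub>R e) - h (x + 0 *\<^sub>R e)) \<le> B * norm (1 / Suc n - (0::real))"
          by (rule field_differentiable_bound[of UNIV])
            (use der B in \<open>auto intro: has_field_derivative_at_within\<close>)
        then have "norm (h (x + (1 / Suc n) *\<^sub>R e) - h x) * Suc n \<le> B"
          by (simp add: field_simps)
        then show ?thesis using True by (simp add: D_def abs_mult)
      next
        case False
        have "x + t *\<^sub>R e \<notin> K" if "0 \<le> t" "t \<le> 1" for t
        proof
          assume "x + t *\<^sub>R e \<in> K"
          then have "(x + t *\<^sub>R e) - t *\<^sub>R e \<in> K'"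
            unfolding K'_def using that by (intro rev_image_eqI[of "(x + t *\<^sub>R e, t)"]) auto
          then show False using False by simp
        qed
        from this[of 0] this[of "1 / Suc n"] show ?thesis
          using K(2) False by (simp add: D_def)
      qed
    qed
  qed
  ultimately show ?thesis by (simp add: LIMSEQ_const_iff)
qed

lemma integral_lebesgue_on_compact_support:
  fixes k :: "'a::euclidean_space \<Rightarrow> real"
  assumes "open \<Omega>" "compact K" "K \<subseteq> \<Omega>" "continuous_on \<Omega> k" "\<And>x. x \<in> \<Omega> \<Longrightarrow> x \<notin> K \<Longrightarrow> k x = 0"
  shows "integrable (lebesgue_on \<Omega>) k"
    and "(LINT x|lebesgue_on \<Omega>. k x) = (LINT x|lborel. (if x \<in> \<Omega> then k x else 0))"
proof -
  have eq: "(\<lambda>x. indicator \<Omega> x *\<^sub>R k x) = (\<lambda>x. indicator K x *\<^sub>R k x)"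
    "(\<lambda>x. indicator K x *\<^sub>R k x) = (\<lambda>x. if x \<in> \<Omega> then k x else 0)"
    using assms by (auto simp: indicator_def fun_eq_iff)
  have i: "integrable lborel (\<lambda>x. indicator K x *\<^sub>R k x)"
    using assms by (intro borel_integrable_compact) (auto intro: continuous_on_subset)
  then have m: "(\<lambda>x. indicator K x *\<^sub>R k x) \<in> borel_measurable lborel" by auto
  show "integrable (lebesgue_on \<Omega>) k"
  proof (subst integrable_restrict_space)
    show "integrable lebesgue (\<lambda>x. indicator \<Omega> x *\<^sub>R k x)"
      unfolding eq(1) using i m by (subst integrable_completion) auto
  qed (use assms(1) in auto)
  show "(LINT x|lebesgue_on \<Omega>. k x) = (LINT x|lborel. (if x \<in> \<Omega> then k x else 0))"
  proof (subst integral_restrict_space)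
    show "(LINT x|lebesgue. indicator \<Omega> x *\<^sub>R k x) = (LINT x|lborel. (if x \<in> \<Omega> then k x else 0))"
      unfolding eq(1) eq(2)[symmetric] by (rule integral_completion) (use m in auto)
  qed (use assms(1) in auto)
qed

text \<open>The factor \<open>b\<close> is arbitrary near the boundary of \<open>\<Omega>\<close>: the product \<open>b * \<phi>\<close>, continued by
  zero, is differentiable on the whole space because \<open>\<phi>\<close> has compact support in \<open>\<Omega>\<close>.\<close>

lemma integral_by_parts_Cc_infinity:
  fixes \<phi> b :: "'a::euclidean_space \<Rightarrow> real"
  assumes "open \<Omega>" and \<phi>: "\<phi> \<in> Cc_infinity \<Omega>"
    and b: "\<And>x. x \<in> \<Omega> \<Longrightarrow> (b has_derivative b' x) (at x)"
    and cont: "continuous_on \<Omega> (\<lambda>x. b' x e)"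
  shows "(LINT x|lebesgue_on \<Omega>. b x * (grad \<phi> x \<bullet> e)) = - (LINT x|lebesgue_on \<Omega>. b' x e * \<phi> x)"
proof -
  obtain K where K: "compact K" "K \<subseteq> \<Omega>" "\<And>x. x \<notin> K \<Longrightarrow> \<phi> x = 0"
    using Cc_infinity_compact_support[OF \<phi>] by blast
  have g0: "grad \<phi> x = 0" if "x \<notin> K" for x
    using grad_eq_0_off_support[OF \<phi> K(1,3) that] by blast
  have bcont: "continuous_on \<Omega> b"
    using b by (meson continuous_at_imp_continuous_on has_derivative_continuous)
  note conts = bcont cont continuous_on_subset[OF Cc_infinity_continuous[OF \<phi>]]
    continuous_on_subset[OF Cc_infinity_continuous_grad[OF \<phi>]]
  define h where "h x = (if x \<in> \<Omega> then b x * \<phi> x else 0)" for x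
  define h' where "h' x v = (if x \<in> \<Omega> then b x * (grad \<phi> x \<bullet> v) + b' x v * \<phi> x else 0)" for x v
  have off: "h x = 0" "h' x = (\<lambda>v. 0)" if "x \<notin> K" for x
    using that K g0 by (auto simp: h_def h'_def fun_eq_iff)
  have "(LINT x|lborel. h' x e) = 0"
  proof (rule integral_directional_derivative_eq_0[OF K(1)])
    show "(h has_derivative h' x) (at x)" for x
    proof (cases "x \<in> \<Omega>")
      case True
      have "h' x = (\<lambda>v. b x * (grad \<phi> x \<bullet> v) + b' x v * \<phi> x)"
        using True by (simp add: h'_def fun_eq_iff)
      then have "((\<lambda>x. b x * \<phi> x) has_derivative h' x) (at x)"
        using has_derivative_mult[OF b[OF True] has_derivative_grad[OF Cc_infinity_differentiable[OF \<phi>]]]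
        by simp
      then show ?thesis
        by (rule has_derivative_transform_within_open[OF _ assms(1) True]) (simp add: h_def)
    next
      case False
      then have "x \<in> - K" using K by auto
      then show ?thesis
        using off(2)[of x] has_derivative_transform_within_open[of "\<lambda>_. 0" "\<lambda>_. 0" x UNIV "- K" h]
          compact_imp_closed[OF K(1)] off(1) by (auto simp: open_Compl)
    qed
    have "continuous_on (\<Omega> \<union> - K) (\<lambda>x. h' x e)"
    proof (rule continuous_on_open_Un[OF assms(1)])
      have "continuous_on \<Omega> (\<lambda>x. b x * (grad \<phi> x \<bullet> e) + b' x e * \<phi> x)"
        by (intro continuous_intros conts) auto
      then show "continuous_on \<Omega> (\<lambda>x. h' x e)"
        by (rule continuous_on_eq) (simp add: h'_def)
      have "continuous_on (- K) (\<lambda>x. 0::real)" by simp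
      then show "continuous_on (- K) (\<lambda>x. h' x e)"
        by (rule continuous_on_eq) (simp add: off)
    qed (use compact_imp_closed[OF K(1)] in auto)
    moreover have "\<Omega> \<union> - K = UNIV" using K by auto
    ultimately show "continuous_on UNIV (\<lambda>x. h' x e)" by simp
  qed (rule off)
  moreover have "(LINT x|lebesgue_on \<Omega>. b x * (grad \<phi> x \<bullet> e) + b' x e * \<phi> x) = (LINT x|lborel. h' x e)"
    unfolding h'_def
    by (rule integral_lebesgue_on_compact_support(2)[OF assms(1) K(1,2)])
      (use K g0 in \<open>auto intro!: continuous_intros conts\<close>)
  moreover have "integrable (lebesgue_on \<Omega>) (\<lambda>x. b x * (grad \<phi> x \<bullet> e))"
    by (rule integral_lebesgue_on_compact_support(1)[OF assms(1) K(1,2)])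
      (use K g0 in \<open>auto intro!: continuous_intros conts\<close>)
  moreover have "integrable (lebesgue_on \<Omega>) (\<lambda>x. b' x e * \<phi> x)"
    by (rule integral_lebesgue_on_compact_support(1)[OF assms(1) K(1,2)])
      (use K g0 in \<open>auto intro!: continuous_intros conts\<close>)
  ultimately show ?thesis by simp
qed


section \<open>Lebesgue spaces on sets of finite measure\<close>

lemma powr_norm_add_le:
  fixes p :: real assumes "0 \<le> p" "a \<ge> 0" "b \<ge> 0"
  shows "(a + b) powr p \<le> 2 powr p * (a powr p + b powr p)"
proof -
  have "(a + b) powr p \<le> (2 * max a b) powr p" using assms by (intro powr_mono2) auto
  also have "\<dots> = 2 powr p * max a b powr p" using assms by (simp add: powr_mult)
  also have "\<dots> \<le> 2 powr p * (a powr p + b powr p)"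
    using assms by (intro mult_left_mono) (auto simp: max_def)
  finally show ?thesis .
qed

lemma finite_measure_bounded_open:
  assumes "open \<Omega>" "bounded \<Omega>" shows "finite_measure (lebesgue_on \<Omega>)"
  using assms by (intro finite_measure_lebesgue_on lmeasurable_open)

lemma Lp_measurable: "u \<in> Lp \<Omega> p \<Longrightarrow> u \<in> borel_measurable (lebesgue_on \<Omega>)"
  by (simp add: Lp_def)

lemma Lp_integrable_powr: "u \<in> Lp \<Omega> p \<Longrightarrow> integrable (lebesgue_on \<Omega>) (\<lambda>x. norm (u x) powr p)"
  by (simp add: Lp_def)

lemma integrable_bounded:
  fixes g :: "'a::euclidean_space \<Rightarrow> 'b::euclidean_space"
  assumes "finite_measure (lebesgue_on \<Omega>)" "g \<in> borel_measurable (lebesgue_on \<Omega>)"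
    "AE x in lebesgue_on \<Omega>. norm (g x) \<le> c"
  shows "integrable (lebesgue_on \<Omega>) g"
  using finite_measure.integrable_const_bound[OF assms(1)] assms by auto

lemma Lp_dominated:
  assumes fin: "finite_measure (lebesgue_on \<Omega>)" and p: "0 \<le> p"
    and m: "g \<in> borel_measurable (lebesgue_on \<Omega>)"
    and v: "v \<in> Lp \<Omega> p" and w: "w \<in> Lp \<Omega> p"
    and le: "\<And>x. x \<in> \<Omega> \<Longrightarrow> norm (g x) \<le> norm (v x) + norm (w x) + c" and c: "c \<ge> 0"
  shows "g \<in> Lp \<Omega> p"
proof -
  interpret finite_measure "lebesgue_on \<Omega>" by (rule fin)
  let ?h = "\<lambda>x. 2 powr p * (2 powr p * (norm (v x) powr p + norm (w x) powr p) + c powr p)"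
  have "integrable (lebesgue_on \<Omega>) (\<lambda>x. norm (g x) powr p)"
  proof (rule Bochner_Integration.integrable_bound[of _ ?h])
    show "integrable (lebesgue_on \<Omega>) ?h"
      using Lp_integrable_powr[OF v] Lp_integrable_powr[OF w] by simp
    have "norm (norm (g x) powr p) \<le> norm (?h x)" if "x \<in> \<Omega>" for x
    proof -
      have "norm (g x) powr p \<le> (norm (v x) + norm (w x) + c) powr p"
        using le[OF that] p by (intro powr_mono2) auto
      also have "\<dots> \<le> 2 powr p * ((norm (v x) + norm (w x)) powr p + c powr p)"
        using p c by (intro powr_norm_add_le) auto
      also have "\<dots> \<le> ?h x"
        using p by (intro mult_left_mono add_right_mono powr_norm_add_le) auto
      finally show ?thesis by simp
    qed
    then show "AE x in lebesgue_on \<Omega>. norm (norm (g x) powr p) \<le> norm (?h x)"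
      by (intro AE_I2) simp
    show "(\<lambda>x. norm (g x) powr p) \<in> borel_measurable (lebesgue_on \<Omega>)"
      using m by measurable
  qed
  then show ?thesis using m by (simp add: Lp_def)
qed

lemma Lp_bounded:
  fixes g :: "'a::euclidean_space \<Rightarrow> 'b::euclidean_space"
  assumes "finite_measure (lebesgue_on \<Omega>)" "0 \<le> p" "g \<in> borel_measurable (lebesgue_on \<Omega>)"
    "\<And>x. x \<in> \<Omega> \<Longrightarrow> norm (g x) \<le> c"
  shows "g \<in> Lp \<Omega> p"
proof -
  have 0: "(\<lambda>x. 0::real) \<in> Lp \<Omega> p" by (simp add: Lp_def)
  show ?thesis
  proof (rule Lp_dominated[OF assms(1-3) 0 0, of "max c 0"])
    show "norm (g x) \<le> norm (0::real) + norm (0::real) + max c 0" if "x \<in> \<Omega>" for x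
      using assms(4)[OF that] by simp
  qed simp
qed

lemma Lp_diff:
  fixes u v :: "'a::euclidean_space \<Rightarrow> 'b::euclidean_space"
  assumes "finite_measure (lebesgue_on \<Omega>)" "0 \<le> p" "u \<in> Lp \<Omega> p" "v \<in> Lp \<Omega> p"
  shows "(\<lambda>x. u x - v x) \<in> Lp \<Omega> p"
  by (rule Lp_dominated[OF assms(1,2) _ assms(3,4), of _ 0])
    (use assms(3,4)[THEN Lp_measurable] norm_triangle_ineq4 in auto)

lemma Lp_integrable:
  fixes u :: "'a::euclidean_space \<Rightarrow> 'b::euclidean_space"
  assumes fin: "finite_measure (lebesgue_on \<Omega>)" and p: "1 \<le> p" and u: "u \<in> Lp \<Omega> p"
  shows "integrable (lebesgue_on \<Omega>) u"
proof (rule Bochner_Integration.integrable_bound[of _ "\<lambda>x. 1 + norm (u x) powr p"])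
  interpret finite_measure "lebesgue_on \<Omega>" by (rule fin)
  show "integrable (lebesgue_on \<Omega>) (\<lambda>x. 1 + norm (u x) powr p)"
    using Lp_integrable_powr[OF u] by simp
  have "norm (u x) \<le> 1 + norm (u x) powr p" for x
  proof (cases "norm (u x) \<le> 1")
    case False
    then have "norm (u x) powr 1 \<le> norm (u x) powr p" using p by (intro powr_mono) auto
    then show ?thesis using False by simp
  qed (simp add: add_increasing2)
  then show "AE x in lebesgue_on \<Omega>. norm (u x) \<le> norm (1 + norm (u x) powr p)"
    by (intro AE_I2) (metis abs_of_nonneg add_nonneg_nonneg powr_ge_zero real_norm_def zero_le_one)
qed (rule Lp_measurable[OF u])

text \<open>On a finite measure space, \<open>t \<le> d + d powr (1 - p) * t powr p\<close> for every \<open>d > 0\<close>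
  replaces the inequality of Hoelder.\<close>

lemma Lp_tendsto_imp_L1_tendsto:
  fixes g :: "nat \<Rightarrow> 'a::euclidean_space \<Rightarrow> 'b::euclidean_space"
  assumes fin: "finite_measure (lebesgue_on \<Omega>)" and p: "1 \<le> p" and g: "\<And>n. g n \<in> Lp \<Omega> p"
    and lim: "(\<lambda>n. LINT x|lebesgue_on \<Omega>. norm (g n x) powr p) \<longlonglongrightarrow> 0"
  shows "(\<lambda>n. LINT x|lebesgue_on \<Omega>. norm (g n x)) \<longlonglongrightarrow> 0"
proof (rule order_tendstoI)
  interpret finite_measure "lebesgue_on \<Omega>" by (rule fin)
  let ?M = "measure (lebesgue_on \<Omega>) \<Omega>"
  fix e :: real assume e: "0 < e"
  define d where "d = e / (2 * (?M + 1))"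
  have M: "?M \<ge> 0" by simp
  have d: "d > 0" using e M unfolding d_def by (intro divide_pos_pos mult_pos_pos) linarith+
  have dM: "d * ?M < e / 2"
  proof -
    have "d * ?M < d * (?M + 1)" using d by simp
    also have "\<dots> = e / 2"
    proof -
      have "?M + 1 \<noteq> 0" using M by linarith
      then show ?thesis unfolding d_def by (simp add: divide_simps)
    qed
    finally show ?thesis .
  qed
  have le: "(LINT x|lebesgue_on \<Omega>. norm (g n x)) \<le>
      d * ?M + d powr (1 - p) * (LINT x|lebesgue_on \<Omega>. norm (g n x) powr p)" for n
  proof -
    have pw: "t \<le> d + d powr (1 - p) * t powr p" if "t \<ge> 0" for t
    proof (cases "t \<le> d")
      case False
      then have "t powr (1 - p) \<le> d powr (1 - p)" using d p by (intro powr_mono2') auto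
      then have "t powr (1 - p) * t powr p \<le> d powr (1 - p) * t powr p"
        by (intro mult_right_mono) auto
      then show ?thesis using False d by (simp flip: powr_add)
    qed (simp add: add_increasing2)
    have "(LINT x|lebesgue_on \<Omega>. norm (g n x)) \<le>
        (LINT x|lebesgue_on \<Omega>. d + d powr (1 - p) * norm (g n x) powr p)"
      using Lp_integrable[OF fin p g] Lp_integrable_powr[OF g] pw
      by (intro integral_mono integrable_norm) auto
    also have "\<dots> = d * ?M + d powr (1 - p) * (LINT x|lebesgue_on \<Omega>. norm (g n x) powr p)"
      using Lp_integrable_powr[OF g] by simp
    finally show ?thesis .
  qed
  have "(\<lambda>n. d * ?M + d powr (1 - p) * (LINT x|lebesgue_on \<Omega>. norm (g n x) powr p))
      \<longlonglongrightarrow> d * ?M + d powr (1 - p) * 0"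
    by (intro tendsto_intros lim)
  then have "\<forall>\<^sub>F n in sequentially.
      d * ?M + d powr (1 - p) * (LINT x|lebesgue_on \<Omega>. norm (g n x) powr p) < e"
    by (rule order_tendstoD) (use dM e in linarith)
  then show "\<forall>\<^sub>F n in sequentially. (LINT x|lebesgue_on \<Omega>. norm (g n x)) < e"
  proof eventually_elim
    case (elim n)
    then show ?case using le[of n] by linarith
  qed
next
  fix e :: real assume "e < 0"
  then show "\<forall>\<^sub>F n in sequentially. e < (LINT x|lebesgue_on \<Omega>. norm (g n x))"
    by (intro always_eventually allI order.strict_trans2[OF \<open>e < 0\<close> Bochner_Integration.integral_nonneg]) simp
qed

lemma L1_tendsto_integral_mult:
  fixes g :: "nat \<Rightarrow> 'a::euclidean_space \<Rightarrow> real"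
  assumes k: "k \<in> borel_measurable (lebesgue_on \<Omega>)" "\<And>x. x \<in> \<Omega> \<Longrightarrow> \<bar>k x\<bar> \<le> B"
    and g: "\<And>n. integrable (lebesgue_on \<Omega>) (g n)" and G: "integrable (lebesgue_on \<Omega>) G"
    and lim: "(\<lambda>n. LINT x|lebesgue_on \<Omega>. \<bar>g n x - G x\<bar>) \<longlonglongrightarrow> 0"
  shows "(\<lambda>n. LINT x|lebesgue_on \<Omega>. k x * g n x) \<longlonglongrightarrow> (LINT x|lebesgue_on \<Omega>. k x * G x)"
proof -
  have int: "integrable (lebesgue_on \<Omega>) (\<lambda>x. k x * h x)" if "integrable (lebesgue_on \<Omega>) h" for h :: "'a \<Rightarrow> real"
  proof (rule Bochner_Integration.integrable_bound[of _ "\<lambda>x. B * h x"])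
    show "AE x in lebesgue_on \<Omega>. norm (k x * h x) \<le> norm (B * h x)"
      using order_trans[OF k(2) abs_ge_self]
      by (intro AE_I2) (auto simp: abs_mult intro!: mult_right_mono)
  qed (use k(1) that in auto)
  have "(\<lambda>n. (LINT x|lebesgue_on \<Omega>. k x * g n x) - (LINT x|lebesgue_on \<Omega>. k x * G x)) \<longlonglongrightarrow> 0"
  proof (rule Lim_null_comparison)
    have "norm ((LINT x|lebesgue_on \<Omega>. k x * g n x) - (LINT x|lebesgue_on \<Omega>. k x * G x))
        \<le> B * (LINT x|lebesgue_on \<Omega>. \<bar>g n x - G x\<bar>)" for n
    proof -
      have "(LINT x|lebesgue_on \<Omega>. k x * g n x) - (LINT x|lebesgue_on \<Omega>. k x * G x)
          = (LINT x|lebesgue_on \<Omega>. k x * (g n x - G x))"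
        using int g G by (simp add: right_diff_distrib)
      also have "norm \<dots> \<le> (LINT x|lebesgue_on \<Omega>. norm (k x * (g n x - G x)))"
        by (rule integral_norm_bound)
      also have "\<dots> \<le> (LINT x|lebesgue_on \<Omega>. B * \<bar>g n x - G x\<bar>)"
        using int[of "\<lambda>x. g n x - G x"] g G k
        by (intro integral_mono integrable_norm) (auto simp: abs_mult intro: mult_right_mono)
      finally show ?thesis by simp
    qed
    then show "\<forall>\<^sub>F n in sequentially. norm ((LINT x|lebesgue_on \<Omega>. k x * g n x) -
        (LINT x|lebesgue_on \<Omega>. k x * G x)) \<le> B * (LINT x|lebesgue_on \<Omega>. \<bar>g n x - G x\<bar>)"
      by simp
    show "(\<lambda>n. B * (LINT x|lebesgue_on \<Omega>. \<bar>g n x - G x\<bar>)) \<longlonglongrightarrow> 0"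
      using tendsto_mult_right_zero[OF lim] by simp
  qed
  then show ?thesis by (simp add: LIM_zero_iff)
qed


section \<open>The closure of the test functions\<close>

text \<open>Membership in \<open>W01p\<close> without the integration by parts formula, which passes to the limit, see
  \<open>Cc_approx_imp_W01p\<close>. The approximating sequence is a parameter so that it can be composed with
  smooth functions.\<close>

definition Cc_approx ::
  "'a::euclidean_space set \<Rightarrow> real \<Rightarrow> (nat \<Rightarrow> 'a \<Rightarrow> real) \<Rightarrow> ('a \<Rightarrow> real) \<Rightarrow> ('a \<Rightarrow> 'a) \<Rightarrow> bool" where
  "Cc_approx \<Omega> p \<phi> u Du \<longleftrightarrow> u \<in> Lp \<Omega> p \<and> Du \<in> Lp \<Omega> p \<and> (\<forall>n. \<phi> n \<in> Cc_infinity \<Omega>) \<and>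
     (\<lambda>n. LINT x|lebesgue_on \<Omega>. norm (\<phi> n x - u x) powr p) \<longlonglongrightarrow> 0 \<and>
     (\<lambda>n. LINT x|lebesgue_on \<Omega>. norm (grad (\<phi> n) x - Du x) powr p) \<longlonglongrightarrow> 0"

lemma W01p_imp_Cc_approx:
  assumes "W01p \<Omega> p u Du" "1 \<le> p"
  obtains \<phi> where "Cc_approx \<Omega> p \<phi> u Du"
proof -
  obtain \<phi> where \<phi>: "\<And>n. \<phi> n \<in> Cc_infinity \<Omega>"
    and lim: "(\<lambda>n. ((LINT x|lebesgue_on \<Omega>. \<bar>\<phi> n x - u x\<bar> powr p) +
        (LINT x|lebesgue_on \<Omega>. norm (grad (\<phi> n) x - Du x) powr p)) powr (1 / p)) \<longlonglongrightarrow> 0"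
    using assms unfolding W01p_def by blast
  define a where "a n = (LINT x|lebesgue_on \<Omega>. norm (\<phi> n x - u x) powr p)" for n
  define b where "b n = (LINT x|lebesgue_on \<Omega>. norm (grad (\<phi> n) x - Du x) powr p)" for n
  have ab: "0 \<le> a n" "0 \<le> b n" for n by (auto simp: a_def b_def)
  have "(\<lambda>n. ((a n + b n) powr (1 / p)) powr p) \<longlonglongrightarrow> 0"
    using lim assms(2) unfolding a_def b_def real_norm_def
    by (intro tendsto_zero_powrI[OF lim tendsto_const]) auto
  then have s: "(\<lambda>n. a n + b n) \<longlonglongrightarrow> 0"
    using assms(2) ab by (simp add: powr_powr add_nonneg_nonneg)
  have "a \<longlonglongrightarrow> 0" "b \<longlonglongrightarrow> 0"
    using ab by (intro Lim_null_comparison[OF _ s] always_eventually allI; simp)+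
  then show ?thesis
    using that[of \<phi>] \<phi> assms(1) unfolding Cc_approx_def a_def[abs_def] b_def[abs_def] W01p_def W1p_def
    by blast
qed

lemma continuous_measurable_lebesgue_on:
  assumes "continuous_on UNIV h" "open \<Omega>"
  shows "h \<in> borel_measurable (lebesgue_on \<Omega>)"
proof (rule continuous_imp_measurable_on_sets_lebesgue)
  show "continuous_on \<Omega> h" using assms(1) by (rule continuous_on_subset) simp
  show "\<Omega> \<in> sets lebesgue" using assms(2) by simp
qed

lemma Cc_infinity_bounded:
  assumes "\<phi> \<in> Cc_infinity \<Omega>"
  obtains B where "\<And>x. \<bar>\<phi> x\<bar> \<le> B" "\<And>x. norm (grad \<phi> x) \<le> B"
proof -
  obtain K where K: "compact K" and "K \<subseteq> \<Omega>" and off: "\<And>x. x \<notin> K \<Longrightarrow> \<phi> x = 0"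
    by (rule Cc_infinity_compact_support[OF assms]) (rule that)
  obtain B1 where "B1 > 0" and B1: "\<And>x. norm (\<phi> x) \<le> B1"
    by (rule compactly_supported_bound[OF K
          continuous_on_subset[OF Cc_infinity_continuous[OF assms] subset_UNIV] off]) (assumption | rule that)+
  obtain B2 where "B2 > 0" and B2: "\<And>x. norm (grad \<phi> x) \<le> B2"
    by (rule compactly_supported_bound[OF K
          continuous_on_subset[OF Cc_infinity_continuous_grad[OF assms] subset_UNIV]
          grad_eq_0_off_support[OF assms K off]]) (assumption | rule that)+
  show ?thesis
  proof (rule that[of "max B1 B2"])
    show "\<bar>\<phi> x\<bar> \<le> max B1 B2" for x using B1[of x] by simp
    show "norm (grad \<phi> x) \<le> max B1 B2" for x using B2[of x] by simp
  qed
qed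

lemma Cc_infinity_Lp:
  assumes "open \<Omega>" "bounded \<Omega>" "\<phi> \<in> Cc_infinity \<Omega>" "0 \<le> p"
  shows "\<phi> \<in> Lp \<Omega> p" "grad \<phi> \<in> Lp \<Omega> p"
proof -
  obtain B where B: "\<And>x. \<bar>\<phi> x\<bar> \<le> B" "\<And>x. norm (grad \<phi> x) \<le> B"
    using Cc_infinity_bounded[OF assms(3)] by blast
  show "\<phi> \<in> Lp \<Omega> p" "grad \<phi> \<in> Lp \<Omega> p"
    by (rule Lp_bounded[OF finite_measure_bounded_open[OF assms(1,2)] assms(4), where c=B],
        rule continuous_measurable_lebesgue_on[OF _ assms(1)],
        simp_all add: B Cc_infinity_continuous[OF assms(3)] Cc_infinity_continuous_grad[OF assms(3)])+
qed

text \<open>Stronger than the formula in the definition of \<open>W1p\<close>, since \<open>b\<close> need not vanish at the boundary: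
  here the boundary values of \<open>u\<close> enter.\<close>

lemma Cc_approx_integral_by_parts:
  fixes u b :: "'a::euclidean_space \<Rightarrow> real"
  assumes \<Omega>: "open \<Omega>" "bounded \<Omega>" and p: "1 \<le> p" and u: "Cc_approx \<Omega> p \<phi> u Du" and e: "norm e \<le> 1"
    and b: "\<And>x. x \<in> \<Omega> \<Longrightarrow> (b has_derivative b' x) (at x)"
    and cont: "continuous_on \<Omega> (\<lambda>x. b' x e)"
    and B: "\<And>x. x \<in> \<Omega> \<Longrightarrow> \<bar>b x\<bar> \<le> B" "\<And>x. x \<in> \<Omega> \<Longrightarrow> \<bar>b' x e\<bar> \<le> B"
  shows "(LINT x|lebesgue_on \<Omega>. b x * (Du x \<bullet> e)) = - (LINT x|lebesgue_on \<Omega>. b' x e * u x)"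
proof -
  note fin = finite_measure_bounded_open[OF \<Omega>]
  have \<phi>: "\<phi> n \<in> Cc_infinity \<Omega>" for n using u by (simp add: Cc_approx_def)
  have p0: "0 \<le> p" using p by simp
  note L = Cc_infinity_Lp[OF \<Omega> \<phi> p0]
  have uL: "u \<in> Lp \<Omega> p" "Du \<in> Lp \<Omega> p" using u by (auto simp: Cc_approx_def)
  have bcont: "continuous_on \<Omega> b"
    by (auto intro!: continuous_at_imp_continuous_on has_derivative_continuous[OF b])
  have bm: "b \<in> borel_measurable (lebesgue_on \<Omega>)" "(\<lambda>x. b' x e) \<in> borel_measurable (lebesgue_on \<Omega>)"
    using \<Omega>(1) by (simp_all add: continuous_imp_measurable_on_sets_lebesgue cont bcont)
  have 1: "(\<lambda>n. LINT x|lebesgue_on \<Omega>. b x * (grad (\<phi> n) x \<bullet> e)) \<longlonglongrightarrow> (LINT x|lebesgue_on \<Omega>. b x * (Du x \<bullet> e))"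
  proof (rule L1_tendsto_integral_mult[OF bm(1) B(1)])
    have "(\<lambda>n. LINT x|lebesgue_on \<Omega>. norm (grad (\<phi> n) x - Du x)) \<longlonglongrightarrow> 0"
      using u by (intro Lp_tendsto_imp_L1_tendsto[OF fin p Lp_diff[OF fin p0 L(2) uL(2)]])
        (auto simp: Cc_approx_def)
    then show "(\<lambda>n. LINT x|lebesgue_on \<Omega>. \<bar>grad (\<phi> n) x \<bullet> e - Du x \<bullet> e\<bar>) \<longlonglongrightarrow> 0"
    proof (rule Lim_null_comparison[rotated], intro always_eventually allI)
      fix n
      have "\<bar>grad (\<phi> n) x \<bullet> e - Du x \<bullet> e\<bar> \<le> norm (grad (\<phi> n) x - Du x)" for x
        using Cauchy_Schwarz_ineq2[of "grad (\<phi> n) x - Du x" e] e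
          mult_left_mono[OF e norm_ge_zero[of "grad (\<phi> n) x - Du x"]]
        by (simp add: inner_diff_left)
      then have "(LINT x|lebesgue_on \<Omega>. \<bar>grad (\<phi> n) x \<bullet> e - Du x \<bullet> e\<bar>)
          \<le> (LINT x|lebesgue_on \<Omega>. norm (grad (\<phi> n) x - Du x))"
        using Lp_integrable[OF fin p L(2)] Lp_integrable[OF fin p uL(2)]
        by (intro integral_mono) auto
      then show "norm (LINT x|lebesgue_on \<Omega>. \<bar>grad (\<phi> n) x \<bullet> e - Du x \<bullet> e\<bar>)
          \<le> (LINT x|lebesgue_on \<Omega>. norm (grad (\<phi> n) x - Du x))"
        by simp
    qed
  qed (assumption | rule integrable_inner_left Lp_integrable[OF fin p L(2)] Lp_integrable[OF fin p uL(2)])+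
  have 2: "(\<lambda>n. LINT x|lebesgue_on \<Omega>. b' x e * \<phi> n x) \<longlonglongrightarrow> (LINT x|lebesgue_on \<Omega>. b' x e * u x)"
  proof (rule L1_tendsto_integral_mult[OF bm(2) B(2)])
    have "(\<lambda>n. LINT x|lebesgue_on \<Omega>. norm (\<phi> n x - u x)) \<longlonglongrightarrow> 0"
      using u by (intro Lp_tendsto_imp_L1_tendsto[OF fin p Lp_diff[OF fin p0 L(1) uL(1)]])
        (auto simp: Cc_approx_def)
    then show "(\<lambda>n. LINT x|lebesgue_on \<Omega>. \<bar>\<phi> n x - u x\<bar>) \<longlonglongrightarrow> 0" by simp
  qed (assumption | rule Lp_integrable[OF fin p L(1)] Lp_integrable[OF fin p uL(1)])+
  have "(\<lambda>n. LINT x|lebesgue_on \<Omega>. b x * (grad (\<phi> n) x \<bullet> e)) \<longlonglongrightarrow> - (LINT x|lebesgue_on \<Omega>. b' x e * u x)"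
    using tendsto_minus[OF 2] by (simp add: integral_by_parts_Cc_infinity[OF \<Omega>(1) \<phi> b cont])
  then show ?thesis using LIMSEQ_unique[OF 1] by blast
qed

lemma Cc_approx_imp_W01p:
  fixes u :: "'a::euclidean_space \<Rightarrow> real"
  assumes \<Omega>: "open \<Omega>" "bounded \<Omega>" and p: "1 \<le> p" and u: "Cc_approx \<Omega> p \<phi> u Du"
  shows "W01p \<Omega> p u Du"
proof -
  note fin = finite_measure_bounded_open[OF \<Omega>]
  have uL: "u \<in> Lp \<Omega> p" "Du \<in> Lp \<Omega> p" and \<phi>: "\<And>n. \<phi> n \<in> Cc_infinity \<Omega>"
    using u by (auto simp: Cc_approx_def)
  note uI = Lp_integrable[OF fin p uL(1)] Lp_integrable[OF fin p uL(2)]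
  have "(LINT x|lebesgue_on \<Omega>. u x *\<^sub>R grad \<psi> x) = - (LINT x|lebesgue_on \<Omega>. \<psi> x *\<^sub>R Du x)"
    if \<psi>: "\<psi> \<in> Cc_infinity \<Omega>" for \<psi>
  proof (rule euclidean_eqI)
    fix e :: 'a assume e: "e \<in> Basis"
    obtain B where B: "\<And>x. \<bar>\<psi> x\<bar> \<le> B" "\<And>x. norm (grad \<psi> x) \<le> B"
      using Cc_infinity_bounded[OF \<psi>] by blast
    note m = continuous_measurable_lebesgue_on[OF Cc_infinity_continuous[OF \<psi>] \<Omega>(1)]
      continuous_measurable_lebesgue_on[OF Cc_infinity_continuous_grad[OF \<psi>] \<Omega>(1)]
    have i1: "integrable (lebesgue_on \<Omega>) (\<lambda>x. u x *\<^sub>R grad \<psi> x)"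
    proof (rule Bochner_Integration.integrable_bound[of _ "\<lambda>x. B * u x"])
      show "AE x in lebesgue_on \<Omega>. norm (u x *\<^sub>R grad \<psi> x) \<le> norm (B * u x)"
        using order_trans[OF B(2) abs_ge_self]
        by (intro AE_I2) (auto simp: abs_mult mult.commute[of "\<bar>B\<bar>"] intro!: mult_left_mono)
    qed (use uI m in auto)
    have i2: "integrable (lebesgue_on \<Omega>) (\<lambda>x. \<psi> x *\<^sub>R Du x)"
    proof (rule Bochner_Integration.integrable_bound[of _ "\<lambda>x. B *\<^sub>R Du x"])
      show "AE x in lebesgue_on \<Omega>. norm (\<psi> x *\<^sub>R Du x) \<le> norm (B *\<^sub>R Du x)"
        using order_trans[OF B(1) abs_ge_self]
        by (intro AE_I2) (auto intro!: mult_right_mono)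
    qed (use uI m in auto)
    have "(LINT x|lebesgue_on \<Omega>. \<psi> x * (Du x \<bullet> e)) = - (LINT x|lebesgue_on \<Omega>. (grad \<psi> x \<bullet> e) * u x)"
    proof (rule Cc_approx_integral_by_parts[OF \<Omega> p u, where B=B])
      show "\<bar>grad \<psi> x \<bullet> e\<bar> \<le> B" for x
        using B(2)[of x] Basis_le_norm[OF e, of "grad \<psi> x"] by simp
      show "continuous_on \<Omega> (\<lambda>x. grad \<psi> x \<bullet> e)"
        using Cc_infinity_continuous_grad[OF \<psi>] by (intro continuous_intros) (auto intro: continuous_on_subset)
    qed (use e B has_derivative_grad[OF Cc_infinity_differentiable[OF \<psi>]] in auto)
    then show "(LINT x|lebesgue_on \<Omega>. u x *\<^sub>R grad \<psi> x) \<bullet> e = - (LINT x|lebesgue_on \<Omega>. \<psi> x *\<^sub>R Du x) \<bullet> e"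
      using i1 i2 by (simp flip: integral_inner_left add: mult.commute)
  qed
  moreover have "(\<lambda>n. ((LINT x|lebesgue_on \<Omega>. \<bar>\<phi> n x - u x\<bar> powr p) +
        (LINT x|lebesgue_on \<Omega>. norm (grad (\<phi> n) x - Du x) powr p)) powr (1 / p)) \<longlonglongrightarrow> 0"
  proof (rule tendsto_zero_powrI)
    show "(\<lambda>n. (LINT x|lebesgue_on \<Omega>. \<bar>\<phi> n x - u x\<bar> powr p) +
        (LINT x|lebesgue_on \<Omega>. norm (grad (\<phi> n) x - Du x) powr p)) \<longlonglongrightarrow> 0"
      using tendsto_add[of "\<lambda>n. LINT x|lebesgue_on \<Omega>. norm (\<phi> n x - u x) powr p" 0 _
          "\<lambda>n. LINT x|lebesgue_on \<Omega>. norm (grad (\<phi> n) x - Du x) powr p" 0] u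
      by (simp add: Cc_approx_def)
    show "(\<lambda>n. 1 / p) \<longlonglongrightarrow> 1 / p" by (rule tendsto_const)
  qed (use p in \<open>auto intro!: always_eventually add_nonneg_nonneg\<close>)
  ultimately show ?thesis using uL \<phi> unfolding W01p_def W1p_def by blast
qed


lemma has_derivative_softplus:
  assumes "\<epsilon> > 0" "(h has_derivative h') (at x)"
  shows "((\<lambda>x. softplus \<epsilon> (h x)) has_derivative (\<lambda>v. logistic \<epsilon> (h x) * h' v)) (at x)"
  using has_derivative_compose[OF assms(2), OF DERIV_softplus[OF assms(1), THEN has_field_derivative_imp_has_derivative]]
  by simp

lemma Cc_approx_AE_subseq:
  fixes u :: "'a::euclidean_space \<Rightarrow> real"
  assumes \<Omega>: "open \<Omega>" "bounded \<Omega>" and p: "1 \<le> p" and u: "Cc_approx \<Omega> p \<phi> u Du"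
  obtains \<psi> where "Cc_approx \<Omega> p \<psi> u Du" "AE x in lebesgue_on \<Omega>. (\<lambda>n. \<psi> n x) \<longlonglongrightarrow> u x"
proof -
  note fin = finite_measure_bounded_open[OF \<Omega>]
  have p0: "0 \<le> p" using p by simp
  have uL: "u \<in> Lp \<Omega> p" and \<phi>: "\<phi> n \<in> Cc_infinity \<Omega>" for n
    using u by (auto simp: Cc_approx_def)
  have d: "(\<lambda>x. \<phi> n x - u x) \<in> Lp \<Omega> p" for n
    by (rule Lp_diff[OF fin p0 Cc_infinity_Lp(1)[OF \<Omega> \<phi> p0] uL])
  have "(\<lambda>n. LINT x|lebesgue_on \<Omega>. norm (\<phi> n x - u x)) \<longlonglongrightarrow> 0"
    using u by (intro Lp_tendsto_imp_L1_tendsto[OF fin p d]) (simp add: Cc_approx_def)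
  then have "\<exists>r::nat\<Rightarrow>nat. strict_mono r \<and> (AE x in lebesgue_on \<Omega>. (\<lambda>n. \<phi> (r n) x - u x) \<longlonglongrightarrow> 0)"
    by (rule tendsto_L1_AE_subseq[OF Lp_integrable[OF fin p d]])
  then obtain r :: "nat \<Rightarrow> nat" where r: "strict_mono r"
    "AE x in lebesgue_on \<Omega>. (\<lambda>n. \<phi> (r n) x - u x) \<longlonglongrightarrow> 0"
    by (elim exE conjE) (rule that)
  show ?thesis
  proof (rule that[of "\<lambda>n. \<phi> (r n)"])
    show "Cc_approx \<Omega> p (\<lambda>n. \<phi> (r n)) u Du"
      using u LIMSEQ_subseq_LIMSEQ[OF _ r(1), of "\<lambda>n. LINT x|lebesgue_on \<Omega>. norm (\<phi> n x - u x) powr p" 0]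
        LIMSEQ_subseq_LIMSEQ[OF _ r(1), of "\<lambda>n. LINT x|lebesgue_on \<Omega>. norm (grad (\<phi> n) x - Du x) powr p" 0]
      by (simp add: Cc_approx_def o_def)
    show "AE x in lebesgue_on \<Omega>. (\<lambda>n. \<phi> (r n) x) \<longlonglongrightarrow> u x"
      using r(2) by eventually_elim (simp add: LIM_zero_iff)
  qed
qed

text \<open>Subtracting \<open>softplus \<epsilon> (- w x)\<close> makes the composition vanish where \<open>\<phi> n\<close> does, so that it maps
  test functions to test functions. Where \<open>w \<ge> 0\<close> this term disappears as \<open>\<epsilon>\<close> tends to zero and
  the positive part of \<open>u - w\<close> remains. Convergence of the gradients needs \<open>logistic \<epsilon> (\<phi> n - w)\<close> to converge
  almost everywhere, since \<open>Du\<close> is merely in \<open>Lp\<close>.\<close>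

lemma Cc_approx_softplus:
  fixes u w :: "'a::euclidean_space \<Rightarrow> real"
  assumes \<Omega>: "open \<Omega>" "bounded \<Omega>" and p: "1 \<le> p" and u: "Cc_approx \<Omega> p \<phi> u Du"
    and AE: "AE x in lebesgue_on \<Omega>. (\<lambda>n. \<phi> n x) \<longlonglongrightarrow> u x"
    and \<epsilon>: "\<epsilon> > 0" and w: "smooth w" "\<And>x. x \<in> \<Omega> \<Longrightarrow> norm (grad w x) \<le> C"
  shows "Cc_approx \<Omega> p (\<lambda>n x. softplus \<epsilon> (\<phi> n x - w x) - softplus \<epsilon> (- w x))
     (\<lambda>x. softplus \<epsilon> (u x - w x) - softplus \<epsilon> (- w x))
     (\<lambda>x. logistic \<epsilon> (u x - w x) *\<^sub>R (Du x - grad w x) + logistic \<epsilon> (- w x) *\<^sub>R grad w x)"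
    (is "Cc_approx _ _ ?Z ?z ?D")
proof -
  note fin = finite_measure_bounded_open[OF \<Omega>]
  have p0: "0 \<le> p" using p by simp
  have uL: "u \<in> Lp \<Omega> p" "Du \<in> Lp \<Omega> p" and \<phi>: "\<phi> n \<in> Cc_infinity \<Omega>" for n
    using u by (auto simp: Cc_approx_def)
  have wk: "C_k k w" for k using w(1) by blast
  have wd: "(w has_derivative (\<lambda>v. grad w x \<bullet> v)) (at x)" for x
    using has_derivative_grad wk[of "Suc 0"] by auto
  have wc: "continuous_on UNIV w" using wk[of 0] by simp
  have gwc: "continuous_on UNIV (grad w)"
    using wk[of "Suc 0"] unfolding grad_def by (auto intro!: continuous_intros)
  note [measurable] = Lp_measurable[OF uL(1)] Lp_measurable[OF uL(2)]
    continuous_measurable_lebesgue_on[OF wc \<Omega>(1)] continuous_measurable_lebesgue_on[OF gwc \<Omega>(1)]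
    continuous_measurable_lebesgue_on[OF Cc_infinity_continuous[OF \<phi>] \<Omega>(1)]
    continuous_measurable_lebesgue_on[OF Cc_infinity_continuous_grad[OF \<phi>] \<Omega>(1)]
    borel_measurable_continuous_onI[OF continuous_on_softplus[OF \<epsilon>]]
    borel_measurable_continuous_onI[OF continuous_on_logistic[OF \<epsilon>]]
  have gZ: "grad (?Z n) x = logistic \<epsilon> (\<phi> n x - w x) *\<^sub>R (grad (\<phi> n) x - grad w x)
      + logistic \<epsilon> (- w x) *\<^sub>R grad w x" for n x
  proof (rule grad_eqI)
    have "(\<phi> n has_derivative (\<lambda>v. grad (\<phi> n) x \<bullet> v)) (at x)"
      by (rule has_derivative_grad[OF Cc_infinity_differentiable[OF \<phi>]])
    from has_derivative_diff[OF has_derivative_softplus[OF \<epsilon> has_derivative_diff[OF this wd]]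
        has_derivative_softplus[OF \<epsilon> has_derivative_minus[OF wd]]]
    show "(?Z n has_derivative (\<lambda>v. (logistic \<epsilon> (\<phi> n x - w x) *\<^sub>R (grad (\<phi> n) x - grad w x)
      + logistic \<epsilon> (- w x) *\<^sub>R grad w x) \<bullet> v)) (at x)"
      by (simp add: inner_diff_left inner_add_left)
  qed
  have "?Z n \<in> Cc_infinity \<Omega>" for n
  proof (rule Cc_infinity_intro[OF _ \<phi>[of n]])
    have "C_k k (\<phi> n)" for k using \<phi>[of n] by (simp add: Cc_infinity_def)
    then show "smooth (?Z n)"
      using C_k_diff[OF C_k_const[of _ 0] wk]
      by (intro allI C_k_diff C_k_softplus[OF \<epsilon>] wk) auto
  qed simp
  moreover have "?z \<in> Lp \<Omega> p"
  proof (rule Lp_dominated[OF fin p0 _ uL(1) uL(1), of _ 0])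
    show "norm (?z x) \<le> norm (u x) + norm (u x) + 0" for x
      using softplus_lipschitz[OF \<epsilon>, of "u x - w x" "- w x"] by simp
  qed simp_all
  moreover have "?D \<in> Lp \<Omega> p"
  proof (rule Lp_dominated[OF fin p0 _ uL(2) uL(2), of _ "2 * \<bar>C\<bar>"])
    fix x assume x: "x \<in> \<Omega>"
    have "norm (?D x) \<le> norm (Du x - grad w x) + norm (grad w x)"
      using logistic_bounds[of \<epsilon>]
      by (intro norm_triangle_le add_mono) (auto intro: mult_left_le_one_le)
    also have "\<dots> \<le> norm (Du x) + 2 * norm (grad w x)"
      using norm_triangle_ineq4[of "Du x" "grad w x"] by simp
    also have "\<dots> \<le> norm (Du x) + norm (Du x) + 2 * \<bar>C\<bar>"
      using w(2)[OF x] norm_ge_zero[of "Du x"] by linarith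
    finally show "norm (?D x) \<le> norm (Du x) + norm (Du x) + 2 * \<bar>C\<bar>" .
  qed simp_all
  moreover have "(\<lambda>n. LINT x|lebesgue_on \<Omega>. norm (?Z n x - ?z x) powr p) \<longlonglongrightarrow> 0"
  proof (rule Lim_null_comparison)
    show "(\<lambda>n. LINT x|lebesgue_on \<Omega>. norm (\<phi> n x - u x) powr p) \<longlonglongrightarrow> 0"
      using u by (simp add: Cc_approx_def)
    have "(LINT x|lebesgue_on \<Omega>. norm (?Z n x - ?z x) powr p)
        \<le> (LINT x|lebesgue_on \<Omega>. norm (\<phi> n x - u x) powr p)" for n
    proof (rule integral_mono)
      note L = Lp_diff[OF fin p0 Cc_infinity_Lp(1)[OF \<Omega> \<phi>[of n] p0] uL(1)]
      show "integrable (lebesgue_on \<Omega>) (\<lambda>x. norm (\<phi> n x - u x) powr p)"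
        by (rule Lp_integrable_powr[OF L])
      have le: "norm (?Z n x - ?z x) \<le> norm (\<phi> n x - u x)" for x
        using softplus_lipschitz[OF \<epsilon>, of "\<phi> n x - w x" "u x - w x"] by simp
      have "(\<lambda>x. ?Z n x - ?z x) \<in> Lp \<Omega> p"
      proof (rule Lp_dominated[OF fin p0 _ L L, of _ 0])
        show "norm (?Z n x - ?z x) \<le> norm (\<phi> n x - u x) + norm (\<phi> n x - u x) + 0" for x
          using le[of x] norm_ge_zero[of "\<phi> n x - u x"] by linarith
      qed simp_all
      then show "integrable (lebesgue_on \<Omega>) (\<lambda>x. norm (?Z n x - ?z x) powr p)"
        by (rule Lp_integrable_powr)
      show "norm (?Z n x - ?z x) powr p \<le> norm (\<phi> n x - u x) powr p" for x
        using le p0 by (intro powr_mono2) auto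
    qed
    then show "\<forall>\<^sub>F n in sequentially. norm (LINT x|lebesgue_on \<Omega>. norm (?Z n x - ?z x) powr p)
        \<le> (LINT x|lebesgue_on \<Omega>. norm (\<phi> n x - u x) powr p)"
      by simp
  qed
  moreover have "(\<lambda>n. LINT x|lebesgue_on \<Omega>. norm (grad (?Z n) x - ?D x) powr p) \<longlonglongrightarrow> 0"
  proof (rule Lim_null_comparison)
    \<comment> \<open>the part of the error that stems from the factor in front of the fixed function \<open>Du - grad w\<close>; it
      vanishes in the limit by dominated convergence\<close>
    define k where "k n x = \<bar>logistic \<epsilon> (\<phi> n x - w x) - logistic \<epsilon> (u x - w x)\<bar> * norm (Du x - grad w x)" for n x
    have DwL: "(\<lambda>x. Du x - grad w x) \<in> Lp \<Omega> p"
      by (rule Lp_diff[OF fin p0 uL(2) Lp_bounded[OF fin p0 _ w(2)]]) simp_all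
    have kle: "k n x \<le> norm (Du x - grad w x)" for n x
      unfolding k_def using logistic_bounds[of \<epsilon> "\<phi> n x - w x"] logistic_bounds[of \<epsilon> "u x - w x"]
      by (intro mult_left_le_one_le) auto
    have k0: "0 \<le> k n x" for n x by (simp add: k_def)
    have km [measurable]: "k n \<in> borel_measurable (lebesgue_on \<Omega>)" for n
      unfolding k_def by measurable
    have ki: "integrable (lebesgue_on \<Omega>) (\<lambda>x. k n x powr p)" for n
    proof (rule Bochner_Integration.integrable_bound[OF Lp_integrable_powr[OF DwL]])
      show "AE x in lebesgue_on \<Omega>. norm (k n x powr p) \<le> norm (norm (Du x - grad w x) powr p)"
        using kle k0 p0 by (intro AE_I2) (auto intro!: powr_mono2)
    qed measurable
    have klim: "(\<lambda>n. LINT x|lebesgue_on \<Omega>. k n x powr p) \<longlonglongrightarrow> (LINT x|lebesgue_on \<Omega>. 0)"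
    proof (rule integral_dominated_convergence[OF _ _ Lp_integrable_powr[OF DwL]])
      show "AE x in lebesgue_on \<Omega>. (\<lambda>n. k n x powr p) \<longlonglongrightarrow> 0"
        using AE
      proof eventually_elim
        case (elim x)
        have "isCont (logistic \<epsilon>) (u x - w x)" using DERIV_logistic[OF \<epsilon>] by (rule DERIV_isCont)
        then have "(\<lambda>n. logistic \<epsilon> (\<phi> n x - w x)) \<longlonglongrightarrow> logistic \<epsilon> (u x - w x)"
          by (rule isCont_tendsto_compose) (intro tendsto_intros elim)
        then have "(\<lambda>n. k n x) \<longlonglongrightarrow> \<bar>logistic \<epsilon> (u x - w x) - logistic \<epsilon> (u x - w x)\<bar> * norm (Du x - grad w x)"
          unfolding k_def by (intro tendsto_intros)
        then show ?case
          using p k0 by (intro tendsto_zero_powrI[OF _ tendsto_const]) auto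
      qed
      show "AE x in lebesgue_on \<Omega>. norm (k n x powr p) \<le> norm (Du x - grad w x) powr p" for n
        using kle k0 p0 by (intro AE_I2) (auto intro!: powr_mono2)
    qed measurable
    let ?R = "\<lambda>n. 2 powr p * ((LINT x|lebesgue_on \<Omega>. norm (grad (\<phi> n) x - Du x) powr p) + (LINT x|lebesgue_on \<Omega>. k n x powr p))"
    have "?R \<longlonglongrightarrow> 2 powr p * (0 + (LINT x|lebesgue_on \<Omega>. 0))"
      using u by (intro tendsto_mult tendsto_add tendsto_const klim) (simp add: Cc_approx_def)
    then show "?R \<longlonglongrightarrow> 0" by simp
    have "(LINT x|lebesgue_on \<Omega>. norm (grad (?Z n) x - ?D x) powr p) \<le> ?R n" for n
    proof -
      note L = Lp_diff[OF fin p0 Cc_infinity_Lp(2)[OF \<Omega> \<phi>[of n] p0] uL(2)]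
      have "norm (grad (?Z n) x - ?D x) \<le> norm (grad (\<phi> n) x - Du x) + k n x" for x
      proof -
        have "grad (?Z n) x - ?D x = logistic \<epsilon> (\<phi> n x - w x) *\<^sub>R (grad (\<phi> n) x - Du x) +
          (logistic \<epsilon> (\<phi> n x - w x) - logistic \<epsilon> (u x - w x)) *\<^sub>R (Du x - grad w x)"
          unfolding gZ by (simp add: algebra_simps)
        then show ?thesis
          using logistic_bounds[of \<epsilon> "\<phi> n x - w x"]
          by (simp add: k_def) (intro norm_triangle_le add_mono; simp add: mult_left_le_one_le)
      qed
      then have pw: "norm (grad (?Z n) x - ?D x) powr p \<le>
          2 powr p * (norm (grad (\<phi> n) x - Du x) powr p + k n x powr p)" for x
        using powr_norm_add_le[OF p0 norm_ge_zero k0, of "grad (\<phi> n) x - Du x" n x] p0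
        by (meson norm_ge_zero order_trans powr_mono2)
      have i: "integrable (lebesgue_on \<Omega>) (\<lambda>x. 2 powr p * (norm (grad (\<phi> n) x - Du x) powr p + k n x powr p))"
        using Lp_integrable_powr[OF L] ki by simp
      have "(LINT x|lebesgue_on \<Omega>. norm (grad (?Z n) x - ?D x) powr p) \<le>
        (LINT x|lebesgue_on \<Omega>. 2 powr p * (norm (grad (\<phi> n) x - Du x) powr p + k n x powr p))"
      proof (rule integral_mono[OF _ i pw])
        show "integrable (lebesgue_on \<Omega>) (\<lambda>x. norm (grad (?Z n) x - ?D x) powr p)"
        proof (rule Bochner_Integration.integrable_bound[OF i])
          show "AE x in lebesgue_on \<Omega>. norm (norm (grad (?Z n) x - ?D x) powr p)
            \<le> norm (2 powr p * (norm (grad (\<phi> n) x - Du x) powr p + k n x powr p))"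
            by (intro AE_I2) (use pw in \<open>simp add: k0\<close>)
        qed (simp add: gZ)
      qed
      also have "\<dots> = ?R n" using Lp_integrable_powr[OF L] ki by simp
      finally show ?thesis .
    qed
    then show "\<forall>\<^sub>F n in sequentially. norm (LINT x|lebesgue_on \<Omega>. norm (grad (?Z n) x - ?D x) powr p) \<le> ?R n"
      by simp
  qed
  ultimately show ?thesis by (simp add: Cc_approx_def)
qed


section \<open>The comparison principle\<close>

text \<open>The divergence of \<open>pflux p (grad u)\<close> is the \<open>p\<close>-Laplacian of \<open>u\<close>.\<close>

definition pflux :: "real \<Rightarrow> 'a::euclidean_space \<Rightarrow> 'a" where
  "pflux p \<xi> = norm \<xi> powr (p - 2) *\<^sub>R \<xi>"

lemma norm_pflux: "norm (pflux p \<xi>) = norm \<xi> powr (p - 1)"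
  using powr_mult_base[of "norm \<xi>" "p - 2"]
  by (cases "\<xi> = 0") (auto simp: pflux_def mult.commute)

text \<open>By the Cauchy-Schwarz inequality the expression is at least
  \<open>(a powr (p - 1) - b powr (p - 1)) * (a - b)\<close> with \<open>a = norm \<xi>\<close> and \<open>b = norm \<eta>\<close>.\<close>

lemma pflux_monotone:
  assumes "1 < p"
  shows "0 \<le> (pflux p \<xi> - pflux p \<eta>) \<bullet> (\<xi> - \<eta>)"
proof -
  define a b where "a = norm \<xi>" and "b = norm \<eta>"
  have [simp]: "0 \<le> a" "0 \<le> b" by (auto simp: a_def b_def)
  have base: "t powr (p - 2) * t = t powr (p - 1)" if "0 \<le> t" for t
    using powr_mult_base[of t "p - 2"] that by (cases "t = 0") (auto simp: mult.commute)
  have "\<xi> \<bullet> \<eta> \<le> a * b" unfolding a_def b_def by (rule norm_cauchy_schwarz)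
  then have "(a powr (p - 2) + b powr (p - 2)) * (\<xi> \<bullet> \<eta>) \<le> (a powr (p - 2) + b powr (p - 2)) * (a * b)"
    by (intro mult_left_mono) auto
  also have "\<dots> = a powr (p - 1) * b + b powr (p - 1) * a"
    unfolding base[OF \<open>0 \<le> a\<close>, symmetric] base[OF \<open>0 \<le> b\<close>, symmetric] by (simp add: algebra_simps)
  finally have 1: "(a powr (p - 2) + b powr (p - 2)) * (\<xi> \<bullet> \<eta>) \<le> a powr (p - 1) * b + b powr (p - 1) * a" .
  have "0 \<le> (a powr (p - 1) - b powr (p - 1)) * (a - b)"
  proof (cases "a \<le> b")
    case True
    then show ?thesis using assms powr_mono2[of "p - 1" a b] by (intro mult_nonpos_nonpos) auto
  next
    case False
    then show ?thesis using assms powr_mono2[of "p - 1" b a] by (intro mult_nonneg_nonneg) auto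
  qed
  also have "\<dots> = a powr (p - 1) * a + b powr (p - 1) * b - (a powr (p - 1) * b + b powr (p - 1) * a)"
    by (simp add: algebra_simps)
  also have "\<dots> \<le> a powr (p - 1) * a + b powr (p - 1) * b - (a powr (p - 2) + b powr (p - 2)) * (\<xi> \<bullet> \<eta>)"
    using 1 by simp
  also have "\<dots> = (pflux p \<xi> - pflux p \<eta>) \<bullet> (\<xi> - \<eta>)"
    unfolding base[OF \<open>0 \<le> a\<close>, symmetric] base[OF \<open>0 \<le> b\<close>, symmetric]
    by (simp add: pflux_def a_def b_def inner_diff_left inner_diff_right inner_commute[of \<eta>]
        dot_square_norm power2_eq_square algebra_simps)
  finally show ?thesis .
qed

lemma Linf_imp_bounded:
  assumes "u \<in> Linf \<Omega>" obtains M where "0 \<le> M" "AE x in lebesgue_on \<Omega>. \<bar>u x\<bar> \<le> M"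
proof -
  have "Linf_norm \<Omega> u < \<infinity>" using assms by (simp add: Linf_def)
  then obtain M where M: "Linf_norm \<Omega> u \<le> ereal M" by (cases "Linf_norm \<Omega> u") auto
  have "AE x in lebesgue_on \<Omega>. ereal \<bar>u x\<bar> \<le> Linf_norm \<Omega> u"
    unfolding Linf_norm_def by (rule esssup_AE)
  then have "AE x in lebesgue_on \<Omega>. \<bar>u x\<bar> \<le> max M 0"
  proof eventually_elim
    case (elim x)
    then have "ereal \<bar>u x\<bar> \<le> ereal M" using M by (rule order_trans)
    then show ?case by simp
  qed
  then show ?thesis by (rule that[rotated]) simp
qed

lemma bounded_imp_Linf:
  assumes "u \<in> borel_measurable (lebesgue_on \<Omega>)" "AE x in lebesgue_on \<Omega>. \<bar>u x\<bar> \<le> M"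
  shows "u \<in> Linf \<Omega>" "Linf_norm \<Omega> u \<le> ereal M"
proof -
  show "Linf_norm \<Omega> u \<le> ereal M"
    unfolding Linf_norm_def using assms by (intro esssup_I) auto
  then show "u \<in> Linf \<Omega>" using assms(1) unfolding Linf_def by (auto intro: order.strict_trans1)
qed

lemma continuous_on_interval_bounded:
  fixes g :: "real \<Rightarrow> real"
  assumes "continuous_on {a..b} g"
  obtains B where "0 \<le> B" "\<And>t. t \<in> {a..b} \<Longrightarrow> \<bar>g t\<bar> \<le> B"
proof -
  obtain B where "\<forall>t\<in>{a..b}. \<bar>g t\<bar> \<le> B"
    using compact_imp_bounded[OF compact_continuous_image[OF assms compact_Icc]]
    by (auto simp: bounded_iff)
  then have "\<bar>g t\<bar> \<le> max B 0" if "t \<in> {a..b}" for t using that by (simp add: le_max_iff_disj)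
  then show ?thesis by (intro that[of "max B 0"] max.cobounded2)
qed

text \<open>Test the equation with the positive part of \<open>u - w\<close>, where \<open>w x = q (x \<bullet> e + c)\<close>. The flux of
  \<open>w\<close> is \<open>q' powr (p - 1) *\<^sub>R e\<close>, whose divergence is the second summand in \<open>super\<close>. Subtracting the
  integrated identity for \<open>w\<close> gives, with integrals over the set where \<open>u > w\<close>,
  \<open>\<integral> (pflux p Du - pflux p Dw) \<bullet> (Du - Dw) = \<integral> (lam * f u + (q' powr (p - 1))') * (u - w)\<close>.
  The left-hand side is nonnegative by monotonicity; the integrand on the right is negative, so the set
  \<open>u > w\<close> is null.\<close>

lemma weak_comparison:
  fixes \<Omega> :: "'a::euclidean_space set"
  assumes \<Omega>: "open \<Omega>" "bounded \<Omega>" and p: "1 < p"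
    and f: "continuous_on UNIV f" and sol: "bounded_solution \<Omega> p f lam u"
    and e: "norm e = 1" and range: "\<And>x. x \<in> \<Omega> \<Longrightarrow> x \<bullet> e + c \<in> {0..L}"
    and q: "real_polynomial_function q" "real_polynomial_function q''"
      "\<And>t. (q has_real_derivative q' t) (at t)" "\<And>t. (q' has_real_derivative q'' t) (at t)"
    and nn: "\<And>t. t \<in> {0..L} \<Longrightarrow> 0 \<le> q t" and pos: "\<And>t. t \<in> {0..L} \<Longrightarrow> 0 < q' t"
    and super: "AE x in lebesgue_on \<Omega>. q (x \<bullet> e + c) < u x \<longrightarrow>
        lam * f (u x) + (p - 1) * (q' (x \<bullet> e + c) powr (p - 2) * q'' (x \<bullet> e + c)) < 0"
  shows "AE x in lebesgue_on \<Omega>. u x \<le> q (x \<bullet> e + c)"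
proof -
  note fin = finite_measure_bounded_open[OF \<Omega>]
  interpret finite_measure "lebesgue_on \<Omega>" by (rule fin)
  have p1: "1 \<le> p" and p0: "0 \<le> p" using p by auto
  define z where "z x = x \<bullet> e + c" for x
  have z: "z x \<in> {0..L}" if "x \<in> \<Omega>" for x using range[OF that] by (simp add: z_def)
  have zc: "continuous_on UNIV z" unfolding z_def by (intro continuous_intros)
  have zd: "(z has_derivative (\<lambda>v. v \<bullet> e)) (at x)" for x
    unfolding z_def by (auto intro!: derivative_eq_intros)
  have ee: "e \<bullet> e = 1" using e by (simp add: dot_square_norm)
  have qc: "continuous_on S q" for S
    using q(3) by (meson DERIV_isCont continuous_at_imp_continuous_on)
  have q'c: "continuous_on S q'" for S
    using q(4) by (meson DERIV_isCont continuous_at_imp_continuous_on)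
  have q''c: "continuous_on S q''" for S
    using continuous_real_polymonial_function[OF q(2)] by (simp add: continuous_at_imp_continuous_on)
  define \<beta> where "\<beta> t = q' t powr (p - 1)" for t
  define \<beta>' where "\<beta>' t = (p - 1) * (q' t powr (p - 2) * q'' t)" for t
  have \<beta>d: "(\<beta> has_real_derivative \<beta>' t) (at t)" if "t \<in> {0..L}" for t
    unfolding \<beta>_def \<beta>'_def
    using DERIV_fun_powr[OF q(4) pos[OF that], of "p - 1"] by (simp add: algebra_simps)
  have \<beta>c: "continuous_on {0..L} \<beta>" "continuous_on {0..L} \<beta>'"
    unfolding \<beta>_def \<beta>'_def using pos by (auto intro!: continuous_intros q'c q''c dest: pos)
  obtain B1 where B1: "0 \<le> B1" "\<And>t. t \<in> {0..L} \<Longrightarrow> \<bar>\<beta> t\<bar> \<le> B1"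
    using continuous_on_interval_bounded[OF \<beta>c(1)] by blast
  obtain B2 where B2: "0 \<le> B2" "\<And>t. t \<in> {0..L} \<Longrightarrow> \<bar>\<beta>' t\<bar> \<le> B2"
    using continuous_on_interval_bounded[OF \<beta>c(2)] by blast
  obtain C where C: "0 \<le> C" "\<And>t. t \<in> {0..L} \<Longrightarrow> \<bar>q' t\<bar> \<le> C"
    using continuous_on_interval_bounded[OF q'c] by blast
  define w where "w x = q (z x)" for x
  have wd: "(w has_derivative (\<lambda>v. (q' (z x) *\<^sub>R e) \<bullet> v)) (at x)" for x
    using has_derivative_compose[OF zd, OF q(3)[THEN has_field_derivative_imp_has_derivative]]
    unfolding w_def by (simp add: inner_commute)
  have gw: "grad w x = q' (z x) *\<^sub>R e" for x by (rule grad_eqI[OF wd])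
  have wsm: "smooth w"
    unfolding w_def z_def by (intro allI C_k_polynomial[OF q(1)] C_k_add C_k_inner C_k_const)
  have gwC: "norm (grad w x) \<le> C" if "x \<in> \<Omega>" for x
    using C(2)[OF z[OF that]] e by (simp add: gw)
  have fluxw: "pflux p (grad w x) = \<beta> (z x) *\<^sub>R e" if "x \<in> \<Omega>" for x
    using pos[OF z[OF that]] e powr_mult_base[of "q' (z x)" "p - 2"]
    by (simp add: gw pflux_def \<beta>_def mult.commute)
  from sol obtain Du where uinf: "u \<in> Linf \<Omega>" and uW: "W01p \<Omega> p u Du"
    and weak: "\<And>\<phi> D\<phi>. W01p \<Omega> p \<phi> D\<phi> \<Longrightarrow> \<phi> \<in> Linf \<Omega> \<Longrightarrow>
        (LINT x|lebesgue_on \<Omega>. pflux p (Du x) \<bullet> D\<phi> x) = lam * (LINT x|lebesgue_on \<Omega>. f (u x) * \<phi> x)"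
    unfolding bounded_solution_def pflux_def by blast
  obtain \<phi>0 where "Cc_approx \<Omega> p \<phi>0 u Du" using W01p_imp_Cc_approx[OF uW p1] .
  then obtain \<phi> where \<phi>: "Cc_approx \<Omega> p \<phi> u Du" "AE x in lebesgue_on \<Omega>. (\<lambda>n. \<phi> n x) \<longlonglongrightarrow> u x"
    by (rule Cc_approx_AE_subseq[OF \<Omega> p1]) (rule that)
  have uL: "u \<in> Lp \<Omega> p" "Du \<in> Lp \<Omega> p" using \<phi>(1) by (auto simp: Cc_approx_def)
  obtain M where M: "0 \<le> M" "AE x in lebesgue_on \<Omega>. \<bar>u x\<bar> \<le> M"
    using Linf_imp_bounded[OF uinf] .
  obtain Bf where Bf: "0 \<le> Bf" "\<And>t. t \<in> {-M..M} \<Longrightarrow> \<bar>f t\<bar> \<le> Bf"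
    using continuous_on_interval_bounded[OF continuous_on_subset[OF f subset_UNIV]] by metis
  \<comment> \<open>the admissible test functions that approximate the positive part of \<open>u - w\<close>\<close>
  define \<epsilon> where "\<epsilon> n = 1 / real (Suc n)" for n
  have \<epsilon>: "\<epsilon> n > 0" for n by (simp add: \<epsilon>_def)
  define \<zeta> where "\<zeta> n x = softplus (\<epsilon> n) (u x - w x) - softplus (\<epsilon> n) (- w x)" for n x
  define D\<zeta> where "D\<zeta> n x = logistic (\<epsilon> n) (u x - w x) *\<^sub>R (Du x - grad w x)
      + logistic (\<epsilon> n) (- w x) *\<^sub>R grad w x" for n x
  note approx = Cc_approx_softplus[OF \<Omega> p1 \<phi> \<epsilon> wsm gwC, folded \<zeta>_def D\<zeta>_def]
  have zL: "\<zeta> n \<in> Lp \<Omega> p" "D\<zeta> n \<in> Lp \<Omega> p" for n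
    using approx[of n] by (auto simp: Cc_approx_def \<zeta>_def[abs_def] D\<zeta>_def[abs_def])
  have wc: "continuous_on UNIV w" unfolding w_def by (rule continuous_on_compose2[OF qc zc]) auto
  have gwc: "continuous_on UNIV (grad w)"
    unfolding gw[abs_def] by (intro continuous_intros continuous_on_compose2[OF q'c zc]) auto
  have zm: "z \<in> borel_measurable (lebesgue_on \<Omega>)" by (rule continuous_measurable_lebesgue_on[OF zc \<Omega>(1)])
  have \<beta>zc: "continuous_on \<Omega> (\<lambda>x. \<beta> (z x))" "continuous_on \<Omega> (\<lambda>x. \<beta>' (z x))"
    using z by (auto intro!: continuous_on_compose2[OF \<beta>c(1)] continuous_on_compose2[OF \<beta>c(2)]
        continuous_on_subset[OF zc])
  have Om: "\<Omega> \<in> sets lebesgue" using \<Omega>(1) by simp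
  have flm: "pflux p \<in> borel_measurable (borel :: 'a measure)"
    unfolding pflux_def by measurable
  note [measurable] = Lp_measurable[OF uL(1)] Lp_measurable[OF uL(2)]
    Lp_measurable[OF zL(1)] Lp_measurable[OF zL(2)] flm
    continuous_measurable_lebesgue_on[OF wc \<Omega>(1)] continuous_measurable_lebesgue_on[OF gwc \<Omega>(1)]
    continuous_imp_measurable_on_sets_lebesgue[OF \<beta>zc(1) Om]
    continuous_imp_measurable_on_sets_lebesgue[OF \<beta>zc(2) Om]
    borel_measurable_continuous_onI[OF f]
  define k where "k x = lam * f (u x) + \<beta>' (z x)" for x
  have km [measurable]: "k \<in> borel_measurable (lebesgue_on \<Omega>)" unfolding k_def by measurable
  have kb: "AE x in lebesgue_on \<Omega>. \<bar>k x\<bar> \<le> \<bar>lam\<bar> * Bf + B2"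
    using M(2) AE_space
  proof eventually_elim
    case (elim x)
    have "u x \<in> {-M..M}" using elim by (auto simp: abs_le_iff)
    then have "\<bar>f (u x)\<bar> \<le> Bf" "\<bar>\<beta>' (z x)\<bar> \<le> B2" using elim z[of x] Bf(2)[of "u x"] B2(2) by auto
    then have "\<bar>lam * f (u x)\<bar> \<le> \<bar>lam\<bar> * Bf" by (simp add: abs_mult mult_left_mono)
    then show ?case using \<open>\<bar>\<beta>' (z x)\<bar> \<le> B2\<close> unfolding k_def by linarith
  qed
  have \<zeta>le: "\<bar>\<zeta> n x\<bar> \<le> \<bar>u x\<bar>" for n x
    unfolding \<zeta>_def using softplus_lipschitz[OF \<epsilon>, of n "u x - w x" "- w x"] by simp
  have \<zeta>b: "AE x in lebesgue_on \<Omega>. \<bar>\<zeta> n x\<bar> \<le> M" for n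
    using M(2) by eventually_elim (rule order_trans[OF \<zeta>le])
  have D\<zeta>le: "norm (D\<zeta> n x) \<le> norm (Du x) + 2 * C" if "x \<in> \<Omega>" for n x
  proof -
    have "norm (D\<zeta> n x) \<le> norm (Du x - grad w x) + norm (grad w x)"
      unfolding D\<zeta>_def using logistic_bounds[of "\<epsilon> n"]
      by (intro norm_triangle_le add_mono) (auto intro: mult_left_le_one_le)
    also have "\<dots> \<le> norm (Du x) + 2 * norm (grad w x)"
      using norm_triangle_ineq4[of "Du x" "grad w x"] by simp
    finally show ?thesis using gwC[OF that] by simp
  qed
  \<comment> \<open>\<open>?G (norm (Du x))\<close> bounds the integrand of the flux term, and \<open>?H\<close> bounds \<open>?G\<close> by an
    integrable function\<close>
  let ?G = "\<lambda>y. (y powr (p - 1) + B1) * (y + 2 * C)"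
  let ?H = "\<lambda>y. y powr p + (2 * C + B1) * (1 + y powr p) + 2 * B1 * C"
  have GH: "?G y \<le> ?H y" if "0 \<le> y" for y
  proof -
    have "y powr (p - 1) * y = y powr p"
      using powr_mult_base[of y "p - 1"] that by (cases "y = 0") (auto simp: mult.commute)
    moreover have "y powr (p - 1) \<le> 1 + y powr p \<and> y \<le> 1 + y powr p"
    proof (cases "y \<le> 1")
      case True
      then have "y powr (p - 1) \<le> 1" using p that by (intro powr_le1) auto
      then show ?thesis using True by (auto intro: add_increasing2)
    next
      case False
      then have "y powr (p - 1) \<le> y powr p" "y powr 1 \<le> y powr p"
        using p by (intro powr_mono; simp)+
      moreover have "y powr 1 = y" using that by simp
      ultimately show ?thesis using False by (intro conjI) linarith+
    qed
    then have "2 * C * y powr (p - 1) + B1 * y \<le> 2 * C * (1 + y powr p) + B1 * (1 + y powr p)"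
      using C(1) B1(1) by (intro add_mono mult_left_mono) auto
    ultimately show ?thesis by (simp add: algebra_simps)
  qed
  have Hi: "integrable (lebesgue_on \<Omega>) (\<lambda>x. ?H (norm (Du x)))"
    using Lp_integrable_powr[OF uL(2)] by simp
  have inner_le: "norm ((pflux p (Du x) - \<beta> (z x) *\<^sub>R e) \<bullet> V) \<le> ?H (norm (Du x))"
    if "x \<in> \<Omega>" "norm V \<le> norm (Du x) + 2 * C" for x V
  proof -
    have "norm ((pflux p (Du x) - \<beta> (z x) *\<^sub>R e) \<bullet> V) \<le> norm (pflux p (Du x) - \<beta> (z x) *\<^sub>R e) * norm V"
      using Cauchy_Schwarz_ineq2 by auto
    also have "\<dots> \<le> ?G (norm (Du x))"
    proof (intro mult_mono that(2))
      have "norm (pflux p (Du x) - \<beta> (z x) *\<^sub>R e) \<le> norm (pflux p (Du x)) + norm (\<beta> (z x) *\<^sub>R e)"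
        by (rule norm_triangle_ineq4)
      then show "norm (pflux p (Du x) - \<beta> (z x) *\<^sub>R e) \<le> norm (Du x) powr (p - 1) + B1"
        using B1(2)[OF z[OF that(1)]] e by (simp add: norm_pflux)
    qed (use B1(1) in auto)
    also have "\<dots> \<le> ?H (norm (Du x))" by (rule GH) simp
    finally show ?thesis .
  qed
  have eq: "(LINT x|lebesgue_on \<Omega>. (pflux p (Du x) - \<beta> (z x) *\<^sub>R e) \<bullet> D\<zeta> n x) = (LINT x|lebesgue_on \<Omega>. k x * \<zeta> n x)" for n
  proof -
    have "W01p \<Omega> p (\<zeta> n) (D\<zeta> n)"
      by (rule Cc_approx_imp_W01p[OF \<Omega> p1 approx[of n, folded \<zeta>_def[abs_def] D\<zeta>_def[abs_def]]])
    moreover have "\<zeta> n \<in> Linf \<Omega>" by (rule bounded_imp_Linf(1)[OF _ \<zeta>b]) measurable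
    ultimately have 1: "(LINT x|lebesgue_on \<Omega>. pflux p (Du x) \<bullet> D\<zeta> n x) = lam * (LINT x|lebesgue_on \<Omega>. f (u x) * \<zeta> n x)"
      by (rule weak)
    have 2: "(LINT x|lebesgue_on \<Omega>. \<beta> (z x) * (D\<zeta> n x \<bullet> e)) = - (LINT x|lebesgue_on \<Omega>. (\<beta>' (z x) * (e \<bullet> e)) * \<zeta> n x)"
    proof (rule Cc_approx_integral_by_parts[OF \<Omega> p1 approx[of n, folded \<zeta>_def[abs_def] D\<zeta>_def[abs_def]],
          where B="max B1 B2" and b="\<lambda>x. \<beta> (z x)" and b'="\<lambda>x v. \<beta>' (z x) * (v \<bullet> e)"])
      show "((\<lambda>x. \<beta> (z x)) has_derivative (\<lambda>v. \<beta>' (z x) * (v \<bullet> e))) (at x)" if "x \<in> \<Omega>" for x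
        using has_derivative_compose[OF zd \<beta>d[OF z[OF that], THEN has_field_derivative_imp_has_derivative]]
        by simp
    qed (use e B1(2) B2(2) z \<beta>zc in \<open>auto simp: ee le_max_iff_disj\<close>)
    have i1: "integrable (lebesgue_on \<Omega>) (\<lambda>x. pflux p (Du x) \<bullet> D\<zeta> n x)"
    proof (rule Bochner_Integration.integrable_bound[OF Hi])
      have "norm (pflux p (Du x) \<bullet> D\<zeta> n x) \<le> norm (?H (norm (Du x)))" if "x \<in> \<Omega>" for x
      proof -
        have "norm (pflux p (Du x) \<bullet> D\<zeta> n x) \<le> norm (pflux p (Du x)) * norm (D\<zeta> n x)"
          using Cauchy_Schwarz_ineq2 by auto
        also have "\<dots> \<le> ?G (norm (Du x))"
          using D\<zeta>le[OF that] B1(1) by (intro mult_mono) (auto simp: norm_pflux)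
        also have "\<dots> \<le> ?H (norm (Du x))" by (rule GH) simp
        finally show ?thesis by simp
      qed
      then show "AE x in lebesgue_on \<Omega>. norm (pflux p (Du x) \<bullet> D\<zeta> n x) \<le> norm (?H (norm (Du x)))"
        by (intro AE_I2) simp
    qed measurable
    have i2: "integrable (lebesgue_on \<Omega>) (\<lambda>x. (pflux p (Du x) - \<beta> (z x) *\<^sub>R e) \<bullet> D\<zeta> n x)"
    proof (rule Bochner_Integration.integrable_bound[OF Hi])
      show "AE x in lebesgue_on \<Omega>. norm ((pflux p (Du x) - \<beta> (z x) *\<^sub>R e) \<bullet> D\<zeta> n x) \<le> norm (?H (norm (Du x)))"
        using order_trans[OF inner_le[OF _ D\<zeta>le] abs_ge_self] by (intro AE_I2) auto
    qed measurable
    have i3: "integrable (lebesgue_on \<Omega>) (\<lambda>x. \<beta> (z x) * (D\<zeta> n x \<bullet> e))"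
      using Bochner_Integration.integrable_diff[OF i1 i2] by (simp add: inner_diff_left inner_commute[of _ e])
    have i4: "integrable (lebesgue_on \<Omega>) (\<lambda>x. k x * \<zeta> n x)"
    proof (rule integrable_bounded[OF fin, of _ "(\<bar>lam\<bar> * Bf + B2) * M"])
      show "AE x in lebesgue_on \<Omega>. norm (k x * \<zeta> n x) \<le> (\<bar>lam\<bar> * Bf + B2) * M"
        using kb \<zeta>b[of n] by eventually_elim (use M(1) in \<open>auto simp: abs_mult intro!: mult_mono\<close>)
    qed measurable
    have i5: "integrable (lebesgue_on \<Omega>) (\<lambda>x. \<beta>' (z x) * \<zeta> n x)"
    proof (rule integrable_bounded[OF fin, of _ "B2 * M"])
      show "AE x in lebesgue_on \<Omega>. norm (\<beta>' (z x) * \<zeta> n x) \<le> B2 * M"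
        using AE_space \<zeta>b[of n]
        by eventually_elim (use M(1) B2 z in \<open>auto simp: abs_mult intro!: mult_mono\<close>)
    qed measurable
    have i6: "integrable (lebesgue_on \<Omega>) (\<lambda>x. lam * (f (u x) * \<zeta> n x))"
      using Bochner_Integration.integrable_diff[OF i4 i5] by (simp add: k_def algebra_simps)
    have "(LINT x|lebesgue_on \<Omega>. (pflux p (Du x) - \<beta> (z x) *\<^sub>R e) \<bullet> D\<zeta> n x)
      = (LINT x|lebesgue_on \<Omega>. pflux p (Du x) \<bullet> D\<zeta> n x) - (LINT x|lebesgue_on \<Omega>. \<beta> (z x) * (D\<zeta> n x \<bullet> e))"
      using Bochner_Integration.integral_diff[OF i1 i3] by (simp add: inner_diff_left inner_commute[of _ e])
    also have "\<dots> = (LINT x|lebesgue_on \<Omega>. lam * (f (u x) * \<zeta> n x)) + (LINT x|lebesgue_on \<Omega>. \<beta>' (z x) * \<zeta> n x)"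
      unfolding 1 2 ee by simp
    also have "\<dots> = (LINT x|lebesgue_on \<Omega>. k x * \<zeta> n x)"
      using Bochner_Integration.integral_add[OF i6 i5] by (simp add: k_def algebra_simps)
    finally show ?thesis .
  qed
  define V where "V x = (if 0 < u x - w x then Du x - grad w x else 0)" for x
  have Vm [measurable]: "V \<in> borel_measurable (lebesgue_on \<Omega>)" unfolding V_def by measurable
  have lim1: "(\<lambda>n. LINT x|lebesgue_on \<Omega>. (pflux p (Du x) - \<beta> (z x) *\<^sub>R e) \<bullet> D\<zeta> n x)
      \<longlonglongrightarrow> (LINT x|lebesgue_on \<Omega>. (pflux p (Du x) - \<beta> (z x) *\<^sub>R e) \<bullet> V x)"
  proof (rule integral_dominated_convergence[OF _ _ Hi])
    show "AE x in lebesgue_on \<Omega>. (\<lambda>n. (pflux p (Du x) - \<beta> (z x) *\<^sub>R e) \<bullet> D\<zeta> n x)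
        \<longlonglongrightarrow> (pflux p (Du x) - \<beta> (z x) *\<^sub>R e) \<bullet> V x"
    proof (rule AE_I2)
      fix x assume "x \<in> space (lebesgue_on \<Omega>)"
      then have "\<not> 0 < - w x" using nn[OF z] by (auto simp: w_def not_less)
      have "(\<lambda>n. D\<zeta> n x) \<longlonglongrightarrow> (if 0 < u x - w x then 1 else 0) *\<^sub>R (Du x - grad w x)
          + (if 0 < - w x then 1 else 0) *\<^sub>R grad w x"
        unfolding D\<zeta>_def \<epsilon>_def by (intro tendsto_intros logistic_tendsto)
      also have "(if 0 < u x - w x then 1 else 0) *\<^sub>R (Du x - grad w x)
          + (if 0 < - w x then 1 else 0) *\<^sub>R grad w x = V x"
        using \<open>\<not> 0 < - w x\<close> by (simp add: V_def)
      finally show "(\<lambda>n. (pflux p (Du x) - \<beta> (z x) *\<^sub>R e) \<bullet> D\<zeta> n x)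
          \<longlonglongrightarrow> (pflux p (Du x) - \<beta> (z x) *\<^sub>R e) \<bullet> V x"
        by (intro tendsto_intros)
    qed
    show "AE x in lebesgue_on \<Omega>. norm ((pflux p (Du x) - \<beta> (z x) *\<^sub>R e) \<bullet> D\<zeta> n x) \<le> ?H (norm (Du x))" for n
      using inner_le[OF _ D\<zeta>le] by (intro AE_I2) auto
  qed measurable
  have lim2: "(\<lambda>n. LINT x|lebesgue_on \<Omega>. k x * \<zeta> n x) \<longlonglongrightarrow> (LINT x|lebesgue_on \<Omega>. k x * max 0 (u x - w x))"
  proof (rule integral_dominated_convergence[where w="\<lambda>x. (\<bar>lam\<bar> * Bf + B2) * M"])
    show "AE x in lebesgue_on \<Omega>. (\<lambda>n. k x * \<zeta> n x) \<longlonglongrightarrow> k x * max 0 (u x - w x)"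
    proof (rule AE_I2)
      fix x assume "x \<in> space (lebesgue_on \<Omega>)"
      then have "0 \<le> w x" using nn[OF z] by (auto simp: w_def)
      have "(\<lambda>n. \<zeta> n x) \<longlonglongrightarrow> max 0 (u x - w x) - max 0 (- w x)"
        unfolding \<zeta>_def \<epsilon>_def by (intro tendsto_diff softplus_tendsto)
      then show "(\<lambda>n. k x * \<zeta> n x) \<longlonglongrightarrow> k x * max 0 (u x - w x)"
        using \<open>0 \<le> w x\<close> by (intro tendsto_mult_left) simp
    qed
    show "AE x in lebesgue_on \<Omega>. norm (k x * \<zeta> n x) \<le> (\<bar>lam\<bar> * Bf + B2) * M" for n
      using kb \<zeta>b[of n] by eventually_elim (use M(1) in \<open>auto simp: abs_mult intro!: mult_mono\<close>)
  qed (simp_all)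
  have "(LINT x|lebesgue_on \<Omega>. (pflux p (Du x) - \<beta> (z x) *\<^sub>R e) \<bullet> V x) = (LINT x|lebesgue_on \<Omega>. k x * max 0 (u x - w x))"
    using LIMSEQ_unique[OF lim1] lim2 unfolding eq by blast
  moreover have "0 \<le> (LINT x|lebesgue_on \<Omega>. (pflux p (Du x) - \<beta> (z x) *\<^sub>R e) \<bullet> V x)"
  proof (rule integral_nonneg_AE, rule AE_I2)
    fix x assume "x \<in> space (lebesgue_on \<Omega>)"
    then show "0 \<le> (pflux p (Du x) - \<beta> (z x) *\<^sub>R e) \<bullet> V x"
      using pflux_monotone[OF p, of "Du x" "grad w x"] fluxw[of x] by (auto simp: V_def)
  qed
  ultimately have ge: "0 \<le> (LINT x|lebesgue_on \<Omega>. k x * max 0 (u x - w x))" by simp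
  have neg: "AE x in lebesgue_on \<Omega>. w x < u x \<longrightarrow> k x < 0"
    using super by (simp add: w_def k_def \<beta>'_def z_def)
  have ki: "integrable (lebesgue_on \<Omega>) (\<lambda>x. - (k x * max 0 (u x - w x)))"
  proof (rule integrable_bounded[OF fin, of _ "(\<bar>lam\<bar> * Bf + B2) * M"])
    show "AE x in lebesgue_on \<Omega>. norm (- (k x * max 0 (u x - w x))) \<le> (\<bar>lam\<bar> * Bf + B2) * M"
      using kb M(2) AE_space
    proof eventually_elim
      case (elim x)
      then have "0 \<le> w x" using nn[OF z] by (auto simp: w_def)
      then have "\<bar>max 0 (u x - w x)\<bar> \<le> M" using elim M(1) by auto
      then show ?case using elim(1) M(1) by (simp add: abs_mult) (intro mult_mono; auto)
    qed
  qed measurable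
  have knn: "AE x in lebesgue_on \<Omega>. 0 \<le> - (k x * max 0 (u x - w x))"
    using neg by eventually_elim (auto simp: max_def mult_nonpos_nonneg)
  have "(LINT x|lebesgue_on \<Omega>. - (k x * max 0 (u x - w x))) = 0"
    using ge integral_nonneg_AE[OF knn] by simp
  then have "AE x in lebesgue_on \<Omega>. - (k x * max 0 (u x - w x)) = 0"
    using integral_nonneg_eq_0_iff_AE[OF ki knn] by blast
  then show ?thesis
    using neg by eventually_elim (auto simp: max_def w_def z_def split: if_splits)
qed


section \<open>The one-dimensional barrier\<close>

lemma DERIV_square_pos_part: "((\<lambda>t. (max 0 t)\<^sup>2 / 2) has_real_derivative max 0 t) (at (t::real))"
proof -
  have est: "\<bar>(max 0 (t + h))\<^sup>2 / 2 - (max 0 t)\<^sup>2 / 2 - max 0 t * h\<bar> \<le> h\<^sup>2" for h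
  proof -
    consider "0 \<le> t" "0 \<le> t + h" | "0 \<le> t" "t + h < 0" | "t < 0" "0 \<le> t + h" | "t < 0" "t + h < 0"
      by linarith
    then show ?thesis
    proof cases
      case 1
      then show ?thesis by (simp add: power2_eq_square field_simps)
    next
      case 2
      have "t * t \<le> t * (- h)" "t * (-h) \<le> (-h) * (-h)" using 2 by (intro mult_left_mono mult_right_mono; linarith)+
      moreover have "0 \<le> t * t" "0 \<le> h * h" by simp_all
      ultimately have "\<bar>- (t * t) / 2 - t * h\<bar> \<le> h * h" unfolding abs_le_iff by (intro conjI) linarith+
      then show ?thesis using 2 by (simp add: power2_eq_square)
    next
      case 3
      then have "(t + h)\<^sup>2 \<le> h\<^sup>2" by (intro power_mono) auto
      then have "(t + h)\<^sup>2 / 2 \<le> h\<^sup>2" using zero_le_power2[of h] by linarith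
      then show ?thesis using 3 by (simp add: max_def)
    qed simp
  qed
  have "((\<lambda>h. ((max 0 (t + h))\<^sup>2 / 2 - (max 0 t)\<^sup>2 / 2) / h - max 0 t) \<longlongrightarrow> 0) (at 0)"
  proof (rule Lim_null_comparison)
    show "((\<lambda>h::real. \<bar>h\<bar>) \<longlongrightarrow> 0) (at 0)" by (intro tendsto_eq_intros) auto
    have "norm (((max 0 (t + h))\<^sup>2 / 2 - (max 0 t)\<^sup>2 / 2) / h - max 0 t) \<le> \<bar>h\<bar>" if "h \<noteq> 0" for h
    proof -
      have "((max 0 (t + h))\<^sup>2 / 2 - (max 0 t)\<^sup>2 / 2) / h - max 0 t
          = ((max 0 (t + h))\<^sup>2 / 2 - (max 0 t)\<^sup>2 / 2 - max 0 t * h) / h"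
        using that by (simp add: diff_divide_distrib)
      also have "norm \<dots> \<le> h\<^sup>2 / \<bar>h\<bar>"
        using est[of h] by (simp add: divide_right_mono)
      also have "h\<^sup>2 / \<bar>h\<bar> = \<bar>h\<bar>"
        using that by (cases "h < 0") (simp_all add: power2_eq_square)
      finally show ?thesis .
    qed
    then show "\<forall>\<^sub>F h in at 0. norm (((max 0 (t + h))\<^sup>2 / 2 - (max 0 t)\<^sup>2 / 2) / h - max 0 t) \<le> \<bar>h\<bar>"
      by (simp add: eventually_at_filter)
  qed
  then show ?thesis unfolding DERIV_def by (simp add: LIM_zero_iff)
qed

text \<open>The derivative of the clip is a trapezoid: the slope rises
  linearly from 0 to 1 on \<open>{-r..0}\<close> and falls back to 0 on \<open>{M..M + r}\<close>.\<close>

lemma smooth_clip: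
  fixes M r :: real assumes "0 \<le> M" "0 < r"
  obtains c c' where "\<And>s. (c has_real_derivative c' s) (at s)" "continuous_on UNIV c'"
    "\<And>s. s \<in> {0..M} \<Longrightarrow> c s = s" "\<And>s. s \<in> {0..M} \<Longrightarrow> c' s = 1" "\<And>s. c s \<in> {-r..M + r}"
proof -
  define P where "P t = (max 0 t)\<^sup>2 / 2" for t :: real
  define c where "c s = (P (s + r) - P s - P (s - M) + P (s - M - r)) / r - r / 2" for s
  define c' where "c' s = (max 0 (s + r) - max 0 s - max 0 (s - M) + max 0 (s - M - r)) / r" for s
  have P: "((\<lambda>s. P (s + k)) has_real_derivative max 0 (s + k)) (at s)" for s k
    using DERIV_square_pos_part unfolding P_def DERIV_shift[symmetric, of "\<lambda>t. (max 0 t)\<^sup>2 / 2"] by blast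
  have 1: "(c has_real_derivative c' s) (at s)" for s
  proof -
    have "(c has_real_derivative (max 0 (s + r) - max 0 s - max 0 (s - M) + max 0 (s - M - r)) / r - 0) (at s)"
      unfolding c_def
      using P[of r s] P[of 0 s] P[of "- M" s] P[of "- M - r" s]
      by (intro DERIV_diff DERIV_cdivide DERIV_add DERIV_const) (simp_all add: algebra_simps)
    then show ?thesis by (simp add: c'_def)
  qed
  have 2: "continuous_on UNIV c'" unfolding c'_def using assms by (intro continuous_intros) auto
  have 3: "c s = s" "c' s = 1" if "s \<in> {0..M}" for s
    using that assms by (auto simp: c_def c'_def P_def field_simps power2_eq_square max_def)
  have 4: "c s \<in> {-r..M + r}" for s
  proof -
    consider "s \<le> -r" | "-r \<le> s" "s \<le> 0" | "s \<in> {0..M}" | "M \<le> s" "s \<le> M + r" | "M + r \<le> s"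
      by fastforce
    then show ?thesis
    proof cases
      case 1
      then have "c s = - r / 2" using assms by (simp add: c_def P_def max_def)
      then show ?thesis using assms by simp
    next
      case 2
      then have "c s = (s + r)\<^sup>2 / (2 * r) - r / 2" using assms by (auto simp: c_def P_def max_def)
      moreover have "(s + r)\<^sup>2 \<le> r\<^sup>2" using 2 by (intro power_mono) auto
      then have "(s + r)\<^sup>2 / (2 * r) \<le> r / 2" using assms by (simp add: field_simps power2_eq_square)
      moreover have "0 \<le> (s + r)\<^sup>2 / (2 * r)" using assms by simp
      ultimately have "- r / 2 \<le> c s" "c s \<le> 0" by linarith+
      then show ?thesis using assms by auto
    next
      case 3 then show ?thesis using \<open>s \<in> {0..M} \<Longrightarrow> c s = s\<close> assms by auto
    next
      case 4
      define y where "y = s - M"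
      have y: "0 \<le> y" "y \<le> r" "s = M + y" using 4 by (auto simp: y_def)
      have "c s = ((M + y + r)\<^sup>2 - (M + y)\<^sup>2 - y\<^sup>2) / (2 * r) - r / 2"
        using y assms by (auto simp: c_def P_def max_def field_simps)
      also have "\<dots> = M + y - y\<^sup>2 / (2 * r)" using assms by (simp add: field_simps power2_eq_square)
      finally have eq: "c s = M + y - y\<^sup>2 / (2 * r)" .
      have "y\<^sup>2 \<le> y * (2 * r)" using y assms unfolding power2_eq_square by (intro mult_left_mono) auto
      then have "y\<^sup>2 / (2 * r) \<le> y" using assms by (simp add: divide_le_eq)
      moreover have "0 \<le> y\<^sup>2 / (2 * r)" using assms by simp
      ultimately have "- r \<le> c s" "c s \<le> M + r" using eq y assms by linarith+
      then show ?thesis by simp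
    next
      case 5
      define y where "y = s - M"
      have y: "r \<le> y" "s = M + y" using 5 by (auto simp: y_def)
      have "c s = ((M + y + r)\<^sup>2 - (M + y)\<^sup>2 - y\<^sup>2 + (y - r)\<^sup>2) / (2 * r) - r / 2"
        using y assms by (auto simp: c_def P_def max_def field_simps)
      also have "\<dots> = M + r / 2" using assms by (simp add: field_simps power2_eq_square)
      finally show ?thesis using assms by auto
    qed
  qed
  show ?thesis by (rule that[OF 1 2 3 4])
qed

lemma continuous_antiderivative:
  fixes g :: "real \<Rightarrow> real" assumes "continuous_on UNIV g"
  obtains G where "\<And>s. (G has_real_derivative g s) (at s)" "G 0 = 0"
proof -
  have "isCont g x" for x using assms by (simp add: continuous_on_eq_continuous_at)
  then have "\<exists>G. \<forall>x::real. -\<infinity> < ereal x \<longrightarrow> ereal x < \<infinity> \<longrightarrow> (G has_vector_derivative g x) (at x)"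
    by (intro einterval_antiderivative) auto
  then obtain G where G: "\<And>s. (G has_real_derivative g s) (at s)"
    by (auto simp: has_real_derivative_iff_has_vector_derivative)
  show ?thesis
    by (rule that[of "\<lambda>s. G s - G 0"]) (auto intro!: derivative_eq_intros G)
qed

text \<open>Separation of variables: \<open>w\<close> is the inverse of the antiderivative \<open>X\<close> of \<open>1 / g\<close>, which maps onto
  the real line because its slope is at least \<open>1 / K\<close>.\<close>

lemma autonomous_ode_solution:
  fixes g :: "real \<Rightarrow> real"
  assumes g: "continuous_on UNIV g" "\<And>s. 0 < g s" "\<And>s. g s \<le> K"
  obtains X w where "\<And>s. (X has_real_derivative 1 / g s) (at s)" "X 0 = 0"
    "\<And>t. (w has_real_derivative g (w t)) (at t)" "\<And>s. w (X s) = s" "\<And>t. X (w t) = t" "strict_mono w"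
proof -
  have K: "0 < K" using g(2,3)[of 0] by linarith
  have "continuous_on UNIV (\<lambda>s. 1 / g s)" using g(1,2) by (intro continuous_intros) (auto simp: less_imp_neq[symmetric])
  then obtain X where X: "\<And>s. (X has_real_derivative 1 / g s) (at s)" "X 0 = 0"
    using continuous_antiderivative by metis
  have grow: "(b - a) / K \<le> X b - X a" if "a \<le> b" for a b
  proof -
    have "(\<lambda>s. X s - s / K) a \<le> (\<lambda>s. X s - s / K) b"
    proof (rule DERIV_nonneg_imp_nondecreasing[OF that])
      fix s
      have "1 / K \<le> 1 / g s" using g K by (intro divide_left_mono) auto
      then show "\<exists>y. ((\<lambda>s. X s - s / K) has_real_derivative y) (at s) \<and> 0 \<le> y"
        using K by (intro exI[of _ "1 / g s - 1 / K"]) (auto intro!: derivative_eq_intros X)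
    qed
    then show ?thesis by (simp add: diff_divide_distrib)
  qed
  have mono: "strict_mono X"
  proof (rule strict_monoI)
    fix a b :: real assume "a < b"
    then have "0 < (b - a) / K" using K by simp
    then show "X a < X b" using grow[of a b] \<open>a < b\<close> by linarith
  qed
  have cont: "isCont X s" for s using X(1) by (rule DERIV_isCont)
  have surj: "\<exists>s. X s = t" for t
  proof -
    define a where "a = - (\<bar>t\<bar> * K)" define b where "b = \<bar>t\<bar> * K"
    have ab: "a \<le> 0" "0 \<le> b" using K by (auto simp: a_def b_def)
    have "X a \<le> t" using grow[OF ab(1)] K X(2) by (simp add: a_def)
    moreover have "t \<le> X b" using grow[OF ab(2)] K X(2) by (simp add: b_def)
    ultimately show ?thesis using IVT[of X a t b] ab cont by force
  qed
  define w where "w = inv X"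
  have wX: "w (X s) = s" for s using strict_mono_imp_inj_on[OF mono] by (simp add: w_def)
  have Xw: "X (w t) = t" for t using surj[of t] by (metis wX)
  have wcont: "isCont w t" for t
    using isCont_inverse_function[of 1 "w t" w X] wX cont Xw by simp
  have w: "(w has_real_derivative g (w t)) (at t)" for t
    using DERIV_inverse_function[of X "1 / g (w t)" w t "t - 1" "t + 1"] X(1) g(2)[of "w t"] Xw wcont
    by simp
  have "strict_mono w"
    by (rule strict_monoI) (metis Xw mono strict_mono_less)
  then show ?thesis using that[OF X w wX Xw] by blast
qed

text \<open>The energy equation of the overview. The profile has to continue beyond the value \<open>M\<close>, because a
  translate that lies above \<open>M\<close> at one end of \<open>\<Omega>\<close> still increases across the width of \<open>\<Omega>\<close>. The
  energy \<open>H0\<close> need not stay positive there, so it is precomposed with a clip that is the identity on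
  \<open>{0..M}\<close>. The inequality \<open>w D < M\<close> comes from \<open>g s \<le> \<kappa> * (s + B)\<close>: reaching \<open>M\<close> takes at least the time
  \<open>ln ((M + B) / B) / \<kappa>\<close>, which exceeds \<open>D\<close> by the last assumption.\<close>

lemma barrier_profile:
  fixes f \<Phi> :: "real \<Rightarrow> real"
  assumes p: "1 < p" and f: "continuous_on UNIV f"
    and \<Phi>: "\<And>s. (\<Phi> has_real_derivative f s) (at s)" "\<Phi> 0 = 0"
    and M: "0 < M" and E: "\<And>s. s \<in> {0..M} \<Longrightarrow> lam * \<Phi> s < E"
    and \<kappa>: "0 < \<kappa>" and B: "0 < B"
    and speed: "\<And>s. s \<in> {0..M} \<Longrightarrow> p / (p - 1) * (E - lam * \<Phi> s) \<le> (\<kappa> * (s + B)) powr p"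
    and D: "B * (exp (\<kappa> * D) - 1) < M"
  obtains w w' w'' T where
    "\<And>t. (w has_real_derivative w' t) (at t)" "\<And>t. (w' has_real_derivative w'' t) (at t)"
    "continuous_on UNIV w''" "\<And>t. 0 < w' t" "w 0 = 0" "0 < T" "M < w T" "w D < M"
    "\<And>t. w t \<in> {0..M} \<Longrightarrow> lam * f (w t) + (p - 1) * (w' t powr (p - 2) * w'' t) < 0"
proof -
  have \<Phi>c: "isCont \<Phi> s" for s using \<Phi>(1) by (rule DERIV_isCont)
  have \<Phi>cont: "continuous_on S \<Phi>" for S using \<Phi>c by (simp add: continuous_at_imp_continuous_on)
  have fcont: "continuous_on S f" for S using f by (rule continuous_on_subset) simp
  have "\<exists>s0\<in>{0..M}. \<forall>s\<in>{0..M}. E - lam * \<Phi> s0 \<le> E - lam * \<Phi> s"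
    using M by (intro continuous_attains_inf continuous_intros \<Phi>cont) auto
  then obtain s0 where s0: "s0 \<in> {0..M}" "\<And>s. s \<in> {0..M} \<Longrightarrow> E - lam * \<Phi> s0 \<le> E - lam * \<Phi> s"
    by blast
  \<comment> \<open>small enough that subtracting \<open>\<eta> * s\<close> keeps the energy positive on \<open>{0..M}\<close>\<close>
  define \<eta> where "\<eta> = (E - lam * \<Phi> s0) / (2 * M)"
  have \<eta>: "0 < \<eta>" using E[OF s0(1)] M by (simp add: \<eta>_def)
  define H0 where "H0 s = E - lam * \<Phi> s - \<eta> * s" for s
  have H0pos: "0 < H0 s" if "s \<in> {0..M}" for s
  proof -
    have "\<eta> * s \<le> \<eta> * M" using that \<eta> by (intro mult_left_mono) auto
    also have "\<eta> * M = (E - lam * \<Phi> s0) / 2" using M by (simp add: \<eta>_def)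
    finally have "\<eta> * s \<le> (E - lam * \<Phi> s0) / 2" .
    moreover have "0 < (E - lam * \<Phi> s0) / 2" using E[OF s0(1)] by simp
    moreover have "(E - lam * \<Phi> s0) / 2 + (E - lam * \<Phi> s0) / 2 = E - lam * \<Phi> s0" by simp
    ultimately show ?thesis using s0(2)[OF that] unfolding H0_def by linarith
  qed
  have H0c: "isCont H0 s" for s unfolding H0_def by (intro continuous_intros \<Phi>c)
  obtain r where r: "0 < r" "\<And>s. s \<in> {-r..M + r} \<Longrightarrow> 0 < H0 s"
  proof -
    have "\<exists>d>0. \<forall>s. \<bar>s - x\<bar> < d \<longrightarrow> 0 < H0 s" if "x \<in> {0..M}" for x
    proof -
      have "\<forall>\<^sub>F s in nhds x. 0 < H0 s"
        using H0c[of x] H0pos[OF that] unfolding isCont_def tendsto_at_iff_tendsto_nhds by (rule order_tendstoD)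
      then show ?thesis by (auto simp: eventually_nhds_metric dist_real_def)
    qed
    from this[of 0] this[of M] obtain d1 d2 where d: "0 < d1" "0 < d2"
      "\<And>s. \<bar>s\<bar> < d1 \<Longrightarrow> 0 < H0 s" "\<And>s. \<bar>s - M\<bar> < d2 \<Longrightarrow> 0 < H0 s"
      using M by auto
    show thesis
    proof (rule that[of "min d1 d2 / 2"])
      fix s assume "s \<in> {- (min d1 d2 / 2)..M + min d1 d2 / 2}"
      moreover define m where "m = min d1 d2"
      moreover have "0 < m" "m \<le> d1" "m \<le> d2" using d(1,2) by (auto simp: m_def)
      ultimately have s: "- m / 2 \<le> s" "s \<le> M + m / 2" by auto
      consider "s < 0" | "s \<in> {0..M}" | "M < s" by fastforce
      then show "0 < H0 s"
      proof cases
        case 1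
        then show ?thesis using s \<open>m \<le> d1\<close> \<open>0 < m\<close> by (intro d(3)) linarith
      next
        case 3
        then show ?thesis using s \<open>m \<le> d2\<close> \<open>0 < m\<close> by (intro d(4)) linarith
      qed (rule H0pos)
    qed (use d in auto)
  qed
  obtain c c' where c: "\<And>s. (c has_real_derivative c' s) (at s)" "continuous_on UNIV c'"
    "\<And>s. s \<in> {0..M} \<Longrightarrow> c s = s" "\<And>s. s \<in> {0..M} \<Longrightarrow> c' s = 1" "\<And>s. c s \<in> {-r..M + r}"
    using smooth_clip[of M r] M r(1) by (metis less_imp_le)
  have ccont: "continuous_on UNIV c" using c(1) by (meson DERIV_isCont continuous_at_imp_continuous_on)
  define H where "H s = p / (p - 1) * H0 (c s)" for s
  define H' where "H' s = p / (p - 1) * ((- lam * f (c s) - \<eta>) * c' s)" for s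
  have Hpos: "0 < H s" for s using r(2)[OF c(5)[of s]] p by (simp add: H_def)
  have H0d: "(H0 has_real_derivative - lam * f s - \<eta>) (at s)" for s
    unfolding H0_def by (auto intro!: derivative_eq_intros \<Phi>)
  have Hd: "(H has_real_derivative H' s) (at s)" for s
    unfolding H_def H'_def by (rule DERIV_cmult[OF DERIV_chain2[OF H0d c(1)]])
  have H'c: "continuous_on UNIV H'"
    unfolding H'_def using p by (intro continuous_intros c(2) continuous_on_compose2[OF fcont[of UNIV] ccont]) auto
  have Hc: "continuous_on UNIV H" using Hd by (meson DERIV_isCont continuous_at_imp_continuous_on)
  define g where "g s = H s powr (1 / p)" for s
  define g' where "g' s = (1 / p) * H s powr (1 / p - 1) * H' s" for s
  have gpos: "0 < g s" for s using Hpos[of s] by (simp add: g_def)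
  have gd: "(g has_real_derivative g' s) (at s)" for s
    unfolding g_def g'_def using DERIV_fun_powr[OF Hd Hpos, of "1 / p"] by simp
  have gc: "continuous_on UNIV g" using gd by (meson DERIV_isCont continuous_at_imp_continuous_on)
  have g'c: "continuous_on UNIV g'"
    unfolding g'_def using Hpos by (intro continuous_intros Hc H'c) (auto simp: less_imp_neq[symmetric])
  obtain K where K: "\<And>s. g s \<le> K"
  proof -
    obtain K0 where K0: "\<And>s. s \<in> {-r..M + r} \<Longrightarrow> \<bar>H0 s\<bar> \<le> K0"
      using continuous_on_interval_bounded[of "-r" "M + r" H0] H0c
      by (metis continuous_at_imp_continuous_on)
    show thesis
    proof (rule that[of "(p / (p - 1) * K0) powr (1 / p)"])
      fix s
      have "H s \<le> p / (p - 1) * K0"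
        unfolding H_def using K0[OF c(5)[of s]] p by (intro mult_left_mono) auto
      then show "g s \<le> (p / (p - 1) * K0) powr (1 / p)"
        unfolding g_def using Hpos[of s] p by (intro powr_mono2) auto
    qed
  qed
  obtain X w where X: "\<And>s. (X has_real_derivative 1 / g s) (at s)" "X 0 = 0"
    and w: "\<And>t. (w has_real_derivative g (w t)) (at t)" "\<And>s. w (X s) = s" "\<And>t. X (w t) = t" "strict_mono w"
    using autonomous_ode_solution[OF gc gpos K] by metis
  have wc: "continuous_on UNIV w" using w(1) by (meson DERIV_isCont continuous_at_imp_continuous_on)
  show thesis
  proof (rule that[of w "\<lambda>t. g (w t)" "\<lambda>t. g' (w t) * g (w t)" "X (M + 1)"])
    show "((\<lambda>t. g (w t)) has_real_derivative g' (w t) * g (w t)) (at t)" for t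
      by (rule DERIV_chain2[OF gd w(1)])
    show "continuous_on UNIV (\<lambda>t. g' (w t) * g (w t))"
      by (intro continuous_intros continuous_on_compose2[OF g'c wc] continuous_on_compose2[OF gc wc]) auto
    show w0: "w 0 = 0" using w(2)[of 0] X(2) by simp
    show "M < w (X (M + 1))" using w(2) by simp
    show "0 < X (M + 1)" using strict_mono_less[OF w(4), of 0 "X (M + 1)"] w(2) w0 M by simp
    have "D < X M"
    proof -
      have "(\<lambda>s. X s - ln (s + B) / \<kappa>) 0 \<le> (\<lambda>s. X s - ln (s + B) / \<kappa>) M"
      proof (rule DERIV_nonneg_imp_nondecreasing[where f="\<lambda>s. X s - ln (s + B) / \<kappa>"])
        fix s assume s: "0 \<le> s" "s \<le> M"
        have "H s \<le> p / (p - 1) * (E - lam * \<Phi> s)"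
          unfolding H_def H0_def using s c(3)[of s] \<eta> p by (intro mult_left_mono) auto
        also have "\<dots> \<le> (\<kappa> * (s + B)) powr p" using speed s by auto
        finally have "g s \<le> ((\<kappa> * (s + B)) powr p) powr (1 / p)"
          unfolding g_def using Hpos[of s] p by (intro powr_mono2) auto
        also have "\<dots> = \<kappa> * (s + B)" using s p \<kappa> B by (simp add: powr_powr)
        finally have "1 / (\<kappa> * (s + B)) \<le> 1 / g s" 
          using gpos[of s] \<kappa> B s by (intro divide_left_mono mult_pos_pos) auto
        moreover have "((\<lambda>s. X s - ln (s + B) / \<kappa>) has_real_derivative 1 / g s - 1 / (s + B) / \<kappa>) (at s)"
          using s B by (intro DERIV_diff X DERIV_cdivide) (auto intro!: derivative_eq_intros)
        ultimately show "\<exists>y. ((\<lambda>s. X s - ln (s + B) / \<kappa>) has_real_derivative y) (at s) \<and> 0 \<le> y"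
          by (intro exI[of _ "1 / g s - 1 / (s + B) / \<kappa>"]) (simp add: mult.commute)
      qed (use M in simp)
      then have "ln (M + B) / \<kappa> - ln B / \<kappa> \<le> X M" using X(2) by simp
      moreover have "exp (\<kappa> * D) * B < M + B" using D by (simp add: algebra_simps)
      then have "ln (exp (\<kappa> * D) * B) < ln (M + B)" using B M by (subst ln_less_cancel_iff) auto
      then have "\<kappa> * D + ln B < ln (M + B)" using B by (simp add: ln_mult)
      then have "D < (ln (M + B) - ln B) / \<kappa>" using \<kappa> by (simp add: field_simps)
      ultimately show ?thesis by (simp add: diff_divide_distrib)
    qed
    then have "w D < w (X M)" using w(4) by (simp add: strict_mono_less)
    then show "w D < M" using w(2) by simp
    show "lam * f (w t) + (p - 1) * (g (w t) powr (p - 2) * (g' (w t) * g (w t))) < 0" if "w t \<in> {0..M}" for t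
    proof -
      define s where "s = w t"
      have s: "s \<in> {0..M}" using that by (simp add: s_def)
      \<comment> \<open>the left-hand side reduces to \<open>lam * f s\<close> plus the derivative of the energy\<close>
      have "g s powr (p - 2) * (g' s * g s) = g s powr (p - 1) * g' s"
        using powr_mult_base[of "g s" "p - 2"] gpos[of s] by (simp add: algebra_simps)
      also have "g s powr (p - 1) = H s powr ((p - 1) / p)" by (simp add: g_def powr_powr)
      also have "\<dots> * g' s = (1 / p) * (H s powr ((p - 1) / p) * H s powr (1 / p - 1)) * H' s"
        by (simp add: g'_def)
      also have "H s powr ((p - 1) / p) * H s powr (1 / p - 1) = 1"
        using Hpos[of s] p by (simp add: powr_add[symmetric] diff_divide_distrib)
      finally have "(p - 1) * (g s powr (p - 2) * (g' s * g s)) = (p - 1) / p * H' s"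
        using p by simp
      also have "\<dots> = - lam * f s - \<eta>" using c(3,4)[OF s] p by (simp add: H'_def)
      finally show ?thesis using \<eta> by (simp add: s_def)
    qed
  qed (use w gpos in auto)
qed


lemma polynomial_antiderivative:
  fixes r :: "real \<Rightarrow> real"
  assumes "real_polynomial_function r"
  obtains R where "real_polynomial_function R" "\<And>x. (R has_real_derivative r x) (at x)" "R 0 = 0"
proof -
  obtain a n where r: "r = (\<lambda>x. \<Sum>i\<le>n. a i * x ^ i)"
    using real_polynomial_function_imp_sum[OF assms] by blast
  define R where "R x = (\<Sum>i\<le>n. a i / real (Suc i) * x ^ Suc i)" for x
  have lin: "real_polynomial_function (\<lambda>x::real. x)"
    by (rule real_polynomial_function.intros(1)) (rule bounded_linear_ident)
  have "real_polynomial_function R"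
    unfolding R_def by (intro real_polynomial_function_sum real_polynomial_function.intros(4)
        real_polynomial_function.intros(2) real_polynomial_function_power lin) auto
  moreover have "(R has_real_derivative r x) (at x)" for x
  proof -
    have "(R has_real_derivative (\<Sum>i\<le>n. a i / real (Suc i) * (real (Suc i) * x ^ i))) (at x)"
      unfolding R_def by (intro DERIV_sum DERIV_cmult) (use DERIV_pow[of "Suc _" x] in simp)
    then show ?thesis by (simp add: r del: of_nat_Suc)
  qed
  moreover have "R 0 = 0" by (simp add: R_def)
  ultimately show ?thesis by (rule that)
qed

lemma derivative_difference_bound:
  fixes a b :: "real \<Rightarrow> real"
  assumes "\<And>t. (a has_real_derivative a' t) (at t)" "\<And>t. (b has_real_derivative b' t) (at t)"
    "a 0 = b 0" "\<And>t. t \<in> {0..L} \<Longrightarrow> \<bar>a' t - b' t\<bar> \<le> K" "t \<in> {0..L}"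
  shows "\<bar>a t - b t\<bar> \<le> K * L"
proof -
  have "norm ((\<lambda>t. a t - b t) t - (\<lambda>t. a t - b t) 0) \<le> K * norm (t - 0)"
    by (rule field_differentiable_bound[of "{0..L}" _ "\<lambda>t. a' t - b' t"])
      (use assms in \<open>auto intro!: derivative_eq_intros intro: has_field_derivative_at_within\<close>)
  also have "\<dots> \<le> K * L"
    using assms(4,5) by (intro mult_left_mono) (auto intro: order_trans[OF abs_ge_zero])
  finally show ?thesis using assms(3) by simp
qed

lemma polynomial_approximation_C2:
  fixes w w' w'' :: "real \<Rightarrow> real"
  assumes w: "\<And>t. (w has_real_derivative w' t) (at t)" "\<And>t. (w' has_real_derivative w'' t) (at t)"
    "continuous_on UNIV w''" and "0 < \<epsilon>"
  shows "\<exists>q q' q''. real_polynomial_function q \<and> real_polynomial_function q'' \<and>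
     (\<forall>t. (q has_real_derivative q' t) (at t)) \<and> (\<forall>t. (q' has_real_derivative q'' t) (at t)) \<and> q 0 = w 0 \<and>
     (\<forall>t\<in>{0..L}. \<bar>q t - w t\<bar> \<le> \<epsilon> * L * L) \<and> (\<forall>t\<in>{0..L}. \<bar>q' t - w' t\<bar> \<le> \<epsilon> * L) \<and>
     (\<forall>t\<in>{0..L}. \<bar>q'' t - w'' t\<bar> \<le> \<epsilon>)"
proof -
  have "continuous_on {0..L} w''" using w(3) by (rule continuous_on_subset) simp
  then obtain q'' where q'': "real_polynomial_function q''" "\<And>t. t \<in> {0..L} \<Longrightarrow> \<bar>w'' t - q'' t\<bar> < \<epsilon>"
    using Stone_Weierstrass_real_polynomial_function[of "{0..L}" w'' \<epsilon>] assms(4) by blast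
  obtain Q where Q: "real_polynomial_function Q" "\<And>t. (Q has_real_derivative q'' t) (at t)" "Q 0 = 0"
    using polynomial_antiderivative[OF q''(1)] by metis
  define q' where "q' t = Q t + w' 0" for t
  have q'p: "real_polynomial_function q'"
    unfolding q'_def by (intro real_polynomial_function.intros(3) real_polynomial_function.intros(2) Q)
  have q'd: "(q' has_real_derivative q'' t) (at t)" for t
    unfolding q'_def by (auto intro!: derivative_eq_intros Q)
  obtain P where P: "real_polynomial_function P" "\<And>t. (P has_real_derivative q' t) (at t)" "P 0 = 0"
    using polynomial_antiderivative[OF q'p] by metis
  define q where "q t = P t + w 0" for t
  have qp: "real_polynomial_function q"
    unfolding q_def by (intro real_polynomial_function.intros(3) real_polynomial_function.intros(2) P)
  have qd: "(q has_real_derivative q' t) (at t)" for t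
    unfolding q_def by (auto intro!: derivative_eq_intros P)
  have b2: "\<bar>q'' t - w'' t\<bar> \<le> \<epsilon>" if "t \<in> {0..L}" for t
    using q''(2)[OF that] by (simp add: abs_minus_commute)
  have b1: "\<bar>q' t - w' t\<bar> \<le> \<epsilon> * L" if "t \<in> {0..L}" for t
    using derivative_difference_bound[OF q'd w(2) _ b2 that] Q(3) by (simp add: q'_def)
  have b0: "\<bar>q t - w t\<bar> \<le> \<epsilon> * L * L" if "t \<in> {0..L}" for t
    using derivative_difference_bound[OF qd w(1) _ b1 that] P(3) by (simp add: q_def)
  show ?thesis
    using qp q''(1) qd q'd b0 b1 b2 P(3)
    by (intro exI[of _ q] exI[of _ q'] exI[of _ q''] conjI allI ballI) (simp_all add: q_def)
qed

text \<open>Barriers have to be smooth for the test functions to be admissible, and \<open>w\<close> is only twice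
  continuously differentiable. The strict inequality survives a \<open>C\<^sup>2\<close>-small perturbation to a
  polynomial, and also the replacement of \<open>f (q t)\<close> by \<open>f s\<close> for values \<open>s\<close> passed during one
  sliding step \<open>T / N\<close>. Both follow by compactness: counterexamples for ever finer approximations and steps would
  accumulate at a point where the inequality for \<open>w\<close> fails.\<close>

lemma polynomial_barrier:
  fixes f :: "real \<Rightarrow> real"
  assumes p: "1 < p" and f: "continuous_on UNIV f" and D: "0 < D"
    and w: "\<And>t. (w has_real_derivative w' t) (at t)" "\<And>t. (w' has_real_derivative w'' t) (at t)"
      "continuous_on UNIV w''"
    and pos: "\<And>t. 0 < w' t" and w0: "w 0 = 0"
    and T: "0 < T" "M < w T" and wD: "w D < M"
    and super: "\<And>t. w t \<in> {0..M} \<Longrightarrow> lam * f (w t) + (p - 1) * (w' t powr (p - 2) * w'' t) < 0"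
  obtains q q' q'' and N :: nat where "real_polynomial_function q" "real_polynomial_function q''"
    "\<And>t. (q has_real_derivative q' t) (at t)" "\<And>t. (q' has_real_derivative q'' t) (at t)"
    "\<And>t. t \<in> {0..T + D} \<Longrightarrow> 0 \<le> q t" "\<And>t. t \<in> {0..T + D} \<Longrightarrow> 0 < q' t"
    "\<And>t. t \<in> {T..T + D} \<Longrightarrow> M \<le> q t" "q D < M" "0 < N"
    "\<And>t s. 0 \<le> t \<Longrightarrow> t + T / N \<le> T + D \<Longrightarrow> s \<in> {0..M} \<Longrightarrow> q t < s \<Longrightarrow> s \<le> q (t + T / N) \<Longrightarrow>
       lam * f s + (p - 1) * (q' t powr (p - 2) * q'' t) < 0"
proof -
  define L where "L = T + D"
  have L: "0 < L" using T D by (simp add: L_def)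
  have wc: "isCont w t" and w'c: "isCont w' t" and w''c: "isCont w'' t" and fc: "isCont f t" for t
    using w f by (auto intro: DERIV_isCont simp: continuous_on_eq_continuous_at)
  define \<epsilon> where "\<epsilon> n = 1 / real (Suc n)" for n
  have \<epsilon>: "0 < \<epsilon> n" for n by (simp add: \<epsilon>_def)
  have \<epsilon>0: "\<epsilon> \<longlonglongrightarrow> 0"
    using LIMSEQ_inverse_real_of_nat unfolding \<epsilon>_def[abs_def] by (simp add: divide_inverse)
  have "\<exists>q q' q''. real_polynomial_function q \<and> real_polynomial_function q'' \<and>
     (\<forall>t. (q has_real_derivative q' t) (at t)) \<and> (\<forall>t. (q' has_real_derivative q'' t) (at t)) \<and> q 0 = w 0 \<and>
     (\<forall>t\<in>{0..L}. \<bar>q t - w t\<bar> \<le> \<epsilon> n * L * L) \<and> (\<forall>t\<in>{0..L}. \<bar>q' t - w' t\<bar> \<le> \<epsilon> n * L) \<and>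
     (\<forall>t\<in>{0..L}. \<bar>q'' t - w'' t\<bar> \<le> \<epsilon> n)" for n
    by (rule polynomial_approximation_C2[OF w \<epsilon>])
  then obtain q q' q'' where q: "\<And>n. real_polynomial_function (q n)" "\<And>n. real_polynomial_function (q'' n)"
     "\<And>n t. (q n has_real_derivative q' n t) (at t)" "\<And>n t. (q' n has_real_derivative q'' n t) (at t)"
     "\<And>n. q n 0 = w 0"
     and ap: "\<And>n t. t \<in> {0..L} \<Longrightarrow> \<bar>q n t - w t\<bar> \<le> \<epsilon> n * L * L"
       "\<And>n t. t \<in> {0..L} \<Longrightarrow> \<bar>q' n t - w' t\<bar> \<le> \<epsilon> n * L"
       "\<And>n t. t \<in> {0..L} \<Longrightarrow> \<bar>q'' n t - w'' t\<bar> \<le> \<epsilon> n"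
    by metis
  have conv: "(\<lambda>k. a (r k) (t k)) \<longlonglongrightarrow> b s"
    if r: "strict_mono r" and t: "\<And>k. t k \<in> {0..L}" "t \<longlonglongrightarrow> s"
      and ab: "\<And>n t. t \<in> {0..L} \<Longrightarrow> \<bar>a n t - b t\<bar> \<le> \<epsilon> n * K" and "isCont b s"
    for a :: "nat \<Rightarrow> real \<Rightarrow> real" and b r t s K
  proof -
    have "(\<lambda>k. a (r k) (t k) - b (t k)) \<longlonglongrightarrow> 0"
    proof (rule Lim_null_comparison)
      show "(\<lambda>k. \<epsilon> (r k) * K) \<longlonglongrightarrow> 0"
        using LIMSEQ_subseq_LIMSEQ[OF \<epsilon>0 r] by (auto intro!: tendsto_mult_left_zero simp: o_def)
    qed (use ab t in \<open>auto intro!: always_eventually\<close>)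
    moreover have "(\<lambda>k. b (t k)) \<longlonglongrightarrow> b s" using that(5) t(2) by (rule isCont_tendsto_compose)
    ultimately have "(\<lambda>k. (a (r k) (t k) - b (t k)) + b (t k)) \<longlonglongrightarrow> 0 + b s" by (rule tendsto_add)
    then show ?thesis by simp
  qed
  have "continuous_on {0..L} w'" using w'c by (simp add: continuous_at_imp_continuous_on)
  then obtain t0 where t0: "t0 \<in> {0..L}" "\<And>t. t \<in> {0..L} \<Longrightarrow> w' t0 \<le> w' t"
    using continuous_attains_inf[of "{0..L}" w'] L by auto
  have lim0: "(\<lambda>n. \<epsilon> n * L * L) \<longlonglongrightarrow> 0" and lim1: "(\<lambda>n. \<epsilon> n * L) \<longlonglongrightarrow> 0"
    by (auto intro!: tendsto_mult_left_zero \<epsilon>0)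
  have "\<forall>\<^sub>F n in sequentially. \<epsilon> n * L < w' t0"
    by (rule order_tendstoD(2)[OF lim1 pos])
  moreover have "\<forall>\<^sub>F n in sequentially. \<epsilon> n * L * L < w T - M" "\<forall>\<^sub>F n in sequentially. \<epsilon> n * L * L < M - w D"
    using T wD by (auto intro!: order_tendstoD(2)[OF lim0])
  ultimately have "\<forall>\<^sub>F n in sequentially. \<epsilon> n * L < w' t0 \<and> \<epsilon> n * L * L < w T - M \<and> \<epsilon> n * L * L < M - w D"
    by eventually_elim blast
  then obtain n0 where n0: "\<And>n. n0 \<le> n \<Longrightarrow> \<epsilon> n * L < w' t0"
    "\<And>n. n0 \<le> n \<Longrightarrow> \<epsilon> n * L * L < w T - M" "\<And>n. n0 \<le> n \<Longrightarrow> \<epsilon> n * L * L < M - w D"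
    unfolding eventually_sequentially by blast
  define h where "h n = T / real (Suc n)" for n
  have h0: "h \<longlonglongrightarrow> 0"
    using tendsto_mult_left_zero[OF \<epsilon>0, of T] by (simp add: h_def[abs_def] \<epsilon>_def)
  have "\<exists>n\<ge>n0. \<forall>t s. 0 \<le> t \<longrightarrow> t + h n \<le> L \<longrightarrow> s \<in> {0..M} \<longrightarrow> q n t < s \<longrightarrow> s \<le> q n (t + h n) \<longrightarrow>
       lam * f s + (p - 1) * (q' n t powr (p - 2) * q'' n t) < 0"
  proof (rule ccontr)
    assume "\<not> ?thesis"
    then have "\<exists>t s. 0 \<le> t \<and> t + h n \<le> L \<and> s \<in> {0..M} \<and> q n t < s \<and> s \<le> q n (t + h n) \<and>
       0 \<le> lam * f s + (p - 1) * (q' n t powr (p - 2) * q'' n t)" if "n0 \<le> n" for n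
      using that by (meson not_less)
    then have "\<exists>t s. 0 \<le> t \<and> t + h (n + n0) \<le> L \<and> s \<in> {0..M} \<and> q (n + n0) t < s \<and> s \<le> q (n + n0) (t + h (n + n0)) \<and>
       0 \<le> lam * f s + (p - 1) * (q' (n + n0) t powr (p - 2) * q'' (n + n0) t)" for n
      by simp
    then obtain t s where ts: "\<And>n. 0 \<le> t n" "\<And>n. t n + h (n + n0) \<le> L" "\<And>n. s n \<in> {0..M}"
      "\<And>n. q (n + n0) (t n) < s n" "\<And>n. s n \<le> q (n + n0) (t n + h (n + n0))"
      "\<And>n. 0 \<le> lam * f (s n) + (p - 1) * (q' (n + n0) (t n) powr (p - 2) * q'' (n + n0) (t n))"
      by metis
    have hpos: "0 \<le> h n" for n using T by (simp add: h_def)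
    have tL: "t n \<in> {0..L}" for n using ts(1,2)[of n] hpos[of "n + n0"] by auto
    obtain tl r where tl: "tl \<in> {0..L}" "strict_mono r" "(t \<circ> r) \<longlonglongrightarrow> tl"
      using compact_Icc[of 0 L] tL unfolding compact_def by metis
    define r' where "r' k = r k + n0" for k
    have r': "strict_mono r'" using tl(2) by (auto simp: r'_def strict_mono_def)
    have tk: "t (r k) \<in> {0..L}" "t (r k) + h (r' k) \<in> {0..L}" for k
      using tL[of "r k"] ts(2)[of "r k"] hpos[of "r' k"] by (auto simp: r'_def)
    have tlim: "(\<lambda>k. t (r k)) \<longlonglongrightarrow> tl" using tl(3) by (simp add: o_def)
    have "(\<lambda>k. t (r k) + h (r' k)) \<longlonglongrightarrow> tl + 0"
      using LIMSEQ_subseq_LIMSEQ[OF h0 r'] by (intro tendsto_add tlim) (simp add: o_def)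
    then have tlim': "(\<lambda>k. t (r k) + h (r' k)) \<longlonglongrightarrow> tl" by simp
    have ap0: "\<bar>q n t - w t\<bar> \<le> \<epsilon> n * (L * L)" if "t \<in> {0..L}" for n t
      using ap(1)[OF that, of n] by (simp add: mult.assoc)
    have ap2: "\<bar>q'' n t - w'' t\<bar> \<le> \<epsilon> n * 1" if "t \<in> {0..L}" for n t
      using ap(3)[OF that, of n] by simp
    have slim: "(\<lambda>k. s (r k)) \<longlonglongrightarrow> w tl"
    proof (rule tendsto_sandwich)
      show "(\<lambda>k. q (r' k) (t (r k))) \<longlonglongrightarrow> w tl"
        by (rule conv[OF r' tk(1) tlim ap0 wc])
      show "(\<lambda>k. q (r' k) (t (r k) + h (r' k))) \<longlonglongrightarrow> w tl"
        by (rule conv[OF r' tk(2) tlim' ap0 wc])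
      show "\<forall>\<^sub>F k in sequentially. q (r' k) (t (r k)) \<le> s (r k)"
        unfolding r'_def by (intro always_eventually allI less_imp_le ts)
      show "\<forall>\<^sub>F k in sequentially. s (r k) \<le> q (r' k) (t (r k) + h (r' k))"
        unfolding r'_def by (intro always_eventually allI ts)
    qed
    have "w tl \<in> {0..M}"
      by (rule Lim_in_closed_set[OF closed_atLeastAtMost _ _ slim]) (use ts(3) in auto)
    then have "lam * f (w tl) + (p - 1) * (w' tl powr (p - 2) * w'' tl) < 0" by (rule super)
    moreover have "(\<lambda>k. lam * f (s (r k)) + (p - 1) * (q' (r' k) (t (r k)) powr (p - 2) * q'' (r' k) (t (r k))))
        \<longlonglongrightarrow> lam * f (w tl) + (p - 1) * (w' tl powr (p - 2) * w'' tl)"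
      using pos[of tl]
      by (intro tendsto_intros isCont_tendsto_compose[OF fc slim] conv[OF r' tk(1) tlim ap(2) w'c]
          conv[OF r' tk(1) tlim ap2 w''c]) auto
    then have "0 \<le> lam * f (w tl) + (p - 1) * (w' tl powr (p - 2) * w'' tl)"
      by (rule LIMSEQ_le_const) (use ts(6) in \<open>auto simp: r'_def\<close>)
    ultimately show False by simp
  qed
  then obtain n where n: "n0 \<le> n" and bar: "\<And>t s. 0 \<le> t \<Longrightarrow> t + h n \<le> L \<Longrightarrow> s \<in> {0..M} \<Longrightarrow> q n t < s \<Longrightarrow>
      s \<le> q n (t + h n) \<Longrightarrow> lam * f s + (p - 1) * (q' n t powr (p - 2) * q'' n t) < 0"
    by blast
  have q'pos: "0 < q' n t" if "t \<in> {0..L}" for t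
    using ap(2)[OF that, of n] n0(1)[OF n] t0(2)[OF that] by linarith
  have qmono: "q n a \<le> q n b" if "0 \<le> a" "a \<le> b" "b \<le> L" for a b
    by (rule DERIV_nonneg_imp_nondecreasing[OF that(2)]) (use q(3) q'pos that in \<open>fastforce intro: less_imp_le\<close>)
  show ?thesis
  proof (rule that[of "q n" "q'' n" "q' n" "Suc n"])
    show "0 \<le> q n t" if "t \<in> {0..T + D}" for t
      using qmono[of 0 t] that q(5)[of n] w0 by (simp add: L_def)
    show "0 < q' n t" if "t \<in> {0..T + D}" for t
      using q'pos that by (simp add: L_def)
    show "M \<le> q n t" if "t \<in> {T..T + D}" for t
    proof -
      have "M < q n T" using ap(1)[of T n] n0(2)[OF n] T D by (simp add: L_def)
      also have "q n T \<le> q n t" using that T by (intro qmono) (auto simp: L_def)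
      finally show ?thesis by simp
    qed
    show "q n D < M" using ap(1)[of D n] n0(3)[OF n] T D by (simp add: L_def)
    show "lam * f s + (p - 1) * (q' n t powr (p - 2) * q'' n t) < 0"
      if "0 \<le> t" "t + T / real (Suc n) \<le> T + D" "s \<in> {0..M}" "q n t < s" "s \<le> q n (t + T / real (Suc n))" for t s
      using bar[of t s] that by (simp add: h_def L_def)
  qed (use q in auto)
qed

text \<open>The barrier moves down in \<open>N\<close> steps of length \<open>T / N\<close>. At the start it is above \<open>M\<close>. In each
  step \<open>u\<close> is at most the previous barrier, which is the situation covered by \<open>super\<close>.\<close>

lemma sliding_comparison:
  fixes \<Omega> :: "'a::euclidean_space set"
  assumes \<Omega>: "open \<Omega>" "bounded \<Omega>" and p: "1 < p"
    and f: "continuous_on UNIV f" and sol: "bounded_solution \<Omega> p f lam u"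
    and u: "AE x in lebesgue_on \<Omega>. u x \<in> {0..M}"
    and e: "norm e = 1" and range: "\<And>x. x \<in> \<Omega> \<Longrightarrow> x \<bullet> e + R \<in> {0..D}"
    and T: "0 < T" "0 < (N::nat)"
    and q: "real_polynomial_function q" "real_polynomial_function q''"
      "\<And>t. (q has_real_derivative q' t) (at t)" "\<And>t. (q' has_real_derivative q'' t) (at t)"
    and nn: "\<And>t. t \<in> {0..T + D} \<Longrightarrow> 0 \<le> q t" and pos: "\<And>t. t \<in> {0..T + D} \<Longrightarrow> 0 < q' t"
    and top: "\<And>t. t \<in> {T..T + D} \<Longrightarrow> M \<le> q t"
    and super: "\<And>t s. 0 \<le> t \<Longrightarrow> t + T / N \<le> T + D \<Longrightarrow> s \<in> {0..M} \<Longrightarrow> q t < s \<Longrightarrow> s \<le> q (t + T / N) \<Longrightarrow>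
       lam * f s + (p - 1) * (q' t powr (p - 2) * q'' t) < 0"
  shows "AE x in lebesgue_on \<Omega>. u x \<le> q (x \<bullet> e + R)"
proof -
  have "AE x in lebesgue_on \<Omega>. u x \<le> q (x \<bullet> e + (R + (T - real j * (T / N))))" if "j \<le> N" for j
    using that
  proof (induction j)
    case 0
    show ?case using u AE_space
    proof eventually_elim
      case (elim x)
      then have "x \<bullet> e + (R + (T - real 0 * (T / N))) \<in> {T..T + D}" using range[of x] by auto
      from top[OF this] elim show ?case by auto
    qed
  next
    case (Suc j)
    define c where "c = R + (T - real (Suc j) * (T / N))"
    have cj: "R + (T - real j * (T / N)) = c + T / N" by (simp add: c_def algebra_simps add_divide_distrib)
    have "real (Suc j) * (T / N) \<le> real N * (T / N)"
      using Suc.prems T by (intro mult_right_mono) (auto simp del: of_nat_Suc)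
    then have le: "real (Suc j) * (T / N) \<le> T" using T by simp
    have "0 \<le> real (Suc j) * (T / N)" "T / N \<le> real (Suc j) * (T / N)" using T
      by (auto simp: divide_right_mono)
    then have rg: "x \<bullet> e + c \<in> {0..T + D}" "x \<bullet> e + c + T / N \<le> T + D" if "x \<in> \<Omega>" for x
      using range[OF that] le by (auto simp: c_def)
    have IH: "AE x in lebesgue_on \<Omega>. u x \<le> q (x \<bullet> e + (c + T / N))"
      using Suc.IH Suc.prems unfolding cj by simp
    show ?case
      unfolding c_def[symmetric]
    proof (rule weak_comparison[OF \<Omega> p f sol e rg(1) q nn pos])
      show "AE x in lebesgue_on \<Omega>. q (x \<bullet> e + c) < u x \<longrightarrow>
        lam * f (u x) + (p - 1) * (q' (x \<bullet> e + c) powr (p - 2) * q'' (x \<bullet> e + c)) < 0"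
        using IH u AE_space
      proof eventually_elim
        case (elim x)
        then show ?case using rg[of x] super[of "x \<bullet> e + c" "u x"] by (auto simp: add.assoc)
      qed
    qed
  qed
  from this[of N] show ?thesis using T by simp
qed


section \<open>Nonexistence of bounded solutions\<close>

lemma powr_superadditive:
  fixes a b p :: real
  assumes "1 \<le> p" "0 \<le> a" "0 \<le> b"
  shows "a powr p + b powr p \<le> (a + b) powr p"
proof -
  have base: "t powr p = t powr (p - 1) * t" if "0 \<le> t" for t
    using powr_mult_base[of t "p - 1"] that by (cases "t = 0") (auto simp: mult.commute)
  have "a powr p + b powr p \<le> (a + b) powr (p - 1) * a + (a + b) powr (p - 1) * b"
    unfolding base[OF assms(2)] base[OF assms(3)]
    using assms by (intro add_mono mult_right_mono powr_mono2) auto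
  also have "\<dots> = (a + b) powr p"
    using assms base[of "a + b"] by (simp add: distrib_left)
  finally show ?thesis .
qed

text \<open>The right-hand side of \<open>small\<close> is \<open>C * (M / (exp (\<kappa> * D) - 1)) powr p\<close> with
  \<open>\<kappa> powr p = p / (p - 1) * \<Lambda> * C\<close> and width \<open>D = 2 * \<rho>\<close>. Any \<open>Z\<close> strictly between its two sides gives an energy
  \<open>E = lam * (Z - b)\<close> above \<open>lam * F\<close> and a bound \<open>\<kappa> * (s + B)\<close> for the speed with \<open>B powr p = Z / C\<close>,
  and \<open>small\<close> is what makes the time to reach \<open>M\<close> exceed \<open>D\<close>.\<close>

lemma no_bounded_solution:
  fixes \<Omega> :: "'a::euclidean_space set"
  assumes \<Omega>: "open \<Omega>" and \<rho>: "0 < \<rho>" "\<Omega> \<subseteq> cball 0 \<rho>" and p: "1 < p"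
    and f: "continuous_on UNIV f" and F: "\<And>s. 0 \<le> s \<Longrightarrow> F s = integral {0..s} f"
    and lam: "0 < lam" "lam \<le> \<Lambda>" and sol: "bounded_solution \<Omega> p f lam u"
    and u0: "AE x in lebesgue_on \<Omega>. 0 \<le> u x" and uM: "Linf_norm \<Omega> u = ereal M" and M: "0 < M"
    and C: "0 < C" and b: "0 \<le> b" and G: "0 \<le> G"
    and bounds: "\<And>s. s \<in> {0..M} \<Longrightarrow> - C * s powr p - b \<le> F s" "\<And>s. s \<in> {0..M} \<Longrightarrow> F s \<le> G"
    and small: "G + b < C / (exp ((p / (p - 1) * \<Lambda> * C) powr (1 / p) * (2 * \<rho>)) - 1) powr p * M powr p"
  shows False
proof -
  define D where "D = 2 * \<rho>"
  define p' where "p' = p / (p - 1)"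
  define \<kappa> where "\<kappa> = (p' * \<Lambda> * C) powr (1 / p)"
  define Y where "Y = exp (\<kappa> * D) - 1"
  have D: "0 < D" using \<rho> by (simp add: D_def)
  have p': "0 < p'" using p by (simp add: p'_def)
  have \<Lambda>: "0 < \<Lambda>" using lam by simp
  have \<kappa>: "0 < \<kappa>" using p' \<Lambda> C by (simp add: \<kappa>_def)
  have \<kappa>p: "\<kappa> powr p = p' * \<Lambda> * C" using p' \<Lambda> C p by (simp add: \<kappa>_def powr_powr)
  have Y: "0 < Y" using \<kappa> D by (simp add: Y_def)
  have "G + b < C / Y powr p * M powr p"
    using small by (simp add: Y_def \<kappa>_def p'_def D_def)
  then obtain Z where Z: "G + b < Z" and Z': "Z < C / Y powr p * M powr p"
    using dense by blast
  have Zpos: "0 < Z" using Z G b by linarith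
  define B where "B = (Z / C) powr (1 / p)"
  have B: "0 < B" using Zpos C by (simp add: B_def)
  have Bp: "B powr p = Z / C" using Zpos C p by (simp add: B_def powr_powr)
  define E where "E = lam * (Z - b)"
  obtain \<Phi> where \<Phi>: "\<And>s. (\<Phi> has_real_derivative f s) (at s)" "\<Phi> 0 = 0"
    using continuous_antiderivative[OF f] by metis
  have \<Phi>F: "\<Phi> s = F s" if "0 \<le> s" for s
  proof -
    have "(f has_integral \<Phi> s - \<Phi> 0) {0..s}"
      using that \<Phi>(1) by (intro fundamental_theorem_of_calculus)
        (auto simp flip: has_real_derivative_iff_has_vector_derivative intro: has_field_derivative_at_within)
    then show ?thesis using F[OF that] \<Phi>(2) by (simp add: integral_unique)
  qed
  have E: "lam * \<Phi> s < E" if "s \<in> {0..M}" for s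
    unfolding E_def using bounds(2)[OF that] \<Phi>F[of s] that Z lam(1) by (intro mult_strict_left_mono) auto
  have speed: "p / (p - 1) * (E - lam * \<Phi> s) \<le> (\<kappa> * (s + B)) powr p" if s: "s \<in> {0..M}" for s
  proof -
    have "0 < Z - b - \<Phi> s" using bounds(2)[OF s] \<Phi>F[of s] s Z by auto
    then have "lam * (Z - b - \<Phi> s) \<le> \<Lambda> * (Z - b - \<Phi> s)" using lam by (intro mult_right_mono) auto
    also have "\<dots> \<le> \<Lambda> * (Z + C * s powr p)"
      using bounds(1)[OF s] \<Phi>F[of s] s \<Lambda> by (intro mult_left_mono) auto
    finally have "p' * (lam * (Z - b - \<Phi> s)) \<le> p' * (\<Lambda> * (Z + C * s powr p))" using p' by simp
    then have "p / (p - 1) * (E - lam * \<Phi> s) \<le> p' * (\<Lambda> * (Z + C * s powr p))"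
      by (simp add: p'_def E_def algebra_simps)
    also have "\<dots> = \<kappa> powr p * (s powr p + B powr p)"
      using C by (simp add: \<kappa>p Bp field_simps)
    also have "\<dots> \<le> \<kappa> powr p * (s + B) powr p"
      using s B p by (intro mult_left_mono powr_superadditive) auto
    also have "\<dots> = (\<kappa> * (s + B)) powr p" using \<kappa> s B by (simp add: powr_mult)
    finally show ?thesis .
  qed
  have "(B * Y) powr p = Z / C * Y powr p" using B Y by (simp add: powr_mult Bp)
  also have "\<dots> < M powr p" using Z' C Y by (simp add: field_simps)
  finally have "B * Y < M"
    using powr_mono2[of p M "B * Y"] M p by (meson less_imp_le not_less order.trans zero_le_one)
  then have BY: "B * (exp (\<kappa> * D) - 1) < M" by (simp add: Y_def)
  obtain w w' w'' T where w: "\<And>t. (w has_real_derivative w' t) (at t)" "\<And>t. (w' has_real_derivative w'' t) (at t)"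
    "continuous_on UNIV w''" "\<And>t. 0 < w' t" "w 0 = 0" "0 < T" "M < w T" "w D < M"
    "\<And>t. w t \<in> {0..M} \<Longrightarrow> lam * f (w t) + (p - 1) * (w' t powr (p - 2) * w'' t) < 0"
    by (rule barrier_profile[OF p f \<Phi> M E \<kappa> B speed BY]) (assumption | rule that)+
  obtain q q' q'' and N :: nat where q: "real_polynomial_function q" "real_polynomial_function q''"
    "\<And>t. (q has_real_derivative q' t) (at t)" "\<And>t. (q' has_real_derivative q'' t) (at t)"
    "\<And>t. t \<in> {0..T + D} \<Longrightarrow> 0 \<le> q t" "\<And>t. t \<in> {0..T + D} \<Longrightarrow> 0 < q' t"
    "\<And>t. t \<in> {T..T + D} \<Longrightarrow> M \<le> q t" "q D < M" "0 < N"
    "\<And>t s. 0 \<le> t \<Longrightarrow> t + T / N \<le> T + D \<Longrightarrow> s \<in> {0..M} \<Longrightarrow> q t < s \<Longrightarrow> s \<le> q (t + T / N) \<Longrightarrow>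
       lam * f s + (p - 1) * (q' t powr (p - 2) * q'' t) < 0"
    by (rule polynomial_barrier[OF p f D w]) (assumption | rule that)+
  obtain e :: 'a where e: "norm e = 1" using vector_choose_size[of 1] by auto
  have range: "x \<bullet> e + \<rho> \<in> {0..D}" if "x \<in> \<Omega>" for x
  proof -
    have "\<bar>x \<bullet> e\<bar> \<le> norm x * norm e" by (rule Cauchy_Schwarz_ineq2)
    also have "\<dots> \<le> \<rho>" using \<rho>(2) that e by auto
    finally show ?thesis by (auto simp: D_def abs_le_iff)
  qed
  have "bounded \<Omega>" using \<rho>(2) bounded_cball bounded_subset by blast
  have "AE x in lebesgue_on \<Omega>. ereal \<bar>u x\<bar> \<le> Linf_norm \<Omega> u"
    unfolding Linf_norm_def by (rule esssup_AE)
  then have uI: "AE x in lebesgue_on \<Omega>. u x \<in> {0..M}"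
    using u0 by eventually_elim (simp add: uM)
  have "AE x in lebesgue_on \<Omega>. u x \<le> q (x \<bullet> e + \<rho>)"
    by (rule sliding_comparison[OF \<Omega> \<open>bounded \<Omega>\<close> p f sol uI e range w(6) q(9) q(1-7) q(10)])
  then have "AE x in lebesgue_on \<Omega>. \<bar>u x\<bar> \<le> q D"
    using u0 AE_space
  proof eventually_elim
    case (elim x)
    have "q (x \<bullet> e + \<rho>) \<le> q D"
    proof (rule DERIV_nonneg_imp_nondecreasing[where f=q])
      show "x \<bullet> e + \<rho> \<le> D" using range[of x] elim by simp
      show "\<exists>y. (q has_real_derivative y) (at t) \<and> 0 \<le> y" if "x \<bullet> e + \<rho> \<le> t" "t \<le> D" for t
        using range[of x] elim that w(6) q(3)[of t] q(6)[of t] by (intro exI[of _ "q' t"]) auto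
    qed
    then show ?case using elim by simp
  qed
  moreover have "u \<in> borel_measurable (lebesgue_on \<Omega>)"
    using sol by (simp add: bounded_solution_def Linf_def)
  ultimately have "Linf_norm \<Omega> u \<le> ereal (q D)" by (intro bounded_imp_Linf(2))
  then show False using uM q(8) by simp
qed

section \<open>Bifurcation points\<close>

text \<open>Bounds for \<open>F s / s powr p\<close> near the end \<open>l\<close> become bounds for \<open>F\<close> on all of \<open>{0..M}\<close>. For \<open>l = 0\<close>
  they hold with \<open>b = 0\<close>. For \<open>l = \<infinity>\<close> the values of \<open>F\<close> on a fixed interval contribute a constant, which
  \<open>(c - A) * M powr p\<close> eventually dominates.\<close>

lemma primitive_bounds_near_end:
  fixes f F :: "real \<Rightarrow> real"
  assumes p: "1 < p" and f: "continuous_on UNIV f" and F: "\<And>s. 0 \<le> s \<Longrightarrow> F s = integral {0..s} f"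
    and l: "l \<in> {0, \<infinity>}" and C: "0 < C" and A: "0 \<le> A" "A < c"
    and ev: "\<forall>\<^sub>F s in tends_to_end l. - C < F s / s powr p \<and> F s / s powr p < A'" and A': "A' \<le> A"
  shows "\<forall>\<^sub>F M in tends_to_end l. \<exists>b G. 0 \<le> b \<and> 0 \<le> G \<and>
    (\<forall>s\<in>{0..M}. - C * s powr p - b \<le> F s) \<and> (\<forall>s\<in>{0..M}. F s \<le> G) \<and> G + b < c * M powr p"
proof -
  have F0: "F 0 = 0" using F[of 0] by simp
  have conv: "- C * s powr p \<le> F s" "F s \<le> A * s powr p"
    if "0 < s" "- C < F s / s powr p \<and> F s / s powr p < A'" for s
    using that A' by (auto simp: field_simps intro: order_trans[OF less_imp_le])
  have up: "A * s powr p \<le> A * M powr p" if "0 \<le> s" "s \<le> M" for s M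
    using that A p by (intro mult_left_mono powr_mono2) auto
  show ?thesis
  proof (cases "l = 0")
    case True
    then obtain s0 where s0: "0 < s0" "\<And>s. 0 < s \<Longrightarrow> s < s0 \<Longrightarrow> - C < F s / s powr p \<and> F s / s powr p < A'"
      using ev by (auto simp: tends_to_end_def eventually_at_right_field)
    have "\<forall>\<^sub>F M in at_right 0. 0 < M \<and> M < s0"
      using s0(1) by (auto simp: eventually_at_right_field)
    then have "\<forall>\<^sub>F M in at_right 0. \<exists>b G. 0 \<le> b \<and> 0 \<le> G \<and>
    (\<forall>s\<in>{0..M}. - C * s powr p - b \<le> F s) \<and> (\<forall>s\<in>{0..M}. F s \<le> G) \<and> G + b < c * M powr p"
    proof eventually_elim
      case (elim M)
      have "- C * s powr p \<le> F s \<and> F s \<le> A * M powr p" if "s \<in> {0..M}" for s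
      proof (cases "s = 0")
        case False
        then have "0 < s" "s < s0" using that elim by auto
        from conv[OF this(1) s0(2)[OF this]] show ?thesis using up[of s M] that by auto
      qed (use F0 A in auto)
      then show ?case using A elim
        by (intro exI[of _ 0] exI[of _ "A * M powr p"]) auto
    qed
    then show ?thesis using True by (simp add: tends_to_end_def)
  next
    case False
    then obtain s1 where s1: "\<And>s. s1 \<le> s \<Longrightarrow> - C < F s / s powr p \<and> F s / s powr p < A'"
      using ev by (auto simp: tends_to_end_def eventually_at_top_linorder)
    define s0 where "s0 = max s1 1"
    have s0: "0 < s0" "\<And>s. s0 \<le> s \<Longrightarrow> - C < F s / s powr p \<and> F s / s powr p < A'"
      using s1 by (auto simp: s0_def)
    have "continuous_on {0..s0} (\<lambda>s. integral {0..s} f)"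
      using f by (intro indefinite_integral_continuous_1 integrable_continuous_interval)
        (auto intro: continuous_on_subset)
    then obtain K where K: "0 \<le> K" "\<And>s. s \<in> {0..s0} \<Longrightarrow> \<bar>integral {0..s} f\<bar> \<le> K"
      using continuous_on_interval_bounded by blast
    have "filterlim (\<lambda>M. (c - A) * M powr p) at_top at_top"
    proof (rule filterlim_tendsto_pos_mult_at_top[OF tendsto_const])
      show "filterlim (\<lambda>M. M powr p) at_top at_top" using p by real_asymp
    qed (use A in simp)
    then have "\<forall>\<^sub>F M in at_top. 2 * K < (c - A) * M powr p" by (simp add: filterlim_at_top_dense)
    then have "\<forall>\<^sub>F M in at_top. \<exists>b G. 0 \<le> b \<and> 0 \<le> G \<and>
    (\<forall>s\<in>{0..M}. - C * s powr p - b \<le> F s) \<and> (\<forall>s\<in>{0..M}. F s \<le> G) \<and> G + b < c * M powr p"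
    proof eventually_elim
      case (elim M)
      have "- C * s powr p - K \<le> F s \<and> F s \<le> A * M powr p + K" if s: "s \<in> {0..M}" for s
      proof (cases "s \<le> s0")
        case True
        have "\<bar>F s\<bar> \<le> K" using K(2)[of s] F[of s] s True by simp
        moreover have "0 \<le> C * s powr p" "0 \<le> A * M powr p" using C A by auto
        ultimately show ?thesis by linarith
      next
        case False
        then have "- C * s powr p \<le> F s" "F s \<le> A * s powr p"
          using conv[of s] s0 by auto
        then show ?thesis using up[of s M] s K(1) by auto
      qed
      moreover have "(A * M powr p + K) + K < c * M powr p" using elim by (simp add: algebra_simps)
      moreover have "0 \<le> A * M powr p + K" using A K(1) by simp
      ultimately show ?case using K(1)
        by (intro exI[of _ K] exI[of _ "A * M powr p + K"]) auto
    qed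
    then show ?thesis using False by (simp add: tends_to_end_def)
  qed
qed

lemma no_bifurcation_point:
  fixes \<Omega> :: "'a::euclidean_space set" and f F :: "real \<Rightarrow> real"
  assumes \<Omega>: "open \<Omega>" and \<rho>: "0 < \<rho>" "\<Omega> \<subseteq> cball 0 \<rho>" and p: "1 < p"
    and f: "continuous_on UNIV f" and F: "\<And>s. 0 \<le> s \<Longrightarrow> F s = integral {0..s} f"
    and l: "l \<in> {0, \<infinity>}" and C: "0 < C" and A: "0 \<le> A" "A' \<le> A"
    and ev: "\<forall>\<^sub>F s in tends_to_end l. - C < F s / s powr p \<and> F s / s powr p < A'"
    and small: "A < C / (exp ((p / (p - 1) * \<Lambda> * C) powr (1 / p) * (2 * \<rho>)) - 1) powr p"
    and \<mu>: "\<mu> < \<Lambda>"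
  shows "\<not> bifurcation_point \<Omega> p f l \<mu>"
proof
  assume "bifurcation_point \<Omega> p f l \<mu>"
  then obtain lams :: "nat \<Rightarrow> real" and us :: "nat \<Rightarrow> 'a \<Rightarrow> real" where
    sol: "\<And>n. 0 < lams n" "\<And>n. bounded_solution \<Omega> p f (lams n) (us n)"
      "\<And>n. AE x in lebesgue_on \<Omega>. 0 \<le> us n x" "\<And>n. \<not> (AE x in lebesgue_on \<Omega>. us n x = 0)"
    and lim: "lams \<longlonglongrightarrow> \<mu>" "(\<lambda>n. Linf_norm \<Omega> (us n)) \<longlonglongrightarrow> l"
    unfolding bifurcation_point_def by blast
  have "\<exists>M>0. Linf_norm \<Omega> (us n) = ereal M" for n
  proof -
    have fin: "Linf_norm \<Omega> (us n) < \<infinity>" using sol(2)[of n] by (simp add: bounded_solution_def Linf_def)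
    have "\<not> Linf_norm \<Omega> (us n) \<le> 0"
    proof
      assume le: "Linf_norm \<Omega> (us n) \<le> 0"
      have "AE x in lebesgue_on \<Omega>. ereal \<bar>us n x\<bar> \<le> Linf_norm \<Omega> (us n)"
        unfolding Linf_norm_def by (rule esssup_AE)
      then have "AE x in lebesgue_on \<Omega>. us n x = 0"
      proof eventually_elim
        case (elim x)
        then have "ereal \<bar>us n x\<bar> \<le> 0" using le by (rule order_trans)
        then show ?case by simp
      qed
      then show False using sol(4) by blast
    qed
    then show ?thesis using fin by (cases "Linf_norm \<Omega> (us n)") auto
  qed
  then obtain Ms where Ms: "\<And>n. 0 < Ms n" "\<And>n. Linf_norm \<Omega> (us n) = ereal (Ms n)" by metis
  have "filterlim Ms (tends_to_end l) sequentially"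
  proof (cases "l = 0")
    case True
    then have "(\<lambda>n. ereal (Ms n)) \<longlonglongrightarrow> ereal 0" using lim(2) unfolding Ms(2) by (simp add: zero_ereal_def)
    then have "Ms \<longlonglongrightarrow> 0" by (simp only: lim_ereal)
    then show ?thesis using Ms(1) True
      by (auto simp: tends_to_end_def filterlim_at intro!: always_eventually less_imp_neq[symmetric])
  next
    case False
    then have "(\<lambda>n. ereal (Ms n)) \<longlonglongrightarrow> \<infinity>" using lim(2) l unfolding Ms(2) by auto
    then show ?thesis using False by (simp add: tends_to_end_def tendsto_PInfty_eq_at_top)
  qed
  moreover have "\<forall>\<^sub>F M in tends_to_end l. \<exists>b G. 0 \<le> b \<and> 0 \<le> G \<and>
    (\<forall>s\<in>{0..M}. - C * s powr p - b \<le> F s) \<and> (\<forall>s\<in>{0..M}. F s \<le> G) \<and>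
    G + b < C / (exp ((p / (p - 1) * \<Lambda> * C) powr (1 / p) * (2 * \<rho>)) - 1) powr p * M powr p"
    by (rule primitive_bounds_near_end[OF p f F l C A(1) small ev A(2)])
  ultimately have "\<forall>\<^sub>F n in sequentially. \<exists>b G. 0 \<le> b \<and> 0 \<le> G \<and>
    (\<forall>s\<in>{0..Ms n}. - C * s powr p - b \<le> F s) \<and> (\<forall>s\<in>{0..Ms n}. F s \<le> G) \<and>
    G + b < C / (exp ((p / (p - 1) * \<Lambda> * C) powr (1 / p) * (2 * \<rho>)) - 1) powr p * Ms n powr p"
    by (rule eventually_compose_filterlim[rotated])
  then have "\<forall>\<^sub>F n in sequentially. lams n < \<Lambda> \<and> (\<exists>b G. 0 \<le> b \<and> 0 \<le> G \<and>
    (\<forall>s\<in>{0..Ms n}. - C * s powr p - b \<le> F s) \<and> (\<forall>s\<in>{0..Ms n}. F s \<le> G) \<and>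
    G + b < C / (exp ((p / (p - 1) * \<Lambda> * C) powr (1 / p) * (2 * \<rho>)) - 1) powr p * Ms n powr p)"
    using order_tendstoD(2)[OF lim(1) \<mu>] by eventually_elim blast
  then obtain n b G where n: "lams n < \<Lambda>" "0 \<le> b" "0 \<le> G"
    "\<And>s. s \<in> {0..Ms n} \<Longrightarrow> - C * s powr p - b \<le> F s" "\<And>s. s \<in> {0..Ms n} \<Longrightarrow> F s \<le> G"
    "G + b < C / (exp ((p / (p - 1) * \<Lambda> * C) powr (1 / p) * (2 * \<rho>)) - 1) powr p * Ms n powr p"
    unfolding eventually_sequentially by (meson order_refl)
  show False
    by (rule no_bounded_solution[OF \<Omega> \<rho> p f F sol(1) less_imp_le[OF n(1)] sol(2,3) Ms(2,1) C n(2-6)])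
qed

text \<open>\<open>thr \<Lambda>\<close> is the threshold below which the upper slope \<open>A\<close> of \<open>F\<close> must lie to exclude parameters less than
  \<open>\<Lambda>\<close>. It is positive for \<open>\<Lambda> > 0\<close>, which settles the case \<open>Lplus \<le> 0\<close>. In general \<open>\<Lambda>\<close> is chosen such that
  the exponent in \<open>thr \<Lambda>\<close> equals \<open>ln 2 / 2\<close>; then \<open>thr \<Lambda> > C\<close>, and \<open>A = C\<close> is admissible.\<close>

theorem theorem1p3:
  fixes \<Omega> :: "(real ^ 'N) set"
    and p :: real
    and l Lminus Lplus :: ereal
    and f F :: "real \<Rightarrow> real"
    and \<alpha> :: "nat \<Rightarrow> real"
  assumes "open \<Omega>" "connected \<Omega>" "\<Omega> \<noteq> {}" "bounded \<Omega>"
    and "1 < p"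
    and "l \<in> {0, \<infinity>}"
    and "continuous_on UNIV f"
    and F: "\<And>s. 0 \<le> s \<Longrightarrow> F s = integral {0..s} f"
    and "\<And>n. 0 < \<alpha> n" "(\<lambda>n. ereal (\<alpha> n)) \<longlonglongrightarrow> l" "\<And>n. f (\<alpha> n) = 0"
    and "Lminus = Liminf (tends_to_end l) (\<lambda>s. ereal (F s / s powr p))"
    and "Lplus = Limsup (tends_to_end l) (\<lambda>s. ereal (F s / s powr p))"
    and "- \<infinity> < Lminus" "Lminus \<le> Lplus" "Lplus < \<infinity>"
  shows "(\<exists>lam::ereal. 0 < lam \<and>
            (\<forall>\<mu>::real. 0 \<le> \<mu> \<and> ereal \<mu> < lam \<longrightarrow> \<not> bifurcation_point \<Omega> p f l \<mu>)) \<and>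
         (Lplus < 0 \<or> (Lminus = 0 \<and> Lplus = 0) \<longrightarrow>
            (\<forall>\<mu>::real. 0 \<le> \<mu> \<and> ereal \<mu> < \<infinity> \<longrightarrow> \<not> bifurcation_point \<Omega> p f l \<mu>))"
proof -
  note p = \<open>1 < p\<close>
  obtain \<rho> where \<rho>: "0 < \<rho>" "\<Omega> \<subseteq> cball 0 \<rho>"
    using bounded_subset_ballD[OF \<open>bounded \<Omega>\<close>, of 0] ball_subset_cball by blast
  obtain a1 a2 where a: "Lminus = ereal a1" "Lplus = ereal a2"
    using assms(14-16) by (cases Lminus; cases Lplus) auto
  define C where "C = max (max (- a1) a2) 0 + 1"
  have C: "0 < C" "- C < a1" "a2 < C" by (auto simp: C_def)
  have ev: "\<forall>\<^sub>F s in tends_to_end l. - C < F s / s powr p \<and> F s / s powr p < A" if "a2 < A" for A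
  proof -
    have "\<forall>\<^sub>F s in tends_to_end l. ereal (- C) < ereal (F s / s powr p)"
      using C(2) a(1) assms(12) by (intro less_LiminfD) simp
    moreover have "\<forall>\<^sub>F s in tends_to_end l. ereal (F s / s powr p) < ereal A"
      using that a(2) assms(13) by (intro Limsup_lessD) simp
    ultimately show ?thesis by eventually_elim simp
  qed
  define thr where "thr \<Lambda> = C / (exp ((p / (p - 1) * \<Lambda> * C) powr (1 / p) * (2 * \<rho>)) - 1) powr p" for \<Lambda>
  have no_bif: "\<not> bifurcation_point \<Omega> p f l \<mu>" if "0 \<le> A" "a2 < A" "A < thr \<Lambda>" "\<mu> < \<Lambda>" for A \<Lambda> \<mu>
    by (rule no_bifurcation_point[OF assms(1) \<rho> p assms(7) F assms(6) C(1) that(1) order_refl ev[OF that(2)]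
          that(3)[unfolded thr_def] that(4)])
  define \<Lambda> where "\<Lambda> = (ln 2 / (4 * \<rho>)) powr p / (p / (p - 1) * C)"
  have \<Lambda>: "0 < \<Lambda>" using \<rho>(1) p C(1) by (simp add: \<Lambda>_def)
  have "C < thr \<Lambda>"
  proof -
    have "p / (p - 1) * \<Lambda> * C = (ln 2 / (4 * \<rho>)) powr p"
      using p C(1) by (simp add: \<Lambda>_def)
    then have \<kappa>: "(p / (p - 1) * \<Lambda> * C) powr (1 / p) * (2 * \<rho>) = ln 2 / 2"
      using p \<rho>(1) by (simp add: powr_powr)
    have "exp (ln 2 / 2) < exp (ln 2 :: real)" by (subst exp_less_cancel_iff) simp
    then have y: "exp (ln 2 / 2) - 1 < (1::real)" "0 < exp (ln 2 / 2) - (1::real)" by simp_all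
    then have "(exp (ln 2 / 2) - 1) powr p < (1::real) powr p" using p by (intro powr_less_mono2) auto
    then show ?thesis
      unfolding thr_def \<kappa> using y(2) C(1) by (simp add: less_divide_eq)
  qed
  then have "\<forall>\<mu>::real. 0 \<le> \<mu> \<and> ereal \<mu> < ereal \<Lambda> \<longrightarrow> \<not> bifurcation_point \<Omega> p f l \<mu>"
    using no_bif[of C \<Lambda>] C by auto
  moreover have "\<not> bifurcation_point \<Omega> p f l \<mu>" if "Lplus < 0 \<or> (Lminus = 0 \<and> Lplus = 0)" "0 \<le> \<mu>" for \<mu>
  proof -
    have "a2 \<le> 0" using that(1) a by auto
    have "0 < (p / (p - 1) * (\<mu> + 1) * C) powr (1 / p) * (2 * \<rho>)"
      using p C(1) \<rho>(1) that(2) by simp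
    moreover define y where "y = exp ((p / (p - 1) * (\<mu> + 1) * C) powr (1 / p) * (2 * \<rho>))"
    ultimately have "1 < y" by (simp only: one_less_exp_iff)
    moreover have "thr (\<mu> + 1) = C / (y - 1) powr p" unfolding thr_def y_def ..
    ultimately have "0 < thr (\<mu> + 1)" using C(1) by simp
    then show ?thesis using \<open>a2 \<le> 0\<close> by (intro no_bif[of "thr (\<mu> + 1) / 2" "\<mu> + 1"]) auto
  qed
  ultimately show ?thesis
    using \<Lambda> by (intro conjI exI[of _ "ereal \<Lambda>"]) auto
qed

end
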